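(* Let $n\ge 1$, let each $f_{i,j}:\mathbb{R}^p\to\mathbb{R}$ ($1\le i\le n$, $1\le j\le m_i$) be differentiable, $\mu$-strongly convex and $L$-smooth with constants $\mu,L>0$, and let $W\in\mathbb{R}^{n\times n}$ be primitive and doubly stochastic. Let $\sigma$ be the second largest singular value of $W$, $M=\max_i m_i$ and $Q=L/\mu$. Then, with a suitable choice of the step-size $\alpha>0$ and the inner-loop length $K$, the algorithm GT-SVRG (defined in the context) achieves $\epsilon$-accuracy (in terms of distance to the minimizer $x^*$ of $f$) with $$\mathcal{O}\left(\left(M+\frac{Q^2}{(1-\sigma)^2}\right)\log\frac{1}{\epsilon}\right)$$ local component gradient computations at each node. That is, there is a universal constant $C>0$ such that, for suitable $\alpha$ and $K$ and all sufficiently small $\epsilon>0$ (how small may depend on the problem data and the initial points), there is an outer iteration $t$ with $\mathbb{E}\big[\|\mathbf{x}_i^{t,0}-x^*\|^2\big]\le\epsilon$ for all $i$, before which each node has evaluated at most $C\big(M+\frac{Q^2}{(1-\sigma)^2}\big)\log\frac1\epsilon$ gradients of its component functions $f_{i,j}$.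
   Context: Problem: minimize $f(x)=\frac1n\sum_{i=1}^n f_i(x)$ over $x\in\mathbb{R}^p$, where $f_i(x)=\frac1{m_i}\sum_{j=1}^{m_i}f_{i,j}(x)$. $\mu$-strong convexity: $f_{i,j}(y)\ge f_{i,j}(x)+\langle\nabla f_{i,j}(x),y-x\rangle+\frac{\mu}{2}\|x-y\|^2$ for all $x,y$; $L$-smoothness: $\|\nabla f_{i,j}(x)-\nabla f_{i,j}(y)\|\le L\|x-y\|$ for all $x,y$. The unique minimizer of $f$ is $x^*$. $W=\{w_{ir}\}$; it is assumed that $\sigma<1$. Algorithm GT-SVRG (step-size $\alpha>0$, inner-loop length $K\ge1$). Arbitrary deterministic $\mathbf{x}_i^{0,0}\in\mathbb{R}^p$; $\mathbf{y}_i^{0,0}=\mathbf{v}_i^{0,0}=\widetilde\nabla_i^0=\nabla f_i(\mathbf{x}_i^{0,0})$. For $t=0,1,2,\dots$: for $k=0,\dots,K-1$, each node $i$ sets $\mathbf{x}_i^{t,k+1}=\sum_{r=1}^n w_{ir}\mathbf{x}_r^{t,k}-\alpha\mathbf{y}_i^{t,k}$; draws $s_i^{t,k+1}$ uniformly at random from $\{1,\dots,m_i\}$ (all draws independent over nodes and iterations); sets $\mathbf{v}_i^{t,k+1}=\nabla f_{i,s_i^{t,k+1}}(\mathbf{x}_i^{t,k+1})-\nabla f_{i,s_i^{t,k+1}}(\mathbf{x}_i^{t,0})+\widetilde\nabla_i^t$ and $\mathbf{y}_i^{t,k+1}=\sum_{r=1}^n w_{ir}\mathbf{y}_r^{t,k}+\mathbf{v}_i^{t,k+1}-\mathbf{v}_i^{t,k}$.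 After the inner loop, $\mathbf{x}_i^{t+1,0}=\mathbf{x}_i^{t,K}$, $\mathbf{y}_i^{t+1,0}=\mathbf{y}_i^{t,K}$, $\mathbf{v}_i^{t+1,0}=\mathbf{v}_i^{t,K}$, and $\widetilde\nabla_i^{t+1}=\nabla f_i(\mathbf{x}_i^{t+1,0})$. Cost: one outer iteration (one inner loop plus one local full gradient) costs node $i$ exactly $m_i+2K$ component gradient evaluations. *)

theory Defs
  imports
    "HOL-Probability.Probability"
    "Jordan_Normal_Form.Char_Poly"
begin

(* The complexity bound has one constant C for all dimensions p and all network sizes n. Both are
   therefore quantified inside the theorem, and R^p and R^(n x n) are carrier_vec p and
   carrier_mat n n. Nodes and components are numbered from 0: i < n and j < m i. *)

hide_type (open) Finite_Cartesian_Product.vec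
hide_const (open) Finite_Cartesian_Product.vec
unbundle no vec_syntax
unbundle no inner_syntax

definition eucl_norm :: "real vec \<Rightarrow> real" where
  "eucl_norm x = sqrt (x \<bullet> x)"

definition has_gradient :: "nat \<Rightarrow> (real vec \<Rightarrow> real) \<Rightarrow> real vec \<Rightarrow> real vec \<Rightarrow> bool" where
  "has_gradient p \<phi> g x \<longleftrightarrow> g \<in> carrier_vec p \<and>
     (\<forall>e>0. \<exists>d>0. \<forall>h\<in>carrier_vec p. eucl_norm h < d \<longrightarrow>
        \<bar>\<phi> (x + h) - \<phi> x - g \<bullet> h\<bar> \<le> e * eucl_norm h)"

definition differentiable_fun :: "nat \<Rightarrow> (real vec \<Rightarrow> real) \<Rightarrow> bool" where
  "differentiable_fun p \<phi> \<longleftrightarrow> (\<forall>x\<in>carrier_vec p. \<exists>g. has_gradient p \<phi> g x)"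

definition grad :: "nat \<Rightarrow> (real vec \<Rightarrow> real) \<Rightarrow> real vec \<Rightarrow> real vec" where
  "grad p \<phi> x = (THE g. has_gradient p \<phi> g x)"

definition strongly_convex :: "nat \<Rightarrow> real \<Rightarrow> (real vec \<Rightarrow> real) \<Rightarrow> bool" where
  "strongly_convex p \<mu> \<phi> \<longleftrightarrow> (\<forall>x\<in>carrier_vec p. \<forall>y\<in>carrier_vec p.
     \<phi> y \<ge> \<phi> x + grad p \<phi> x \<bullet> (y - x) + \<mu> / 2 * (eucl_norm (x - y))\<^sup>2)"

definition smooth :: "nat \<Rightarrow> real \<Rightarrow> (real vec \<Rightarrow> real) \<Rightarrow> bool" where
  "smooth p L \<phi> \<longleftrightarrow> (\<forall>x\<in>carrier_vec p. \<forall>y\<in>carrier_vec p.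
     eucl_norm (grad p \<phi> x - grad p \<phi> y) \<le> L * eucl_norm (x - y))"

definition local_obj :: "(nat \<Rightarrow> nat) \<Rightarrow> (nat \<Rightarrow> nat \<Rightarrow> real vec \<Rightarrow> real) \<Rightarrow> nat \<Rightarrow> real vec \<Rightarrow> real" where
  "local_obj m f i x = (1 / real (m i)) * (\<Sum>j<m i. f i j x)"

definition global_obj ::
  "nat \<Rightarrow> (nat \<Rightarrow> nat) \<Rightarrow> (nat \<Rightarrow> nat \<Rightarrow> real vec \<Rightarrow> real) \<Rightarrow> real vec \<Rightarrow> real" where
  "global_obj n m f x = (1 / real n) * (\<Sum>i<n. local_obj m f i x)"

definition nonneg_matrix :: "real mat \<Rightarrow> bool" where
  "nonneg_matrix W \<longleftrightarrow> (\<forall>i<dim_row W. \<forall>j<dim_col W. 0 \<le> W $$ (i, j))"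

definition doubly_stochastic :: "nat \<Rightarrow> real mat \<Rightarrow> bool" where
  "doubly_stochastic n W \<longleftrightarrow> W \<in> carrier_mat n n \<and> nonneg_matrix W \<and>
     (\<forall>i<n. (\<Sum>j<n. W $$ (i, j)) = 1) \<and> (\<forall>j<n. (\<Sum>i<n. W $$ (i, j)) = 1)"

definition primitive_matrix :: "nat \<Rightarrow> real mat \<Rightarrow> bool" where
  "primitive_matrix n W \<longleftrightarrow> W \<in> carrier_mat n n \<and> nonneg_matrix W \<and>
     (\<exists>k\<ge>1. \<forall>i<n. \<forall>j<n. 0 < (W ^\<^sub>m k) $$ (i, j))"

(* In decreasing order and with multiplicity. All roots of this characteristic polynomial are
   real and nonnegative, so a square matrix of size n has a list of length n. *)
definition singular_values :: "real mat \<Rightarrow> real list" where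
  "singular_values A =
     rev (sorted_list_of_multiset (image_mset sqrt (proots (char_poly (A\<^sup>T * A)))))"

(* A matrix of size 1 has no second singular value. There the value is 0, which is the spectral
   norm of W - (1/n) 1 1^T for the only doubly stochastic W of that size. *)
definition second_singular_value :: "real mat \<Rightarrow> real" where
  "second_singular_value A =
     (if length (singular_values A) < 2 then 0 else singular_values A ! 1)"

record gt_state =
  st_x :: "nat \<Rightarrow> real vec"
  st_y :: "nat \<Rightarrow> real vec"
  st_v :: "nat \<Rightarrow> real vec"

definition mix :: "nat \<Rightarrow> nat \<Rightarrow> real mat \<Rightarrow> (nat \<Rightarrow> real vec) \<Rightarrow> nat \<Rightarrow> real vec" where
  "mix p n W z i = vec p (\<lambda>d. \<Sum>r<n. W $$ (i, r) * z r $ d)"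

(* Here z is the snapshot x^(t,0) and s i is the component drawn by node i. *)
definition gt_step ::
  "nat \<Rightarrow> nat \<Rightarrow> (nat \<Rightarrow> nat) \<Rightarrow> (nat \<Rightarrow> nat \<Rightarrow> real vec \<Rightarrow> real) \<Rightarrow> real mat \<Rightarrow> real \<Rightarrow>
   (nat \<Rightarrow> real vec) \<Rightarrow> (nat \<Rightarrow> nat) \<Rightarrow> gt_state \<Rightarrow> gt_state" where
  "gt_step p n m f W \<alpha> z s S =
     (let x' = (\<lambda>i. mix p n W (st_x S) i - \<alpha> \<cdot>\<^sub>v st_y S i);
          v' = (\<lambda>i. grad p (f i (s i)) (x' i) - grad p (f i (s i)) (z i)
                     + grad p (local_obj m f i) (z i));
          y' = (\<lambda>i. mix p n W (st_y S) i + v' i - st_v S i)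
      in \<lparr>st_x = x', st_y = y', st_v = v'\<rparr>)"

primrec gt_inner ::
  "nat \<Rightarrow> nat \<Rightarrow> (nat \<Rightarrow> nat) \<Rightarrow> (nat \<Rightarrow> nat \<Rightarrow> real vec \<Rightarrow> real) \<Rightarrow> real mat \<Rightarrow> real \<Rightarrow>
   (nat \<times> nat \<times> nat \<Rightarrow> nat) \<Rightarrow> nat \<Rightarrow> gt_state \<Rightarrow> nat \<Rightarrow> gt_state" where
  "gt_inner p n m f W \<alpha> s t S 0 = S"
| "gt_inner p n m f W \<alpha> s t S (Suc k) =
     gt_step p n m f W \<alpha> (st_x S) (\<lambda>i. s (t, Suc k, i)) (gt_inner p n m f W \<alpha> s t S k)"

(* The state (x^(t,0), y^(t,0), v^(t,0)) as a function of the realised draws s. *)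
primrec gt_svrg ::
  "nat \<Rightarrow> nat \<Rightarrow> (nat \<Rightarrow> nat) \<Rightarrow> (nat \<Rightarrow> nat \<Rightarrow> real vec \<Rightarrow> real) \<Rightarrow> real mat \<Rightarrow> real \<Rightarrow> nat \<Rightarrow>
   (nat \<Rightarrow> real vec) \<Rightarrow> (nat \<times> nat \<times> nat \<Rightarrow> nat) \<Rightarrow> nat \<Rightarrow> gt_state" where
  "gt_svrg p n m f W \<alpha> K x0 s 0 =
     \<lparr>st_x = x0, st_y = (\<lambda>i. grad p (local_obj m f i) (x0 i)),
      st_v = (\<lambda>i. grad p (local_obj m f i) (x0 i))\<rparr>"
| "gt_svrg p n m f W \<alpha> K x0 s (Suc t) =
     gt_inner p n m f W \<alpha> s t (gt_svrg p n m f W \<alpha> K x0 s t) K"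

(* The law of the draws: coordinate (t, k, i) is the component drawn by node i in inner
   iteration k of outer iteration t. *)
definition draws :: "nat \<Rightarrow> (nat \<Rightarrow> nat) \<Rightarrow> (nat \<times> nat \<times> nat \<Rightarrow> nat) measure" where
  "draws n m = PiM (UNIV \<times> {1..} \<times> {..<n}) (\<lambda>(t, k, i). measure_pmf (pmf_of_set {..<m i}))"

(* Each outer iteration costs one local full gradient (m i evaluations) and K inner iterations
   of two component gradients each. *)
definition component_grads :: "(nat \<Rightarrow> nat) \<Rightarrow> nat \<Rightarrow> nat \<Rightarrow> nat \<Rightarrow> nat" where
  "component_grads m K i t = t * (m i + 2 * K)"

end

(* With d = 1 - sigma, step size alpha = mu d^2 / (2000 L^2) and K of order Q^2 / d^2, write e for
   n times the squared distance of the network mean to x*, X for the consensus error and Y for the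
   gradient-tracking error (all in expectation). One inner iteration gives a linear recursion: e
   contracts by 1 - alpha mu / 2 up to multiples of X and of the gradient noise, X and Y contract by
   1 - d, and Y is driven by L^2 / d times the squared distances to x* of the current iterates and
   of the snapshots. Unbiasedness of the variance-reduced gradient is needed only for e; everywhere
   else the noise is bounded pathwise. With U = e + X + 8 (alpha / d)^2 Y this yields
   U(t+1) <= (U(t) + U(t-1)) / 4 over one outer iteration, hence U(t) <= (3/4)^t U(0). The dependence
   on U(t-1) comes from the first inner iteration of a loop, whose gradient estimate still refers
   to the previous snapshot. *)
theory Submission
  imports Defs
begin

text \<open>The powers of d are balanced by the round trip of an error through consensus and back.
  In normalised form \<open>e\<close> feeds the consensus part with factor 1440 a c / d, that part
  contracts at rate d / 2, and it feeds \<open>e\<close> with factor 4 c d^2, where a = \<alpha>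
  \<mu> and c = 1 / 2000. The resulting gain 11520 a c^2 is free of d, which is what \<alpha>
  proportional to d^2 achieves, and c keeps it far below the rate a / 4 at which \<open>e\<close>
  contracts. An inner loop must then last a multiple of 1 / a = 2000 Q^2 / d^2 steps, whence the
  second term of the cost.

  Two interfaces are not analytic. The second singular value is an entry of a sorted list of
  characteristic roots, while the recursion needs a contraction of vectors with sum zero; the
  maximiser of the quadratic form on such vectors links the two without a diagonalisation.
  Conditional expectations are avoided: every quantity is a function of finitely many draws, and
  unbiasedness is an average over one resampled coordinate.\<close>

section \<open>Scalar recursions\<close>

text \<open>Normalisation: \<open>a = \<alpha> \<mu>\<close>, \<open>y = (\<alpha> / \<delta>)\<^sup>2 Y\<close> and \<open>n = \<alpha>\<^sup>2 N\<close> for the tracking error \<open>Y\<close> and the gradient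
  noise \<open>N\<close>; the step size then gives \<open>\<alpha> L\<^sup>2 / \<mu> = c \<delta>\<^sup>2\<close> and \<open>\<alpha>\<^sup>2 L\<^sup>2 = a c \<delta>\<^sup>2\<close>. \<open>Z\<close> is the snapshot error.\<close>

lemma gt_step_recursion:
  fixes a c \<delta> e e' X X' y y' n n' Z :: real
  assumes c: "c = 1 / 2000" and \<delta>: "0 < \<delta>" "\<delta> \<le> 1" and a: "0 < a" "a \<le> c * \<delta>\<^sup>2"
    and nn: "0 \<le> e" "0 \<le> X" "0 \<le> y" "0 \<le> Z"
    and n: "n \<le> 8 * (a * c * \<delta>\<^sup>2) * (e + X + Z)"
    and n': "n' \<le> 8 * (a * c * \<delta>\<^sup>2) * (e' + X' + Z)"
    and e': "e' \<le> (1 - a / 2) * e + 3 * c * \<delta>\<^sup>2 * X + n"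
    and X': "X' \<le> (1 - \<delta>) * X + 2 * \<delta> * y"
    and y': "y' \<le> (1 - \<delta>) * y + 6 / \<delta>^3 * (n' + n + 2 * (a * c * \<delta>\<^sup>2) * (e' + X' + (e + X)))"
  shows "e' \<le> (1 - a / 4) * e + 4 * c * \<delta>\<^sup>2 * X + 8 * a * c * \<delta>\<^sup>2 * Z"
    and "X' + 8 * y' \<le> (1 - \<delta> / 2) * (X + 8 * y) + 1440 * (a * c / \<delta>) * (e + Z)"
proof -
  \<comment> \<open>\<open>r\<close> is \<open>a * c * \<delta>\<^sup>2 / \<delta>^3\<close>, the
    noise factor as it reaches the tracking error. Since
    \<open>a \<le> c * \<delta>\<^sup>2\<close>, it is at most \<open>c\<^sup>2 * \<delta>\<close>,
    so the feedback from \<open>X\<close> and \<open>y\<close> is a tiny fraction of their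
    contraction.\<close>
  define r where "r = a * c / \<delta>"
  have d2: "0 < \<delta>\<^sup>2" "\<delta>\<^sup>2 \<le> 1" using \<delta> by (auto simp: power_le_one)
  have a1: "a \<le> 1/2000" using a(2) d2 c by (simp add: field_simps)
  have acd: "a * c * \<delta>\<^sup>2 \<le> a * c" using d2 a c by (simp add: mult_left_le)
  have acd0: "0 \<le> a * c * \<delta>\<^sup>2" using d2 a c by simp
  have acd2: "a * c * \<delta>\<^sup>2 \<le> c * \<delta>\<^sup>2 / 2000" using mult_right_mono[OF a1, of "c * \<delta>\<^sup>2"] d2 c by (simp add: mult.assoc)
  have ne: "a * c * \<delta>\<^sup>2 * e \<le> a * c * e" using mult_right_mono[OF acd nn(1)] .
  have nX: "a * c * \<delta>\<^sup>2 * X \<le> c * \<delta>\<^sup>2 * X / 2000" using mult_right_mono[OF acd2 nn(2)] by simp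
  have cX: "0 \<le> c * \<delta>\<^sup>2 * X" using c nn d2 by simp
  show e1: "e' \<le> (1 - a / 4) * e + 4 * c * \<delta>\<^sup>2 * X + 8 * a * c * \<delta>\<^sup>2 * Z"
  proof -
    have "e' \<le> (1 - a / 2) * e + 3 * c * \<delta>\<^sup>2 * X + 8 * (a * c * \<delta>\<^sup>2) * (e + X + Z)" using e' n by linarith
    also have "\<dots> = (1 - a / 2) * e + 3 * c * \<delta>\<^sup>2 * X + 8 * (a * c * \<delta>\<^sup>2 * e) + 8 * (a * c * \<delta>\<^sup>2 * X) + 8 * a * c * \<delta>\<^sup>2 * Z"
      by (simp add: algebra_simps)
    also have "\<dots> \<le> (1 - a / 2) * e + 3 * c * \<delta>\<^sup>2 * X + 8 * (a * c * e) + 8 * (c * \<delta>\<^sup>2 * X / 2000) + 8 * a * c * \<delta>\<^sup>2 * Z"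
      using ne nX by linarith
    also have "\<dots> \<le> (1 - a / 4) * e + 4 * c * \<delta>\<^sup>2 * X + 8 * a * c * \<delta>\<^sup>2 * Z"
    proof -
      have "8 * (a * c * e) \<le> a / 4 * e" using a nn by (simp add: c)
      thus ?thesis using cX by (simp add: algebra_simps)
    qed
    finally show ?thesis .
  qed
  \<comment> \<open>The tracking bound contains the new \<open>e' + X'\<close>, directly and through
    \<open>n'\<close>. Both summands are bounded by old quantities only, so nothing circular remains
    after substitution.\<close>
  have D': "e' + X' \<le> e + 2 * X + Z + 2 * \<delta> * y"
  proof -
    have "a * c * \<delta>\<^sup>2 * Z \<le> 1/8 * Z"
    proof (rule mult_right_mono)
      show "a * c * \<delta>\<^sup>2 \<le> 1/8" using acd a1 unfolding c by linarith
    qed (rule nn)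
    moreover have "c * \<delta>\<^sup>2 * X \<le> 1/4 * X" using d2 nn unfolding c by (intro mult_right_mono) auto
    moreover have "a * e \<ge> 0" "\<delta> * X \<ge> 0" using a nn \<delta> by auto
    ultimately show ?thesis using e1 X' by (simp add: algebra_simps)
  qed
  have r0: "0 \<le> r" using a c \<delta> by (simp add: r_def)
  have r1: "r \<le> c\<^sup>2 * \<delta>"
    using a \<delta> by (simp add: r_def c field_simps power2_eq_square)
  have "n' + n + 2 * (a * c * \<delta>\<^sup>2) * (e' + X' + (e + X)) \<le>
      (a * c * \<delta>\<^sup>2) * (10 * (e' + X') + 10 * (e + X) + 16 * Z)"
    using n n' by (simp add: algebra_simps)
  also have "\<dots> \<le> (a * c * \<delta>\<^sup>2) * (20 * e + 30 * X + 26 * Z + 20 * (\<delta> * y))"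
    using D' acd0 by (intro mult_left_mono) auto
  finally have "6 / \<delta>^3 * (n' + n + 2 * (a * c * \<delta>\<^sup>2) * (e' + X' + (e + X)))
     \<le> 6 / \<delta>^3 * ((a * c * \<delta>\<^sup>2) * (20 * e + 30 * X + 26 * Z + 20 * (\<delta> * y)))"
    using \<delta> by (intro mult_left_mono) auto
  also have "\<dots> = 6 * r * (20 * e + 30 * X + 26 * Z + 20 * (\<delta> * y))"
    using \<delta> by (simp add: r_def power2_eq_square power3_eq_cube)
  finally have y1: "y' \<le> (1 - \<delta>) * y + 6 * r * (20 * e + 30 * X + 26 * Z + 20 * (\<delta> * y))"
    using y' by linarith
  have rX: "r * X \<le> c\<^sup>2 * (\<delta> * X)" using mult_right_mono[OF r1 nn(2)] by simp
  have "r * \<delta> \<le> c\<^sup>2 * \<delta>" using mult_left_le[of \<delta> r] r0 \<delta> r1 by linarith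
  hence ry: "r * (\<delta> * y) \<le> c\<^sup>2 * (\<delta> * y)" using mult_right_mono[of "r * \<delta>" "c\<^sup>2 * \<delta>" y] nn(3) by (simp add: mult.assoc)
  have "8 * y' \<le> 8 * (1 - \<delta>) * y + 960 * (r * e) + 1440 * (r * X) + 1248 * (r * Z) + 960 * (r * (\<delta> * y))"
    using y1 by (simp add: algebra_simps)
  also have "\<dots> \<le> 8 * (1 - \<delta>) * y + 1440 * (r * e) + 1440 * (c\<^sup>2 * (\<delta> * X)) + 1440 * (r * Z) + 960 * (c\<^sup>2 * (\<delta> * y))"
    using rX ry mult_nonneg_nonneg[OF r0 nn(1)] mult_nonneg_nonneg[OF r0 nn(4)] by linarith
  finally have "X' + 8 * y' \<le> (1 - \<delta>) * X + 2 * \<delta> * y +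
      (8 * (1 - \<delta>) * y + 1440 * (r * e) + 1440 * (c\<^sup>2 * (\<delta> * X)) + 1440 * (r * Z) + 960 * (c\<^sup>2 * (\<delta> * y)))"
    using X' by linarith
  \<comment> \<open>The weight 8 leaves room for \<open>2 * \<delta> * y\<close>: of the decrease
    \<open>8 * \<delta> * y\<close> there remain 6 parts, and only 4 are claimed.\<close>
  also have "\<dots> \<le> (1 - \<delta> / 2) * (X + 8 * y) + 1440 * r * (e + Z)"
  proof -
    have "0 \<le> \<delta> * X" "0 \<le> \<delta> * y" using \<delta> nn by auto
    thus ?thesis by (simp add: c power2_eq_square algebra_simps)
  qed
  finally show "X' + 8 * y' \<le> (1 - \<delta> / 2) * (X + 8 * y) + 1440 * (a * c / \<delta>) * (e + Z)"
    by (simp add: r_def)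
qed

text \<open>\<open>B\<close> is the fixed point of the affine map, so the offset stays
  \<open>B\<close> instead of accumulating with \<open>k\<close>.\<close>

lemma affine_recursion_bound:
  fixes u :: "nat \<Rightarrow> real"
  assumes "\<And>k. k < K \<Longrightarrow> u (Suc k) \<le> (1 - \<rho>) * u k + \<rho> * B" "0 \<le> \<rho>" "\<rho> \<le> 1" "0 \<le> B" "k \<le> K"
  shows "u k \<le> (1 - \<rho>) ^ k * u 0 + B"
  using assms(5)
proof (induction k)
  case (Suc k)
  have "u (Suc k) \<le> (1 - \<rho>) * u k + \<rho> * B" using Suc assms by auto
  also have "\<dots> \<le> (1 - \<rho>) * ((1 - \<rho>) ^ k * u 0 + B) + \<rho> * B"
    using Suc assms by (intro add_right_mono mult_left_mono) auto
  also have "\<dots> = (1 - \<rho>) ^ Suc k * u 0 + B" by (simp add: algebra_simps)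
  finally show ?case .
qed (use assms in auto)

text \<open>The power is at most \<open>exp (-4)\<close>, and \<open>exp 1\<close> is at least 2. At
  the rate \<open>a / 8\<close> the premise reads \<open>32 / a \<le> K\<close>, the origin of the
  inner-loop length.\<close>

lemma one_minus_power_le_sixteenth:
  fixes \<rho> :: real
  assumes "0 < \<rho>" "\<rho> \<le> 1" "4 / \<rho> \<le> real K"
  shows "(1 - \<rho>) ^ K \<le> 1 / 16"
proof -
  have "1 - \<rho> \<le> exp (- \<rho>)" using exp_ge_add_one_self[of "-\<rho>"] by simp
  hence "(1 - \<rho>) ^ K \<le> exp (- \<rho>) ^ K" using assms by (intro power_mono) auto
  also have "\<dots> = exp (- (\<rho> * K))" by (simp add: exp_of_nat_mult[symmetric] mult.commute)
  also have "\<dots> \<le> exp (- 4)" using assms by (simp add: field_simps)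
  also have "exp (-4) \<le> (1/16::real)"
  proof -
    have "(2::real) \<le> exp 1" using exp_ge_add_one_self[of 1] by simp
    hence "(2::real) ^ 4 \<le> exp 1 ^ 4" by (intro power_mono) auto
    also have "exp 1 ^ 4 = exp (4::real)" by (simp add: exp_of_nat_mult[symmetric])
    finally show ?thesis by (simp add: exp_minus field_simps)
  qed
  finally show ?thesis .
qed

text \<open>The sum \<open>e + 16 c \<delta> (X + 8 y)\<close> contracts by \<open>1 - a / 8\<close> in every step and bounds \<open>e\<close> along
  the loop. With the weight of order \<open>\<delta>\<close> it would not control the snapshot error, so the
  consensus part \<open>X + 8 y\<close>, which contracts at the faster rate \<open>1 - \<delta> / 2\<close>, is bounded separately.\<close>

lemma gt_inner_loop_contraction:
  fixes a c \<delta> Z :: real and e X y n :: "nat \<Rightarrow> real"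
  assumes c: "c = 1 / 2000" and \<delta>: "0 < \<delta>" "\<delta> \<le> 1" and a: "0 < a" "a \<le> c * \<delta>\<^sup>2"
    and nn: "\<And>k. 0 \<le> e k" "\<And>k. 0 \<le> X k" "\<And>k. 0 \<le> y k" "0 \<le> Z"
    and n: "\<And>k. k \<le> K \<Longrightarrow> n k \<le> 8 * (a * c * \<delta>\<^sup>2) * (e k + X k + Z)"
    and e': "\<And>k. k < K \<Longrightarrow> e (Suc k) \<le> (1 - a / 2) * e k + 3 * c * \<delta>\<^sup>2 * X k + n k"
    and X': "\<And>k. k < K \<Longrightarrow> X (Suc k) \<le> (1 - \<delta>) * X k + 2 * \<delta> * y k"
    and y': "\<And>k. k < K \<Longrightarrow> y (Suc k) \<le> (1 - \<delta>) * y k + 6 / \<delta>^3 *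
       (n (Suc k) + n k + 2 * (a * c * \<delta>\<^sup>2) * (e (Suc k) + X (Suc k) + (e k + X k)))"
    and K: "32 / a \<le> real K"
  shows "e K + X K + 8 * y K \<le> (e 0 + X 0 + 8 * y 0) / 7 + Z / 12"
proof -
  define S where "S k = X k + 8 * y k" for k
  have d2: "0 < \<delta>\<^sup>2" "\<delta>\<^sup>2 \<le> \<delta>" "\<delta>\<^sup>2 \<le> 1" using \<delta> by (auto simp: power2_eq_square mult_left_le mult_le_one)
  have S0: "0 \<le> S k" for k using nn by (simp add: S_def)
  have a8: "a / 8 \<le> \<delta> / 4" and a1: "a \<le> 1 / 2000" and ad: "a / \<delta>\<^sup>2 \<le> 1 / 2000"
    using a(2) d2 c \<delta> by (auto simp: field_simps)
  note st = gt_step_recursion[OF c \<delta> a nn(1-4) n[OF less_imp_le] n[OF Suc_leI] e' X' y']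
  have eS: "e (Suc k) \<le> (1 - a / 4) * e k + 4 * c * \<delta>\<^sup>2 * S k + 8 * a * c * \<delta>\<^sup>2 * Z" if "k < K" for k
  proof -
    have "4 * c * \<delta>\<^sup>2 * X k \<le> 4 * c * \<delta>\<^sup>2 * S k" using nn c by (intro mult_left_mono) (auto simp: S_def)
    thus ?thesis using st(1)[OF that that that that that] by linarith
  qed
  have SS: "S (Suc k) \<le> (1 - \<delta> / 2) * S k + 1440 * (a * c / \<delta>) * (e k + Z)" if "k < K" for k
    using st(2)[OF that that that that that] by (simp add: S_def)
  \<comment> \<open>With this weight half of the contraction of \<open>S\<close>, namely
    \<open>16 * c * \<delta> * \<delta> / 4\<close>, equals the inflow
    \<open>4 * c * \<delta>\<^sup>2\<close> from \<open>S\<close> into \<open>e\<close>. The return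
    flow has factor \<open>23040 * a * c * c\<close>, about \<open>0.006 * a\<close>, and is covered
    by the gap between \<open>a / 4\<close> and \<open>a / 8\<close>.\<close>
  define V where "V k = e k + 16 * c * \<delta> * S k" for k
  have VV: "V (Suc k) \<le> (1 - a / 8) * V k + (a / 8) * (0.08 * Z)" if "k < K" for k
  proof -
    have "V (Suc k) \<le> ((1 - a / 4) * e k + 4 * c * \<delta>\<^sup>2 * S k + 8 * a * c * \<delta>\<^sup>2 * Z)
        + 16 * c * \<delta> * ((1 - \<delta> / 2) * S k + 1440 * (a * c / \<delta>) * (e k + Z))"
      unfolding V_def using c \<delta> by (intro add_mono eS SS mult_left_mono that) simp
    also have "\<dots> = (1 - a / 4) * e k + 16 * c * \<delta> * (1 - \<delta> / 4) * S k + 8 * a * c * \<delta>\<^sup>2 * Z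
        + 23040 * (a * c * c) * (e k + Z)"
      using \<delta> by (simp add: field_simps power2_eq_square)
    also have "\<dots> \<le> (1 - a / 8) * e k + 16 * c * \<delta> * (1 - a / 8) * S k + (a / 8) * (0.08 * Z)"
    proof -
      have 1: "16 * c * \<delta> * (1 - \<delta> / 4) * S k \<le> 16 * c * \<delta> * (1 - a / 8) * S k"
        using a8 c \<delta> S0 by (intro mult_right_mono mult_left_mono) auto
      have "a * \<delta>\<^sup>2 * Z \<le> a * 1 * Z" using d2 a nn by (intro mult_right_mono mult_left_mono) auto
      hence 2: "8 * a * c * \<delta>\<^sup>2 * Z \<le> 0.004 * (a * Z)" by (simp add: c)
      have 3: "23040 * (a * c * c) * (e k + Z) = 0.00576 * (a * e k) + 0.00576 * (a * Z)" by (simp add: c algebra_simps)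
      have "0 \<le> a * e k" "0 \<le> a * Z" using a nn by auto
      \<comment> \<open>\<open>0.004 + 0.00576\<close> is below \<open>0.08 / 8\<close>, which fixes
        the offset \<open>0.08 * Z\<close>.\<close>
      hence "(1 - a / 4) * e k + 0.004 * (a * Z) + (0.00576 * (a * e k) + 0.00576 * (a * Z)) \<le> (1 - a / 8) * e k + (a / 8) * (0.08 * Z)"
        by (simp add: algebra_simps)
      with 1 2 3 show ?thesis by linarith
    qed
    also have "\<dots> = (1 - a / 8) * V k + (a / 8) * (0.08 * Z)" by (simp add: V_def algebra_simps)
    finally show ?thesis .
  qed
  define U where "U = e 0 + S 0"
  have U0: "0 \<le> U" "S 0 \<le> U" using nn S0 by (auto simp: U_def)
  have V0: "0 \<le> V 0" "V 0 \<le> U"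
  proof -
    show "0 \<le> V 0" using nn S0 c \<delta> by (simp add: V_def)
    have "16 * c * \<delta> \<le> 1" using \<delta> by (simp add: c)
    hence "16 * c * \<delta> * S 0 \<le> 1 * S 0" using S0 by (intro mult_right_mono)
    thus "V 0 \<le> U" by (simp add: V_def U_def)
  qed
  have eV: "e k \<le> V k" for k using S0 c \<delta> by (simp add: V_def)
  have Vk: "V k \<le> (1 - a / 8) ^ k * V 0 + 0.08 * Z" if "k \<le> K" for k
    using affine_recursion_bound[of K V, OF VV _ _ _ that] a a1 nn by auto
  have ek: "e k \<le> U + 0.08 * Z" if "k \<le> K" for k
  proof -
    have "(1 - a / 8) ^ k * V 0 \<le> 1 * U" using V0 a a1 by (intro mult_mono power_le_one) auto
    thus ?thesis using Vk[OF that] eV[of k] by simp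
  qed
  have eK: "e K \<le> U / 16 + 0.08 * Z"
  proof -
    have "(1 - a / 8) ^ K \<le> 1 / 16" using one_minus_power_le_sixteenth[of "a / 8" K] a a1 K by simp
    hence "(1 - a / 8) ^ K * V 0 \<le> 1 / 16 * U" using V0 a a1 by (intro mult_mono) auto
    thus ?thesis using Vk[of K] eV[of K] by simp
  qed
  have SK: "S K \<le> U / 16 + 0.001 * (U + 1.08 * Z)"
  proof -
    have step: "S (Suc k) \<le> (1 - \<delta> / 2) * S k + (\<delta> / 2) * (0.001 * (U + 1.08 * Z))" if "k < K" for k
    proof -
      have "1440 * (a * c / \<delta>) \<le> (\<delta> / 2) * 0.001"
        using ad \<delta> a(1) by (simp add: c field_simps power2_eq_square)
      hence "1440 * (a * c / \<delta>) * (e k + Z) \<le> (\<delta> / 2) * 0.001 * (U + 1.08 * Z)"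
      proof (rule mult_mono)
        show "e k + Z \<le> U + 1.08 * Z" using ek[of k] that by simp
        show "0 \<le> e k + Z" using nn(1)[of k] nn(4) by simp
      qed (use \<delta> in auto)
      hence "1440 * (a * c / \<delta>) * (e k + Z) \<le> (\<delta> / 2) * (0.001 * (U + 1.08 * Z))"
        by (simp only: mult.assoc)
      thus ?thesis using SS[OF that] by linarith
    qed
    \<comment> \<open>The rate \<open>\<delta> / 2\<close> needs \<open>8 / \<delta>\<close> steps;
      the loop, sized for the slower rate \<open>a / 8\<close>, is longer.\<close>
    have "32 / (4 * \<delta>) \<le> 32 / a" using a8 a \<delta> by (intro divide_left_mono) auto
    hence "(1 - \<delta> / 2) ^ K \<le> 1 / 16" using one_minus_power_le_sixteenth[of "\<delta> / 2" K] \<delta> K by simp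
    hence "(1 - \<delta> / 2) ^ K * S 0 \<le> 1 / 16 * U" using U0 S0 by (intro mult_mono) auto
    thus ?thesis using affine_recursion_bound[of K S, OF step _ _ _ order_refl] \<delta> nn U0 by simp
  qed
  \<comment> \<open>The totals are \<open>(1/8 + 0.001) * U\<close> and
    \<open>(0.08 + 0.00108) * Z\<close>, below \<open>U / 7\<close> and
    \<open>Z / 12\<close>.\<close>
  show ?thesis using eK SK U0(1) nn(4) unfolding S_def U_def by (simp add: add_divide_distrib)
qed

text \<open>A rate \<open>r\<close> must satisfy \<open>(r + 1) / 4 \<le> r * r\<close>;
  \<open>3 / 4\<close> is a round value above the root \<open>(1 + sqrt 17) / 8\<close>. The
  two-term recursion requires the bound for \<open>t\<close> and \<open>Suc t\<close> at
  once.\<close>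

lemma two_step_contraction:
  fixes U :: "nat \<Rightarrow> real"
  assumes "U (Suc 0) \<le> U 0 / 2" "\<And>t. U (Suc (Suc t)) \<le> (U (Suc t) + U t) / 4" "\<And>t. 0 \<le> U t"
  shows "U t \<le> U 0 * (3 / 4) ^ t"
proof -
  have "U t \<le> U 0 * (3 / 4) ^ t \<and> U (Suc t) \<le> U 0 * (3 / 4) ^ Suc t"
  proof (induction t)
    case 0 thus ?case using assms(1) assms(3)[of 0] by simp
  next
    case (Suc t)
    have "U (Suc (Suc t)) \<le> (U 0 * (3 / 4) ^ Suc t + U 0 * (3 / 4) ^ t) / 4" using assms(2)[of t] Suc by simp
    also have "\<dots> \<le> U 0 * (3 / 4) ^ Suc (Suc t)" using assms(3)[of 0] by simp
    finally show ?case using Suc by simp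
  qed
  thus ?thesis by simp
qed

text \<open>\<open>ln (1 / \<epsilon>)\<close> must absorb two constants. Below
  \<open>1 / (P + 1)\<close> the factor \<open>P\<close> is at most \<open>1 / \<epsilon>\<close>,
  so it suffices that the power reaches \<open>\<epsilon> * \<epsilon>\<close>; as
  \<open>3/4 \<le> exp (-1/4)\<close>, this takes \<open>8 * l\<close> iterations. Below
  \<open>exp (-1)\<close> the logarithm \<open>l\<close> is at least 1 and pays for rounding up,
  hence 9.\<close>

lemma geometric_decay_iterations:
  fixes P :: real
  assumes P: "0 \<le> P"
  shows "\<exists>\<epsilon>0>0. \<epsilon>0 \<le> 1 \<and> (\<forall>\<epsilon>. 0 < \<epsilon> \<and> \<epsilon> < \<epsilon>0 \<longrightarrow> (\<exists>t::nat. P * (3/4)^t \<le> \<epsilon> \<and> real t \<le> 9 * ln (1 / \<epsilon>)))"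
proof (rule exI[of _ "min (exp (-1)) (1 / (P + 1))"], intro conjI allI impI)
  show "0 < min (exp (-1)) (1 / (P + 1))" using P by simp
  show "min (exp (-1)) (1 / (P + 1)) \<le> 1" by (simp add: min.coboundedI1)
  fix \<epsilon> :: real assume "0 < \<epsilon> \<and> \<epsilon> < min (exp (-1)) (1 / (P + 1))"
  hence \<epsilon>: "0 < \<epsilon>" "\<epsilon> < exp (-1)" "\<epsilon> < 1 / (P + 1)" by auto
  define l where "l = ln (1 / \<epsilon>)"
  have l1: "1 \<le> l" 
  proof -
    have "ln \<epsilon> \<le> ln (exp (-1))" using \<epsilon> by (intro ln_mono) auto
    thus ?thesis using \<epsilon> by (simp add: l_def ln_div)
  qed
  define t where "t = nat \<lceil>8 * l\<rceil>"
  have t1: "8 * l \<le> real t" "real t \<le> 8 * l + 1" using l1 unfolding t_def by linarith+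
  have "P \<le> 1 / \<epsilon>" using \<epsilon> P by (simp add: field_simps)
  have "(3/4::real) \<le> exp (- (1/4))" using exp_ge_add_one_self[of "-(1/4)"] by simp
  hence "(3/4::real) ^ t \<le> exp (- (1/4)) ^ t" by (intro power_mono) auto
  also have "\<dots> = exp (- (real t / 4))" by (simp add: exp_of_nat_mult[symmetric])
  also have "\<dots> \<le> exp (- (2 * l))" using t1 by simp
  also have "\<dots> = \<epsilon> * \<epsilon>" using \<epsilon> by (simp add: l_def ln_div mult_exp_exp[symmetric] exp_double power2_eq_square)
  finally have "P * (3/4)^t \<le> (1 / \<epsilon>) * (\<epsilon> * \<epsilon>)"
    using \<open>P \<le> 1 / \<epsilon>\<close> P \<epsilon> by (intro mult_mono) auto
  also have "\<dots> = \<epsilon>" using \<epsilon> by simp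
  finally show "\<exists>t::nat. P * (3/4)^t \<le> \<epsilon> \<and> real t \<le> 9 * ln (1 / \<epsilon>)"
    using t1 l1 by (intro exI[of _ t]) (auto simp: l_def)
qed

section \<open>Averages and consensus in an inner product space\<close>

text \<open>Young's inequality, from the square of
  \<open>s *\<^sub>R a - (1 / s) *\<^sub>R b\<close> with \<open>s\<close> the root of \<theta>. A
  small \<theta> barely enlarges a contracting term \<open>a\<close> and charges the perturbation
  \<open>b\<close> instead.\<close>

lemma norm_add_power2_le:
  fixes a b :: "'a :: real_inner"
  assumes \<theta>: "0 < \<theta>"
  shows "(norm (a + b))\<^sup>2 \<le> (1 + \<theta>) * (norm a)\<^sup>2 + (1 + 1 / \<theta>) * (norm b)\<^sup>2"
proof -
  obtain s where s: "0 < s" "\<theta> = s * s" using \<theta> real_sqrt_gt_zero[OF \<theta>] by (metis abs_of_pos real_sqrt_mult_self)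
  have "0 \<le> (norm (s *\<^sub>R a - (1 / s) *\<^sub>R b))\<^sup>2" by simp
  also have "\<dots> = \<theta> * (norm a)\<^sup>2 - 2 * inner a b + (1 / \<theta>) * (norm b)\<^sup>2"
    using s by (simp add: power2_norm_eq_inner inner_diff_left inner_diff_right inner_commute[of b a] field_simps)
  finally show ?thesis
    by (simp add: power2_norm_eq_inner inner_add_left inner_add_right inner_commute[of b a] distrib_right)
qed

lemma norm_add_power2_le_double:
  fixes a b :: "'a :: real_inner"
  shows "(norm (a + b))\<^sup>2 \<le> 2 * (norm a)\<^sup>2 + 2 * (norm b)\<^sup>2"
  using norm_add_power2_le[of 1 a b] by simp

lemma norm_diff_power2_le_double:
  fixes a b :: "'a :: real_inner"
  shows "(norm (a - b))\<^sup>2 \<le> 2 * (norm a)\<^sup>2 + 2 * (norm b)\<^sup>2"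
  using norm_add_power2_le_double[of a "- b"] by simp

lemma norm_add3_power2_le:
  fixes a b c :: "'a :: real_inner"
  shows "(norm (a + b + c))\<^sup>2 \<le> 3 * ((norm a)\<^sup>2 + (norm b)\<^sup>2 + (norm c)\<^sup>2)"
  using norm_add_power2_le[of "1/2" "a + b" c] norm_add_power2_le_double[of a b] by simp

lemma norm_diff_scaleR_power2:
  fixes a b :: "'a :: real_inner"
  shows "(norm (a - c *\<^sub>R b))\<^sup>2 = (norm a)\<^sup>2 - 2 * c * inner a b + c\<^sup>2 * (norm b)\<^sup>2"
  unfolding power2_norm_eq_inner
  by (simp add: inner_diff_left inner_diff_right inner_commute[of b a] power2_eq_square algebra_simps)

definition avg :: "nat \<Rightarrow> (nat \<Rightarrow> 'a :: real_vector) \<Rightarrow> 'a" where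
  "avg n z = (1 / real n) *\<^sub>R (\<Sum>i<n. z i)"

lemma avg_add: "avg n (\<lambda>i. z i + u i) = avg n z + avg n u"
  and avg_diff: "avg n (\<lambda>i. z i - u i) = avg n z - avg n u"
  and avg_scaleR: "avg n (\<lambda>i. c *\<^sub>R z i) = c *\<^sub>R avg n z"
  by (simp_all add: avg_def sum.distrib sum_subtractf scaleR_add_right scaleR_diff_right scaleR_sum_right mult.commute)

lemma sum_eq_avg: "1 \<le> n \<Longrightarrow> (\<Sum>i<n. z i) = real n *\<^sub>R avg n z"
  by (simp add: avg_def)

lemma avg_cong: "(\<And>i. i < n \<Longrightarrow> z i = u i) \<Longrightarrow> avg n z = avg n u"
  by (simp add: avg_def)

text \<open>Parallel axis identity: deviations from the mean sum to 0, so the mixed term vanishes.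
  With the minimizer as \<open>c\<close> it splits the total error into mean error and consensus
  error; with \<open>c = 0\<close> it gives the two inequalities that follow.\<close>

lemma sum_norm_power2_about_avg:
  fixes z :: "nat \<Rightarrow> 'a :: real_inner"
  assumes n: "1 \<le> n"
  shows "(\<Sum>i<n. (norm (z i - c))\<^sup>2) = (\<Sum>i<n. (norm (z i - avg n z))\<^sup>2) + real n * (norm (avg n z - c))\<^sup>2"
proof -
  define m where "m = avg n z"
  have "(norm (z i - c))\<^sup>2 = (norm (z i - m))\<^sup>2 + 2 * inner (z i - m) (m - c) + (norm (m - c))\<^sup>2" for i
    using dot_norm[of "z i - m" "m - c"] by (simp add: field_simps)
  hence "(\<Sum>i<n. (norm (z i - c))\<^sup>2) = (\<Sum>i<n. (norm (z i - m))\<^sup>2) + 2 * inner (\<Sum>i<n. z i - m) (m - c) + real n * (norm (m - c))\<^sup>2"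
    by (simp add: sum.distrib inner_sum_left sum_distrib_left)
  moreover have "(\<Sum>i<n. z i - m) = 0"
    using sum_eq_avg[OF n, of z] by (simp add: m_def sum_subtractf sum_constant_scaleR)
  ultimately show ?thesis by (simp add: m_def)
qed

lemma sum_norm_power2_centered_le:
  fixes z :: "nat \<Rightarrow> 'a :: real_inner"
  assumes "1 \<le> n"
  shows "(\<Sum>i<n. (norm (z i - avg n z))\<^sup>2) \<le> (\<Sum>i<n. (norm (z i))\<^sup>2)"
  using sum_norm_power2_about_avg[OF assms, of z 0] by simp

lemma norm_avg_power2_le:
  fixes z :: "nat \<Rightarrow> 'a :: real_inner"
  assumes "1 \<le> n"
  shows "real n * (norm (avg n z))\<^sup>2 \<le> (\<Sum>i<n. (norm (z i))\<^sup>2)"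
  using sum_norm_power2_about_avg[OF assms, of z 0] by (simp add: sum_nonneg)

lemma avg_mix:
  fixes z :: "nat \<Rightarrow> 'a :: real_vector"
  assumes "\<And>r. r < n \<Longrightarrow> (\<Sum>i<n. w i r) = 1"
  shows "avg n (\<lambda>i. \<Sum>r<n. w i r *\<^sub>R z r) = avg n z"
proof -
  have "(\<Sum>i<n. \<Sum>r<n. w i r *\<^sub>R z r) = (\<Sum>r<n. (\<Sum>i<n. w i r) *\<^sub>R z r)"
    by (subst sum.swap) (simp add: scaleR_sum_left)
  thus ?thesis using assms by (simp add: avg_def)
qed

text \<open>By the row sums, subtracting the mean commutes with mixing; by the column sums, the mean
  of \<open>T\<close> is the sum of the means. What is mixed has sum 0, so \<open>contr\<close>
  applies. Young's inequality with weight \<delta> leaves one factor of the contraction, as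
  \<open>(1 + \<delta>) * (1 - \<delta>)\<^sup>2 = (1 - \<delta>) * (1 - \<delta>\<^sup>2)\<close>.
  It serves the iterates with \<open>b = - \<alpha> y\<close> and the trackers with \<open>b\<close>
  the increment of the gradient estimates.\<close>

lemma consensus_step:
  fixes z b :: "nat \<Rightarrow> 'a :: real_inner"
  assumes n: "1 \<le> n" and row: "\<And>i. i < n \<Longrightarrow> (\<Sum>r<n. w i r) = 1"
    and col: "\<And>r. r < n \<Longrightarrow> (\<Sum>i<n. w i r) = 1" and \<delta>: "0 < \<delta>" "\<delta> \<le> 1"
    and contr: "\<And>z :: nat \<Rightarrow> 'a. (\<Sum>i<n. z i) = 0 \<Longrightarrow>
      (\<Sum>i<n. (norm (\<Sum>r<n. w i r *\<^sub>R z r))\<^sup>2) \<le> (1 - \<delta>)\<^sup>2 * (\<Sum>i<n. (norm (z i))\<^sup>2)"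
    and T: "\<And>i. i < n \<Longrightarrow> T i = (\<Sum>r<n. w i r *\<^sub>R z r) + b i"
  shows "(\<Sum>i<n. (norm (T i - avg n T))\<^sup>2) \<le>
    (1 - \<delta>) * (\<Sum>i<n. (norm (z i - avg n z))\<^sup>2) + 2 / \<delta> * (\<Sum>i<n. (norm (b i - avg n b))\<^sup>2)"
proof -
  define u where "u i = z i - avg n z" for i
  have u0: "(\<Sum>i<n. u i) = 0"
    using sum_eq_avg[OF n, of z] by (simp add: u_def sum_subtractf sum_constant_scaleR)
  have avgT: "avg n T = avg n z + avg n b"
    using avg_cong[of n T, OF T] by (simp add: avg_add avg_mix[OF col])
  have dev: "T i - avg n T = (\<Sum>r<n. w i r *\<^sub>R u r) + (b i - avg n b)" if "i < n" for i
  proof -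
    have "(\<Sum>r<n. w i r *\<^sub>R u r) = (\<Sum>r<n. w i r *\<^sub>R z r) - avg n z"
      using row[OF that] by (simp add: u_def scaleR_diff_right sum_subtractf scaleR_sum_left[symmetric])
    thus ?thesis using T[OF that] avgT by simp
  qed
  let ?u = "\<Sum>i<n. (norm (u i))\<^sup>2" and ?b = "\<Sum>i<n. (norm (b i - avg n b))\<^sup>2"
  have "(\<Sum>i<n. (norm (T i - avg n T))\<^sup>2) \<le>
      (\<Sum>i<n. (1 + \<delta>) * (norm (\<Sum>r<n. w i r *\<^sub>R u r))\<^sup>2 + (1 + 1 / \<delta>) * (norm (b i - avg n b))\<^sup>2)"
    using dev by (intro sum_mono) (simp add: norm_add_power2_le[OF \<delta>(1)])
  also have "\<dots> = (1 + \<delta>) * (\<Sum>i<n. (norm (\<Sum>r<n. w i r *\<^sub>R u r))\<^sup>2) + (1 + 1 / \<delta>) * ?b"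
    by (simp add: sum.distrib sum_distrib_left)
  also have "\<dots> \<le> (1 + \<delta>) * ((1 - \<delta>)\<^sup>2 * ?u) + (1 + 1 / \<delta>) * ?b"
    using contr[OF u0] \<delta> by (intro add_right_mono mult_left_mono) auto
  also have "\<dots> \<le> (1 - \<delta>) * ?u + 2 / \<delta> * ?b"
  proof (intro add_mono)
    have "(1 + \<delta>) * (1 - \<delta>)\<^sup>2 = (1 - \<delta>) * (1 - \<delta>\<^sup>2)" by (simp add: power2_eq_square algebra_simps)
    also have "\<dots> \<le> (1 - \<delta>) * 1" using \<delta> by (intro mult_left_mono) auto
    finally have "(1 + \<delta>) * (1 - \<delta>)\<^sup>2 * ?u \<le> (1 - \<delta>) * ?u" by (intro mult_right_mono sum_nonneg) auto
    thus "(1 + \<delta>) * ((1 - \<delta>)\<^sup>2 * ?u) \<le> (1 - \<delta>) * ?u" by (simp add: mult.assoc)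
    show "(1 + 1 / \<delta>) * ?b \<le> 2 / \<delta> * ?b"
      using \<delta> by (intro mult_right_mono sum_nonneg) (auto simp: field_simps)
  qed
  finally show ?thesis by (simp add: u_def)
qed

section \<open>Functions of finitely many independent draws\<close>

text \<open>Takes the place of measurability with respect to a filtration. It is required for all
  \<open>s\<close>, including values outside the supports, so that coordinates can be overwritten
  freely.\<close>

definition depends_on :: "'i set \<Rightarrow> (('i \<Rightarrow> 'a) \<Rightarrow> 'b) \<Rightarrow> bool" where
  "depends_on J F \<longleftrightarrow> (\<forall>s s'. (\<forall>c\<in>J. s c = s' c) \<longrightarrow> F s = F s')"

lemma depends_onD: "depends_on J F \<Longrightarrow> (\<And>c. c \<in> J \<Longrightarrow> s c = s' c) \<Longrightarrow> F s = F s'"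
  by (auto simp: depends_on_def)

lemma depends_on_mono: "depends_on J F \<Longrightarrow> J \<subseteq> J' \<Longrightarrow> depends_on J' F"
  by (auto simp: depends_on_def)

lemma depends_on_upd: "depends_on J F \<Longrightarrow> c \<notin> J \<Longrightarrow> F (s(c := y)) = F s"
  by (erule depends_onD) auto

locale finite_draws =
  fixes I :: "'i set" and P :: "'i \<Rightarrow> 'a :: countable pmf"
  assumes finite_support: "c \<in> I \<Longrightarrow> finite (set_pmf (P c))"
begin

sublocale product_prob_space "\<lambda>c. measure_pmf (P c)" I
  by (simp add: product_prob_space_def product_prob_space_axioms_def product_sigma_finite_def
      prob_space_measure_pmf prob_space_imp_sigma_finite)

abbreviation "law \<equiv> PiM I (\<lambda>c. measure_pmf (P c))"

text \<open>A finite product of discrete spaces over a countable type is discrete, so every function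
  is measurable. An infinite product is not discrete; the lemmas below therefore pass through
  \<open>restrict s J\<close>.\<close>

lemma borel_measurable_finite_PiM:
  fixes F :: "('i \<Rightarrow> 'a) \<Rightarrow> real"
  assumes "finite J"
  shows "F \<in> borel_measurable (PiM J (\<lambda>c. measure_pmf (P c)))"
proof -
  have "sets (PiM J (\<lambda>c. measure_pmf (P c))) = sets (PiM J (\<lambda>c. count_space (UNIV :: 'a set)))"
    by (rule sets_PiM_cong) auto
  also have "\<dots> = sets (count_space (PiE J (\<lambda>_. UNIV)))"
    using assms by (simp add: count_space_PiM_finite)
  finally have "borel_measurable (PiM J (\<lambda>c. measure_pmf (P c))) = (borel_measurable (count_space (PiE J (\<lambda>_. UNIV))) :: (('i \<Rightarrow> 'a) \<Rightarrow> real) set)"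
    by (intro measurable_cong_sets) auto
  thus ?thesis by simp
qed

lemma AE_support: "countable I \<Longrightarrow> AE s in law. \<forall>c\<in>I. s c \<in> set_pmf (P c)"
  by (intro AE_ball_countable' AE_PiM_component) (auto simp: prob_space_measure_pmf AE_measure_pmf)

lemma restrict_eq: "depends_on J F \<Longrightarrow> F (restrict s J) = F s"
  by (erule depends_onD) auto

text \<open>Almost surely the draws in \<open>J\<close> lie in a finite product of finite supports,
  so \<open>F\<close> is bounded by a maximum, without any growth condition.\<close>

lemma integrable_depends_on:
  fixes F :: "('i \<Rightarrow> 'a) \<Rightarrow> real"
  assumes F: "depends_on J F" and J: "finite J" "J \<subseteq> I"
  shows "integrable law F"
proof (rule integrable_const_bound)
  let ?B = "PiE J (\<lambda>c. set_pmf (P c))"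
  have "finite ?B" using J finite_support by (intro finite_PiE) auto
  hence fin: "finite ((\<lambda>s. norm (F s)) ` ?B)" by simp
  have "AE s in law. \<forall>c\<in>J. s c \<in> set_pmf (P c)"
    using J by (intro AE_ball_countable' AE_PiM_component)
      (auto simp: prob_space_measure_pmf AE_measure_pmf countable_finite)
  thus "AE s in law. norm (F s) \<le> Max ((\<lambda>s. norm (F s)) ` ?B)"
  proof (rule AE_mp, intro AE_I2 impI)
    fix s assume "\<forall>c\<in>J. s c \<in> set_pmf (P c)"
    hence "restrict s J \<in> ?B" by auto
    hence "norm (F (restrict s J)) \<le> Max ((\<lambda>s. norm (F s)) ` ?B)" using fin by (intro Max_ge) auto
    thus "norm (F s) \<le> Max ((\<lambda>s. norm (F s)) ` ?B)" by (simp add: restrict_eq[OF F])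
  qed
  have "(\<lambda>s. F (restrict s J)) \<in> borel_measurable law"
    by (rule measurable_compose[OF measurable_restrict_subset[OF J(2)] borel_measurable_finite_PiM[OF J(1)]])
  thus "F \<in> borel_measurable law" by (simp add: restrict_eq[OF F])
qed

lemma integral_depends_on:
  fixes F :: "('i \<Rightarrow> 'a) \<Rightarrow> real"
  assumes F: "depends_on J F" and J: "finite J" "J \<subseteq> I"
  shows "integral\<^sup>L law F = integral\<^sup>L (PiM J (\<lambda>c. measure_pmf (P c))) F"
proof -
  have "integral\<^sup>L (PiM J (\<lambda>c. measure_pmf (P c))) F =
      integral\<^sup>L (distr law (PiM J (\<lambda>c. measure_pmf (P c))) (\<lambda>s. restrict s J)) F"
    by (simp add: distr_PiM_restrict_finite[OF J])
  also have "\<dots> = integral\<^sup>L law (\<lambda>s. F (restrict s J))"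
    by (rule integral_distr[OF measurable_restrict_subset[OF J(2)] borel_measurable_finite_PiM[OF J(1)]])
  finally show ?thesis by (simp add: restrict_eq[OF F])
qed

text \<open>Fubini on the finite product over \<open>insert c K\<close>. The inner expectation is
  what conditioning on all draws but \<open>c\<close> would give.\<close>

lemma integral_resample:
  fixes F :: "('i \<Rightarrow> 'a) \<Rightarrow> real"
  assumes F: "depends_on J F" and J: "finite J" "J \<subseteq> I" and c: "c \<in> I"
  shows "integral\<^sup>L law F = integral\<^sup>L law (\<lambda>s. measure_pmf.expectation (P c) (\<lambda>y. F (s(c := y))))"
proof -
  define K where "K = J - {c}"
  have K: "finite K" "c \<notin> K" "K \<subseteq> I" "insert c K \<subseteq> I" using J c by (auto simp: K_def)
  have FK: "depends_on (insert c K) F" by (rule depends_on_mono[OF F]) (auto simp: K_def)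
  have G: "depends_on K (\<lambda>s. measure_pmf.expectation (P c) (\<lambda>y. F (s(c := y))))"
    unfolding depends_on_def
  proof (intro allI impI)
    fix s s' :: "'i \<Rightarrow> 'a" assume "\<forall>d\<in>K. s d = s' d"
    hence "F (s(c := y)) = F (s'(c := y))" for y by (intro depends_onD[OF FK]) auto
    thus "measure_pmf.expectation (P c) (\<lambda>y. F (s(c := y))) = measure_pmf.expectation (P c) (\<lambda>y. F (s'(c := y)))"
      by simp
  qed
  \<comment> \<open>Fubini needs integrability over the finitely many coordinates alone, so the
    locale is entered again with that index set.\<close>
  interpret K: finite_draws "insert c K" P by unfold_locales (use K finite_support in auto)
  have "integral\<^sup>L law F = integral\<^sup>L (PiM (insert c K) (\<lambda>c. measure_pmf (P c))) F"
    using K by (intro integral_depends_on[OF FK]) auto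
  also have "\<dots> = integral\<^sup>L (PiM K (\<lambda>c. measure_pmf (P c))) (\<lambda>s. measure_pmf.expectation (P c) (\<lambda>y. F (s(c := y))))"
    using K by (intro product_integral_insert K.integrable_depends_on[OF FK]) auto
  also have "\<dots> = integral\<^sup>L law (\<lambda>s. measure_pmf.expectation (P c) (\<lambda>y. F (s(c := y))))"
    using K by (intro integral_depends_on[OF G, symmetric]) auto
  finally show ?thesis .
qed

end

section \<open>Finitely supported sequences\<close>

text \<open>The dimension \<open>p\<close> is a variable, so no type represents exactly \<open>R^p\<close>. All \<open>carrier_vec p\<close> embed
  isometrically into this one inner product space.\<close>

typedef fsvec = "{f :: nat \<Rightarrow> real. finite {d. f d \<noteq> 0}}"
  morphisms coord Abs_fsvec
  by (rule exI[of _ "\<lambda>_. 0"]) simp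

setup_lifting type_definition_fsvec

lemma finite_coord: "finite {d. coord x d \<noteq> 0}"
  using coord[of x] by simp

lemma fsvec_eqI: "(\<And>d. coord x d = coord y d) \<Longrightarrow> x = y"
  by (simp add: coord_inject[symmetric] ext)

instantiation fsvec :: real_vector
begin

lift_definition zero_fsvec :: fsvec is "\<lambda>_. 0" by simp

lift_definition plus_fsvec :: "fsvec \<Rightarrow> fsvec \<Rightarrow> fsvec" is "\<lambda>x y d. x d + y d"
  subgoal for x y by (rule finite_subset[of _ "{d. x d \<noteq> 0} \<union> {d. y d \<noteq> 0}"]) auto
  done

lift_definition minus_fsvec :: "fsvec \<Rightarrow> fsvec \<Rightarrow> fsvec" is "\<lambda>x y d. x d - y d"
  subgoal for x y by (rule finite_subset[of _ "{d. x d \<noteq> 0} \<union> {d. y d \<noteq> 0}"]) auto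
  done

lift_definition uminus_fsvec :: "fsvec \<Rightarrow> fsvec" is "\<lambda>x d. - x d" by simp

lift_definition scaleR_fsvec :: "real \<Rightarrow> fsvec \<Rightarrow> fsvec" is "\<lambda>c x d. c * x d"
  by (erule finite_subset[rotated]) auto

instance
  by standard
    (rule fsvec_eqI; simp add: zero_fsvec.rep_eq plus_fsvec.rep_eq minus_fsvec.rep_eq
      uminus_fsvec.rep_eq scaleR_fsvec.rep_eq distrib_left distrib_right)+

end

instantiation fsvec :: real_inner
begin

definition inner_fsvec :: "fsvec \<Rightarrow> fsvec \<Rightarrow> real" where
  "inner_fsvec x y = (\<Sum>d | coord x d \<noteq> 0. coord x d * coord y d)"

definition norm_fsvec :: "fsvec \<Rightarrow> real" where "norm_fsvec x = sqrt (inner x x)"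
definition sgn_fsvec :: "fsvec \<Rightarrow> fsvec" where "sgn_fsvec x = x /\<^sub>R norm x"
definition dist_fsvec :: "fsvec \<Rightarrow> fsvec \<Rightarrow> real" where "dist_fsvec x y = norm (x - y)"
definition uniformity_fsvec :: "(fsvec \<times> fsvec) filter" where
  "uniformity_fsvec = (INF e\<in>{0 <..}. principal {(x, y). dist x y < e})"
definition open_fsvec :: "fsvec set \<Rightarrow> bool" where
  "open_fsvec U = (\<forall>x\<in>U. eventually (\<lambda>(x', y). x' = x \<longrightarrow> y \<in> U) uniformity)"

text \<open>The definition sums over the support of its left argument and is symmetric only in
  value. Computations replace that support by a common finite set.\<close>

lemma inner_fsvec_eq:
  assumes "finite A" "{d. coord x d \<noteq> 0} \<subseteq> A"
  shows "inner x y = (\<Sum>d\<in>A. coord x d * coord y d)"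
  unfolding inner_fsvec_def using assms by (intro sum.mono_neutral_left) auto

instance
proof
  fix x y z :: fsvec and r :: real
  let ?A = "{d. coord x d \<noteq> 0} \<union> {d. coord y d \<noteq> 0}"
  have fin: "finite ?A" using finite_coord by simp
  show "inner x y = inner y x"
    using inner_fsvec_eq[OF fin, of x y] inner_fsvec_eq[OF fin, of y x] by (simp add: mult.commute)
  show "inner (x + y) z = inner x z + inner y z"
  proof -
    have "inner (x + y) z = (\<Sum>d\<in>?A. coord (x + y) d * coord z d)"
      by (rule inner_fsvec_eq[OF fin]) (auto simp: plus_fsvec.rep_eq)
    also have "\<dots> = (\<Sum>d\<in>?A. coord x d * coord z d) + (\<Sum>d\<in>?A. coord y d * coord z d)"
      by (simp add: plus_fsvec.rep_eq distrib_right sum.distrib)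
    also have "\<dots> = inner x z + inner y z"
      by (intro arg_cong2[where f = "(+)"] inner_fsvec_eq[OF fin, symmetric]) auto
    finally show ?thesis .
  qed
  show "inner (r *\<^sub>R x) y = r * inner x y"
  proof -
    have "inner (r *\<^sub>R x) y = (\<Sum>d\<in>?A. coord (r *\<^sub>R x) d * coord y d)"
      by (rule inner_fsvec_eq[OF fin]) (auto simp: scaleR_fsvec.rep_eq)
    also have "\<dots> = r * (\<Sum>d\<in>?A. coord x d * coord y d)"
      by (simp add: scaleR_fsvec.rep_eq sum_distrib_left mult.assoc)
    also have "(\<Sum>d\<in>?A. coord x d * coord y d) = inner x y"
      by (rule inner_fsvec_eq[OF fin, symmetric]) auto
    finally show ?thesis .
  qed
  show "0 \<le> inner x x" by (simp add: inner_fsvec_def sum_nonneg)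
  show "(inner x x = 0) = (x = 0)"
  proof
    assume "inner x x = 0"
    hence "\<forall>d\<in>{d. coord x d \<noteq> 0}. coord x d * coord x d = 0"
      unfolding inner_fsvec_def using finite_coord by (subst (asm) sum_nonneg_eq_0_iff) auto
    thus "x = 0" by (intro fsvec_eqI) (auto simp: zero_fsvec.rep_eq)
  next
    assume "x = 0" thus "inner x x = 0" by (simp add: inner_fsvec_def zero_fsvec.rep_eq)
  qed
qed (rule norm_fsvec_def sgn_fsvec_def dist_fsvec_def uniformity_fsvec_def open_fsvec_def)+

end

lemma coord_simps [simp]:
  "coord 0 d = 0" "coord (x + y) d = coord x d + coord y d" "coord (x - y) d = coord x d - coord y d"
  "coord (c *\<^sub>R x) d = c * coord x d"
  by (simp_all add: zero_fsvec.rep_eq plus_fsvec.rep_eq minus_fsvec.rep_eq scaleR_fsvec.rep_eq)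

lemma coord_sum [simp]: "coord (\<Sum>i\<in>A. f i) d = (\<Sum>i\<in>A. coord (f i) d)"
  by (induction A rule: infinite_finite_induct) auto

lift_definition emb :: "real vec \<Rightarrow> fsvec" is "\<lambda>v d. if d < dim_vec v then v $ d else 0"
  by (rule finite_subset[of _ "{..<dim_vec _}"]) auto

definition unemb :: "nat \<Rightarrow> fsvec \<Rightarrow> real vec" where
  "unemb p x = vec p (coord x)"

lemma coord_emb: "coord (emb v) d = (if d < dim_vec v then v $ d else 0)"
  by (simp add: emb.rep_eq)

lemma unemb_carrier [simp]: "unemb p x \<in> carrier_vec p" "dim_vec (unemb p x) = p"
  by (simp_all add: unemb_def)

lemma unemb_emb: "v \<in> carrier_vec p \<Longrightarrow> unemb p (emb v) = v"
  by (auto simp: unemb_def coord_emb)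

lemma emb_add: "u \<in> carrier_vec p \<Longrightarrow> v \<in> carrier_vec p \<Longrightarrow> emb (u + v) = emb u + emb v"
  by (rule fsvec_eqI) (auto simp: coord_emb)

lemma emb_diff: "u \<in> carrier_vec p \<Longrightarrow> v \<in> carrier_vec p \<Longrightarrow> emb (u - v) = emb u - emb v"
  by (rule fsvec_eqI) (auto simp: coord_emb)

lemma emb_zero: "emb (0\<^sub>v p) = 0"
  by (rule fsvec_eqI) (simp add: coord_emb)

lemma emb_smult: "emb (c \<cdot>\<^sub>v v) = c *\<^sub>R emb v"
  by (rule fsvec_eqI) (auto simp: coord_emb)

lemma inner_emb:
  assumes "u \<in> carrier_vec p" "v \<in> carrier_vec p"
  shows "inner (emb u) (emb v) = u \<bullet> v"
proof -
  have "inner (emb u) (emb v) = (\<Sum>d<p. coord (emb u) d * coord (emb v) d)"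
    using assms by (intro inner_fsvec_eq) (auto simp: coord_emb)
  also have "\<dots> = u \<bullet> v"
    using assms by (auto simp: scalar_prod_def coord_emb atLeast0LessThan intro!: sum.cong)
  finally show ?thesis .
qed

lemma norm_emb: "norm (emb v) = eucl_norm v"
  unfolding norm_eq_sqrt_inner eucl_norm_def
  using inner_emb[OF carrier_vec_dim_vec carrier_vec_dim_vec] by simp

lemma subspace_emb: "subspace (emb ` carrier_vec p)"
proof (rule subspaceI)
  show "0 \<in> emb ` carrier_vec p" by (metis emb_zero imageI zero_carrier_vec)
qed (auto simp: emb_add[symmetric] emb_smult[symmetric])

lemma emb_mix:
  assumes "\<And>r. r < n \<Longrightarrow> z r \<in> carrier_vec p"
  shows "emb (mix p n W z i) = (\<Sum>r<n. W $$ (i, r) *\<^sub>R emb (z r))"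
proof (rule fsvec_eqI)
  fix d
  have "coord (emb (z r)) d = (if d < p then z r $ d else 0)" if "r < n" for r
    using assms[OF that] by (simp add: coord_emb)
  thus "coord (emb (mix p n W z i)) d = coord (\<Sum>r<n. W $$ (i, r) *\<^sub>R emb (z r)) d"
    by (simp add: coord_emb mix_def)
qed

section \<open>Gradients\<close>

lemma eucl_norm_nonneg [simp]: "0 \<le> eucl_norm v"
  by (simp add: norm_emb[symmetric])

lemma eucl_norm_smult: "eucl_norm (c \<cdot>\<^sub>v v) = \<bar>c\<bar> * eucl_norm v"
  by (simp add: norm_emb[symmetric] emb_smult)

text \<open>Homogeneity turns a bound for short vectors into one for \<open>d\<close>: it is tested
  at a small multiple \<open>t\<close> of \<open>d\<close>, and \<open>t\<close> cancels. With
  \<open>d = g\<close> it forces \<open>g\<close> to vanish, which yields both the uniqueness of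
  gradients and the first-order condition at a minimizer.\<close>

lemma linear_bound_imp_nonpos:
  assumes d: "d \<in> carrier_vec p"
    and bound: "\<And>e. 0 < e \<Longrightarrow> \<exists>r>0. \<forall>h\<in>carrier_vec p. eucl_norm h < r \<longrightarrow> g \<bullet> h \<le> e * eucl_norm h"
    and g: "g \<in> carrier_vec p"
  shows "g \<bullet> d \<le> 0"
proof (rule field_le_epsilon)
  fix e :: real assume e: "0 < e"
  \<comment> \<open>The \<open>+ 1\<close> covers \<open>d = 0\<close>.\<close>
  define e' where "e' = e / (eucl_norm d + 1)"
  have nd: "0 < eucl_norm d + 1" by (simp add: add_nonneg_pos)
  obtain r where r: "0 < r" and b: "\<And>h. h \<in> carrier_vec p \<Longrightarrow> eucl_norm h < r \<Longrightarrow> g \<bullet> h \<le> e' * eucl_norm h"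
    using bound[of e'] e nd unfolding e'_def by (metis divide_pos_pos)
  define t where "t = r / (eucl_norm d + 1)"
  have t: "0 < t" using r nd by (simp add: t_def)
  have "t * eucl_norm d < t * (eucl_norm d + 1)" using t by simp
  also have "\<dots> = r" using nd by (simp add: t_def)
  finally have "eucl_norm (t \<cdot>\<^sub>v d) < r" using t by (simp add: eucl_norm_smult)
  hence "g \<bullet> (t \<cdot>\<^sub>v d) \<le> e' * eucl_norm (t \<cdot>\<^sub>v d)" using d by (intro b) auto
  hence "t * (g \<bullet> d) \<le> t * (e' * eucl_norm d)" using d g t by (simp add: eucl_norm_smult mult_ac)
  hence "g \<bullet> d \<le> e' * eucl_norm d" using t by (simp add: mult_le_cancel_left_pos)
  also have "\<dots> \<le> e' * (eucl_norm d + 1)" using e nd by (intro mult_left_mono) (auto simp: e'_def)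
  also have "\<dots> = e" using nd by (simp add: e'_def)
  finally show "g \<bullet> d \<le> 0 + e" by simp
qed

lemma has_gradient_unique:
  assumes "has_gradient p \<phi> g x" "has_gradient p \<phi> g' x"
  shows "g = g'"
proof -
  have g: "g \<in> carrier_vec p" "g' \<in> carrier_vec p" using assms by (auto simp: has_gradient_def)
  have "(g - g') \<bullet> (g - g') \<le> 0"
  proof (rule linear_bound_imp_nonpos)
    fix e :: real assume "0 < e"
    hence e: "0 < e / 2" by simp
    obtain r1 where r1: "0 < r1" "\<And>h. h \<in> carrier_vec p \<Longrightarrow> eucl_norm h < r1 \<Longrightarrow> \<bar>\<phi> (x + h) - \<phi> x - g \<bullet> h\<bar> \<le> e / 2 * eucl_norm h"
      using assms(1) e unfolding has_gradient_def by meson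
    obtain r2 where r2: "0 < r2" "\<And>h. h \<in> carrier_vec p \<Longrightarrow> eucl_norm h < r2 \<Longrightarrow> \<bar>\<phi> (x + h) - \<phi> x - g' \<bullet> h\<bar> \<le> e / 2 * eucl_norm h"
      using assms(2) e unfolding has_gradient_def by meson
    show "\<exists>r>0. \<forall>h\<in>carrier_vec p. eucl_norm h < r \<longrightarrow> (g - g') \<bullet> h \<le> e * eucl_norm h"
    proof (intro exI[of _ "min r1 r2"] conjI ballI impI)
      fix h assume h: "h \<in> carrier_vec p" "eucl_norm h < min r1 r2"
      have "(g - g') \<bullet> h = g \<bullet> h - g' \<bullet> h" using g h by (simp add: minus_scalar_prod_distrib)
      thus "(g - g') \<bullet> h \<le> e * eucl_norm h" using r1(2)[of h] r2(2)[of h] h unfolding abs_le_iff by simp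
    qed (use r1 r2 in auto)
  qed (use g in auto)
  hence "inner (emb (g - g')) (emb (g - g')) \<le> 0" using inner_emb[of "g - g'" p "g - g'"] g by simp
  hence "emb (g - g') = 0" using inner_ge_zero[of "emb (g - g')"] by simp
  hence "emb g = emb g'" using emb_diff[OF g] by simp
  hence "unemb p (emb g) = unemb p (emb g')" by simp
  thus ?thesis using g by (simp add: unemb_emb)
qed

lemma grad_eqI: "has_gradient p \<phi> g x \<Longrightarrow> grad p \<phi> x = g"
  unfolding grad_def by (rule the_equality) (auto intro: has_gradient_unique)

lemma has_gradient_grad:
  "differentiable_fun p \<phi> \<Longrightarrow> x \<in> carrier_vec p \<Longrightarrow> has_gradient p \<phi> (grad p \<phi> x) x"
  unfolding differentiable_fun_def using grad_eqI by metis

lemma grad_carrier: "differentiable_fun p \<phi> \<Longrightarrow> x \<in> carrier_vec p \<Longrightarrow> grad p \<phi> x \<in> carrier_vec p"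
  using has_gradient_grad unfolding has_gradient_def by blast

lemma has_gradient_minimizer:
  assumes g: "has_gradient p \<phi> g x" and x: "x \<in> carrier_vec p"
    and min: "\<And>y. y \<in> carrier_vec p \<Longrightarrow> \<phi> x \<le> \<phi> y"
  shows "emb g = 0"
proof -
  have gc: "g \<in> carrier_vec p" using g by (simp add: has_gradient_def)
  \<comment> \<open>Minimality bounds \<open>g \<bullet> h\<close> from below by
    \<open>- e * eucl_norm h\<close>, which is the upper bound required for the negated
    gradient.\<close>
  have "(- 1 \<cdot>\<^sub>v g) \<bullet> (- 1 \<cdot>\<^sub>v g) \<le> 0"
  proof (rule linear_bound_imp_nonpos)
    fix e :: real assume "0 < e"
    then obtain r where r: "0 < r"
      "\<And>h. h \<in> carrier_vec p \<Longrightarrow> eucl_norm h < r \<Longrightarrow> \<bar>\<phi> (x + h) - \<phi> x - g \<bullet> h\<bar> \<le> e * eucl_norm h"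
      using g unfolding has_gradient_def by meson
    show "\<exists>r>0. \<forall>h\<in>carrier_vec p. eucl_norm h < r \<longrightarrow> (- 1 \<cdot>\<^sub>v g) \<bullet> h \<le> e * eucl_norm h"
    proof (intro exI[of _ r] conjI ballI impI)
      fix h assume h: "h \<in> carrier_vec p" "eucl_norm h < r"
      have "\<phi> x \<le> \<phi> (x + h)" using x h by (intro min) auto
      moreover have "(- 1 \<cdot>\<^sub>v g) \<bullet> h = - (g \<bullet> h)" using gc h by simp
      ultimately show "(- 1 \<cdot>\<^sub>v g) \<bullet> h \<le> e * eucl_norm h" using r(2)[OF h] unfolding abs_le_iff by simp
    qed (rule r(1))
  qed (use gc in auto)
  hence "g \<bullet> g \<le> 0" using gc by simp
  hence "inner (emb g) (emb g) \<le> 0" using inner_emb[OF gc gc] by simp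
  thus ?thesis using inner_ge_zero[of "emb g"] by simp
qed

lemma has_gradient_zero: "has_gradient p (\<lambda>_. 0) (0\<^sub>v p) x"
  by (auto simp: has_gradient_def intro!: exI[of _ 1])

lemma has_gradient_add:
  assumes "has_gradient p \<phi> g x" "has_gradient p \<psi> g' x"
  shows "has_gradient p (\<lambda>y. \<phi> y + \<psi> y) (g + g') x"
  unfolding has_gradient_def
proof (intro conjI allI impI)
  have g: "g \<in> carrier_vec p" "g' \<in> carrier_vec p" using assms by (auto simp: has_gradient_def)
  thus "g + g' \<in> carrier_vec p" by simp
  fix e :: real assume "0 < e"
  hence e: "0 < e / 2" by simp
  obtain r1 where r1: "0 < r1" "\<And>h. h \<in> carrier_vec p \<Longrightarrow> eucl_norm h < r1 \<Longrightarrow> \<bar>\<phi> (x + h) - \<phi> x - g \<bullet> h\<bar> \<le> e / 2 * eucl_norm h"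
    using assms(1) e unfolding has_gradient_def by meson
  obtain r2 where r2: "0 < r2" "\<And>h. h \<in> carrier_vec p \<Longrightarrow> eucl_norm h < r2 \<Longrightarrow> \<bar>\<psi> (x + h) - \<psi> x - g' \<bullet> h\<bar> \<le> e / 2 * eucl_norm h"
    using assms(2) e unfolding has_gradient_def by meson
  show "\<exists>d>0. \<forall>h\<in>carrier_vec p. eucl_norm h < d \<longrightarrow>
      \<bar>\<phi> (x + h) + \<psi> (x + h) - (\<phi> x + \<psi> x) - (g + g') \<bullet> h\<bar> \<le> e * eucl_norm h"
  proof (intro exI[of _ "min r1 r2"] conjI ballI impI)
    fix h assume h: "h \<in> carrier_vec p" "eucl_norm h < min r1 r2"
    have "(g + g') \<bullet> h = g \<bullet> h + g' \<bullet> h" using g h by (simp add: add_scalar_prod_distrib)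
    thus "\<bar>\<phi> (x + h) + \<psi> (x + h) - (\<phi> x + \<psi> x) - (g + g') \<bullet> h\<bar> \<le> e * eucl_norm h"
      using r1(2)[of h] r2(2)[of h] h unfolding abs_le_iff by simp
  qed (use r1 r2 in auto)
qed

lemma has_gradient_cmult:
  assumes "has_gradient p \<phi> g x"
  shows "has_gradient p (\<lambda>y. c * \<phi> y) (c \<cdot>\<^sub>v g) x"
  unfolding has_gradient_def
proof (intro conjI allI impI)
  have g: "g \<in> carrier_vec p" using assms by (auto simp: has_gradient_def)
  thus "c \<cdot>\<^sub>v g \<in> carrier_vec p" by simp
  fix e :: real assume e: "0 < e"
  have "0 < e / (\<bar>c\<bar> + 1)" using e by (simp add: add_nonneg_pos)
  then obtain r where r: "0 < r" "\<And>h. h \<in> carrier_vec p \<Longrightarrow> eucl_norm h < r \<Longrightarrow>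
      \<bar>\<phi> (x + h) - \<phi> x - g \<bullet> h\<bar> \<le> e / (\<bar>c\<bar> + 1) * eucl_norm h"
    using assms unfolding has_gradient_def by meson
  show "\<exists>d>0. \<forall>h\<in>carrier_vec p. eucl_norm h < d \<longrightarrow>
      \<bar>c * \<phi> (x + h) - c * \<phi> x - (c \<cdot>\<^sub>v g) \<bullet> h\<bar> \<le> e * eucl_norm h"
  proof (intro exI[of _ r] conjI ballI impI)
    fix h assume h: "h \<in> carrier_vec p" "eucl_norm h < r"
    have "c * \<phi> (x + h) - c * \<phi> x - (c \<cdot>\<^sub>v g) \<bullet> h = c * (\<phi> (x + h) - \<phi> x - g \<bullet> h)"
      using g h by (simp add: algebra_simps)
    hence "\<bar>c * \<phi> (x + h) - c * \<phi> x - (c \<cdot>\<^sub>v g) \<bullet> h\<bar> = \<bar>c\<bar> * \<bar>\<phi> (x + h) - \<phi> x - g \<bullet> h\<bar>"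
      by (simp add: abs_mult)
    also have "\<dots> \<le> (\<bar>c\<bar> + 1) * (e / (\<bar>c\<bar> + 1) * eucl_norm h)"
      using r(2)[OF h] by (intro mult_mono) auto
    also have "\<dots> = e * eucl_norm h" by (simp add: add_nonneg_pos less_imp_neq[symmetric])
    finally show "\<bar>c * \<phi> (x + h) - c * \<phi> x - (c \<cdot>\<^sub>v g) \<bullet> h\<bar> \<le> e * eucl_norm h" .
  qed (rule r(1))
qed

text \<open>The zero of \<open>real vec\<close> depends on the dimension, so the sum, including the
  empty one, is formed in \<open>fsvec\<close> and carried back by \<open>unemb\<close>.\<close>

lemma has_gradient_weighted_sum:
  assumes "finite I" "\<And>i. i \<in> I \<Longrightarrow> has_gradient p (\<phi> i) (g i) x"
  shows "has_gradient p (\<lambda>y. c * (\<Sum>i\<in>I. \<phi> i y)) (unemb p (c *\<^sub>R (\<Sum>i\<in>I. emb (g i)))) x"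
proof -
  have "has_gradient p (\<lambda>y. \<Sum>i\<in>I. \<phi> i y) (unemb p (\<Sum>i\<in>I. emb (g i))) x"
    using assms
  proof (induction I)
    case empty
    have "unemb p 0 = 0\<^sub>v p" by (rule eq_vecI) (auto simp: unemb_def)
    thus ?case by (simp add: has_gradient_zero)
  next
    case (insert i I)
    have "g i \<in> carrier_vec p" using insert.prems[of i] by (simp add: has_gradient_def)
    hence "unemb p (emb (g i) + (\<Sum>i\<in>I. emb (g i))) = g i + unemb p (\<Sum>i\<in>I. emb (g i))"
      by (intro eq_vecI) (auto simp: unemb_def coord_emb)
    thus ?case using insert by (auto intro!: has_gradient_add)
  qed
  from has_gradient_cmult[OF this, of c]
  have "has_gradient p (\<lambda>y. c * (\<Sum>i\<in>I. \<phi> i y)) (c \<cdot>\<^sub>v unemb p (\<Sum>i\<in>I. emb (g i))) x" .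
  also have "c \<cdot>\<^sub>v unemb p (\<Sum>i\<in>I. emb (g i)) = unemb p (c *\<^sub>R (\<Sum>i\<in>I. emb (g i)))"
    by (rule eq_vecI) (auto simp: unemb_def)
  finally show ?thesis .
qed

definition gradV :: "nat \<Rightarrow> (real vec \<Rightarrow> real) \<Rightarrow> fsvec \<Rightarrow> fsvec" where
  "gradV p \<phi> x = emb (grad p \<phi> (unemb p x))"

lemma emb_weighted_sum:
  assumes "\<And>i. i \<in> I \<Longrightarrow> g i \<in> carrier_vec p"
  shows "emb (unemb p (c *\<^sub>R (\<Sum>i\<in>I. emb (g i)))) = c *\<^sub>R (\<Sum>i\<in>I. emb (g i))"
proof -
  have "c *\<^sub>R (\<Sum>i\<in>I. emb (g i)) \<in> emb ` carrier_vec p"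
    using assms by (intro subspace_scale[OF subspace_emb] subspace_sum[OF subspace_emb]) auto
  thus ?thesis by (auto simp: unemb_emb)
qed

lemma grad_weighted_sum:
  assumes "finite I" "\<And>i. i \<in> I \<Longrightarrow> differentiable_fun p (\<phi> i)"
  shows "differentiable_fun p (\<lambda>y. c * (\<Sum>i\<in>I. \<phi> i y))"
    and "x \<in> carrier_vec p \<Longrightarrow> emb (grad p (\<lambda>y. c * (\<Sum>i\<in>I. \<phi> i y)) x) = c *\<^sub>R (\<Sum>i\<in>I. emb (grad p (\<phi> i) x))"
proof -
  have *: "has_gradient p (\<lambda>y. c * (\<Sum>i\<in>I. \<phi> i y)) (unemb p (c *\<^sub>R (\<Sum>i\<in>I. emb (grad p (\<phi> i) x)))) x"
    if "x \<in> carrier_vec p" for x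
    using assms that by (intro has_gradient_weighted_sum has_gradient_grad) auto
  thus "differentiable_fun p (\<lambda>y. c * (\<Sum>i\<in>I. \<phi> i y))" by (auto simp: differentiable_fun_def)
  show "emb (grad p (\<lambda>y. c * (\<Sum>i\<in>I. \<phi> i y)) x) = c *\<^sub>R (\<Sum>i\<in>I. emb (grad p (\<phi> i) x))"
    if "x \<in> carrier_vec p"
    unfolding grad_eqI[OF *[OF that]] using assms that by (intro emb_weighted_sum grad_carrier) auto
qed

text \<open>Adding the convexity inequalities at \<open>(x, y)\<close> and \<open>(y, x)\<close>
  cancels the function values. This is the only form in which strong convexity enters the
  convergence analysis.\<close>

lemma gradV_strongly_monotone:
  assumes d: "differentiable_fun p \<phi>" and sc: "strongly_convex p \<mu> \<phi>"
    and xy: "x \<in> emb ` carrier_vec p" "y \<in> emb ` carrier_vec p"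
  shows "\<mu> * (norm (x - y))\<^sup>2 \<le> inner (gradV p \<phi> x - gradV p \<phi> y) (x - y)"
proof -
  obtain u v where u: "u \<in> carrier_vec p" "x = emb u" and v: "v \<in> carrier_vec p" "y = emb v" using xy by auto
  have *: "\<phi> b \<ge> \<phi> a + inner (gradV p \<phi> (emb a)) (emb b - emb a) + \<mu> / 2 * (norm (emb a - emb b))\<^sup>2"
    if "a \<in> carrier_vec p" "b \<in> carrier_vec p" for a b
  proof -
    have "inner (gradV p \<phi> (emb a)) (emb b - emb a) = grad p \<phi> a \<bullet> (b - a)"
      using that inner_emb[OF grad_carrier[OF d that(1)], of "b - a"] by (simp add: gradV_def unemb_emb flip: emb_diff[of _ p])
    moreover have "norm (emb a - emb b) = eucl_norm (a - b)"
      using that by (simp add: norm_emb flip: emb_diff[of _ p])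
    ultimately show ?thesis using sc that by (simp add: strongly_convex_def)
  qed
  show ?thesis using *[OF u(1) v(1)] *[OF v(1) u(1)] unfolding u v
    by (simp add: norm_minus_commute[of "emb v"] inner_diff_left inner_diff_right)
qed

lemma gradV_lipschitz:
  assumes d: "differentiable_fun p \<phi>" and sm: "smooth p L \<phi>"
    and xy: "x \<in> emb ` carrier_vec p" "y \<in> emb ` carrier_vec p"
  shows "norm (gradV p \<phi> x - gradV p \<phi> y) \<le> L * norm (x - y)"
proof -
  obtain u v where u: "u \<in> carrier_vec p" "x = emb u" and v: "v \<in> carrier_vec p" "y = emb v" using xy by auto
  have "norm (gradV p \<phi> x - gradV p \<phi> y) = eucl_norm (grad p \<phi> u - grad p \<phi> v)"
    using u v grad_carrier[OF d] by (simp add: gradV_def unemb_emb norm_emb flip: emb_diff[of _ p])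
  also have "\<dots> \<le> L * eucl_norm (u - v)" using sm u v by (simp add: smooth_def)
  also have "eucl_norm (u - v) = norm (x - y)" using u v by (simp add: norm_emb flip: emb_diff[of _ p])
  finally show ?thesis .
qed

section \<open>The second singular value of a doubly stochastic matrix\<close>

text \<open>\<open>n\<close> is a variable, so the sphere lives in the product topology on
  \<open>nat \<Rightarrow> real\<close>, with the coordinates from \<open>n\<close> on pinned to 0.
  Tychonoff makes the box compact, and the two equations cut out a closed subset.\<close>

lemma compact_unit_sphere_orth_ones:
  fixes n :: nat
  shows "compact {f :: nat \<Rightarrow> real. (\<forall>i. f i \<in> (if i < n then {-1..1} else {0})) \<and>
     (\<Sum>i<n. f i) = 0 \<and> (\<Sum>i<n. (f i)\<^sup>2) = 1}"
proof -
  let ?B = "\<lambda>i. if i < n then {-1..1} else {0::real}"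
  have "compactin (product_topology (\<lambda>i. euclidean) UNIV) (PiE UNIV ?B)"
    by (subst compactin_PiE) (auto simp: compactin_euclidean_iff)
  hence "compact (PiE UNIV ?B)"
    by (simp add: euclidean_product_topology compactin_euclidean_iff)
  moreover have "closed ({f :: nat \<Rightarrow> real. (\<Sum>i<n. f i) = 0} \<inter> {f. (\<Sum>i<n. (f i)\<^sup>2) = 1})"
    by (intro closed_Int closed_Collect_eq continuous_intros continuous_on_product_coordinates)
  ultimately have "compact (PiE UNIV ?B \<inter> ({f. (\<Sum>i<n. f i) = 0} \<inter> {f. (\<Sum>i<n. (f i)\<^sup>2) = 1}))"
    by (rule compact_Int_closed)
  also have "PiE UNIV ?B \<inter> ({f. (\<Sum>i<n. f i) = 0} \<inter> {f. (\<Sum>i<n. (f i)\<^sup>2) = 1}) =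
    {f :: nat \<Rightarrow> real. (\<forall>i. f i \<in> ?B i) \<and> (\<Sum>i<n. f i) = 0 \<and> (\<Sum>i<n. (f i)\<^sup>2) = 1}"
    by (auto simp: PiE_def Pi_def extensional_def)
  finally show ?thesis .
qed

text \<open>The quadratic form attains its maximum on the compact sphere, and homogeneity extends
  the bound to all \<open>z\<close> with sum 0.\<close>

lemma exists_max_on_orth_ones:
  fixes w :: "nat \<Rightarrow> nat \<Rightarrow> real"
  assumes "2 \<le> n"
  shows "\<exists>v. (\<Sum>i<n. v i) = 0 \<and> (\<Sum>i<n. (v i)\<^sup>2) = 1 \<and>
    (\<forall>z. (\<Sum>i<n. z i) = 0 \<longrightarrow>
      (\<Sum>i<n. (\<Sum>r<n. w i r * z r)\<^sup>2) \<le> (\<Sum>i<n. (\<Sum>r<n. w i r * v r)\<^sup>2) * (\<Sum>i<n. (z i)\<^sup>2))"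
proof -
  let ?C = "{f :: nat \<Rightarrow> real. (\<forall>i. f i \<in> (if i < n then {-1..1} else {0})) \<and>
     (\<Sum>i<n. f i) = 0 \<and> (\<Sum>i<n. (f i)\<^sup>2) = 1}"
  let ?q = "\<lambda>f :: nat \<Rightarrow> real. \<Sum>i<n. (\<Sum>r<n. w i r * f r)\<^sup>2"
  have scaled: "(\<lambda>i. if i < n then z i / sqrt (\<Sum>i<n. (z i)\<^sup>2) else 0) \<in> ?C"
    if z: "(\<Sum>i<n. z i) = 0" "(\<Sum>i<n. (z i)\<^sup>2) \<noteq> 0" for z
  proof -
    define N where "N = (\<Sum>i<n. (z i)\<^sup>2)"
    have N: "0 < N" using z sum_nonneg[of "{..<n}" "\<lambda>i. (z i)\<^sup>2"] by (simp add: N_def order_less_le)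
    have "\<bar>z i\<bar> \<le> sqrt N" if "i < n" for i
    proof -
      have "(z i)\<^sup>2 \<le> N" unfolding N_def using that by (intro member_le_sum) auto
      thus ?thesis by (rule real_le_rsqrt[of "\<bar>z i\<bar>", simplified])
    qed
    hence "-1 \<le> z i / sqrt N \<and> z i / sqrt N \<le> 1" if "i < n" for i
      using that N by (simp add: field_simps abs_le_iff) (smt (verit))
    moreover have "(\<Sum>i<n. z i / sqrt N) = 0" using z by (simp add: sum_divide_distrib[symmetric])
    moreover have "(\<Sum>i<n. (z i / sqrt N)\<^sup>2) = 1"
      using N by (simp add: power_divide sum_divide_distrib[symmetric] N_def[symmetric])
    ultimately show ?thesis unfolding N_def[symmetric] by auto
  qed
  \<comment> \<open>A nonzero vector with sum 0, for which two coordinates are needed; it shows that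
    the sphere is nonempty.\<close>
  let ?z = "\<lambda>i::nat. if i = 0 then 1 else if i = 1 then -1 else 0 :: real"
  have "(\<Sum>i<n. ?z i) = (\<Sum>i\<in>{0,1}. ?z i)" "(\<Sum>i<n. (?z i)\<^sup>2) = (\<Sum>i\<in>{0,1}. (?z i)\<^sup>2)"
    using assms by (intro sum.mono_neutral_right; auto)+
  hence z: "(\<Sum>i<n. ?z i) = 0" "(\<Sum>i<n. (?z i)\<^sup>2) \<noteq> 0" by auto
  have ne: "?C \<noteq> {}" using scaled[OF z] by (rule ex_in_conv[THEN iffD1, OF exI])
  have cont: "continuous_on ?C ?q"
    by (intro continuous_intros continuous_on_subset[OF continuous_on_product_coordinates]) auto
  obtain v where v: "v \<in> ?C" and max': "\<forall>f\<in>?C. ?q f \<le> ?q v"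
    using continuous_attains_sup[OF compact_unit_sphere_orth_ones ne cont] by (rule bexE)
  have "?q z \<le> ?q v * (\<Sum>i<n. (z i)\<^sup>2)" if z: "(\<Sum>i<n. z i) = 0" for z
  proof (cases "(\<Sum>i<n. (z i)\<^sup>2) = 0")
    case True
    hence "\<forall>i<n. z i = 0" by (subst (asm) sum_nonneg_eq_0_iff) auto
    thus ?thesis by simp
  next
    case False
    define N where "N = (\<Sum>i<n. (z i)\<^sup>2)"
    have N: "0 < N" using False sum_nonneg[of "{..<n}" "\<lambda>i. (z i)\<^sup>2"] by (simp add: N_def order_less_le)
    have "(\<Sum>r<n. w i r * (if r < n then z r / sqrt N else 0)) = (\<Sum>r<n. w i r * z r) / sqrt N" for i
      by (simp add: sum_divide_distrib)
    hence "?q (\<lambda>i. if i < n then z i / sqrt N else 0) = (\<Sum>i<n. ((\<Sum>r<n. w i r * z r) / sqrt N)\<^sup>2)"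
      by (simp only:)
    also have "\<dots> = ?q z / N" using N by (simp add: power_divide flip: sum_divide_distrib)
    finally have "?q (\<lambda>i. if i < n then z i / sqrt N else 0) = ?q z / N" .
    moreover have "?q (\<lambda>i. if i < n then z i / sqrt N else 0) \<le> ?q v"
      using bspec[OF max' scaled[OF z False]] by (simp only: N_def)
    ultimately have "?q z / N \<le> ?q v" by simp
    thus ?thesis unfolding pos_divide_le_eq[OF N] by (simp only: N_def)
  qed
  thus ?thesis using v by (intro exI[of _ v]) auto
qed

lemma sum_power2_line:
  fixes a b :: "'i \<Rightarrow> real"
  shows "(\<Sum>i\<in>I. (a i + t * b i)\<^sup>2) = (\<Sum>i\<in>I. (a i)\<^sup>2) + 2 * t * (\<Sum>i\<in>I. a i * b i) + t\<^sup>2 * (\<Sum>i\<in>I. (b i)\<^sup>2)"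
  by (simp add: power2_sum sum.distrib sum_distrib_left power_mult_distrib mult_ac)

text \<open>The first-order condition at the maximiser makes it an eigenvector of \<open>W\<^sup>T W\<close>.\<close>

lemma gram_eigenvector_orth_ones:
  fixes w :: "nat \<Rightarrow> nat \<Rightarrow> real"
  assumes "2 \<le> n" and S: "\<And>i j. S i j = (\<Sum>k<n. w k i * w k j)" and S1: "\<And>j. j < n \<Longrightarrow> (\<Sum>i<n. S i j) = 1"
  shows "\<exists>v \<kappa>. (\<Sum>i<n. v i) = 0 \<and> (\<Sum>i<n. (v i)\<^sup>2) = 1 \<and> 0 \<le> \<kappa> \<and>
    (\<forall>i<n. (\<Sum>j<n. S i j * v j) = \<kappa> * v i) \<and>
    (\<forall>z. (\<Sum>i<n. z i) = 0 \<longrightarrow> (\<Sum>i<n. (\<Sum>r<n. w i r * z r)\<^sup>2) \<le> \<kappa> * (\<Sum>i<n. (z i)\<^sup>2))"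
proof -
  define q where "q f = (\<Sum>i<n. (\<Sum>r<n. w i r * f r)\<^sup>2)" for f
  obtain v where v: "(\<Sum>i<n. v i) = 0" "(\<Sum>i<n. (v i)\<^sup>2) = 1"
    and max: "\<And>z. (\<Sum>i<n. z i) = 0 \<Longrightarrow> q z \<le> q v * (\<Sum>i<n. (z i)\<^sup>2)"
    using exists_max_on_orth_ones[OF assms(1), of w] unfolding q_def by blast
  define \<kappa> where "\<kappa> = q v"
  \<comment> \<open>Half the gradient at \<open>v\<close> of
    \<open>\<kappa> * (\<Sum>i<n. (z i)\<^sup>2) - q z\<close>, a function of \<open>z\<close> that
    is nonnegative on the hyperplane and 0 at \<open>v\<close>. As \<open>u\<close> has sum 0, the
    line through \<open>v\<close> in direction \<open>u\<close> stays in the hyperplane.\<close>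
  define u where "u i = \<kappa> * v i - (\<Sum>j<n. S i j * v j)" for i
  define p where "p k = (\<Sum>j<n. w k j * v j)" for k
  have Sv: "(\<Sum>j<n. S i j * v j) = (\<Sum>k<n. w k i * p k)" for i
  proof -
    have "(\<Sum>j<n. S i j * v j) = (\<Sum>j<n. \<Sum>k<n. w k i * (w k j * v j))"
      by (simp add: S sum_distrib_right mult.assoc)
    thus ?thesis by (subst (asm) sum.swap) (simp add: p_def sum_distrib_left)
  qed
  have u0: "(\<Sum>i<n. u i) = 0"
  proof -
    have "(\<Sum>i<n. \<Sum>j<n. S i j * v j) = (\<Sum>j<n. (\<Sum>i<n. S i j) * v j)"
      by (subst sum.swap) (simp add: sum_distrib_right)
    also have "\<dots> = 0" using S1 v by simp
    finally show ?thesis using v by (simp add: u_def sum_subtractf sum_distrib_left[symmetric])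
  qed
  have cross: "(\<Sum>k<n. p k * (\<Sum>i<n. w k i * u i)) = (\<Sum>i<n. (\<Sum>j<n. S i j * v j) * u i)"
    unfolding Sv sum_distrib_left sum_distrib_right by (subst sum.swap) (simp add: mult_ac)
  define b where "b = (\<Sum>i<n. (u i)\<^sup>2)"
  have b: "\<kappa> * (\<Sum>i<n. v i * u i) - (\<Sum>i<n. (\<Sum>j<n. S i j * v j) * u i) = b"
    unfolding b_def by (simp add: sum_distrib_left sum_subtractf[symmetric] u_def power2_eq_square algebra_simps)
  have ineq: "0 \<le> t * (2 * b) + t\<^sup>2 * (\<kappa> * b - q u)" for t
  proof -
    have "q (\<lambda>i. v i + t * u i) = (\<Sum>k<n. (p k + t * (\<Sum>j<n. w k j * u j))\<^sup>2)"
      unfolding q_def p_def by (simp add: distrib_left sum.distrib sum_distrib_left mult_ac)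
    also have "\<dots> = q v + 2 * t * (\<Sum>k<n. p k * (\<Sum>i<n. w k i * u i)) + t\<^sup>2 * q u"
      unfolding q_def p_def[symmetric] by (rule sum_power2_line)
    finally have 1: "q (\<lambda>i. v i + t * u i) = \<kappa> + 2 * t * (\<Sum>i<n. (\<Sum>j<n. S i j * v j) * u i) + t\<^sup>2 * q u"
      by (simp add: cross \<kappa>_def)
    have 2: "(\<Sum>i<n. (v i + t * u i)\<^sup>2) = 1 + 2 * t * (\<Sum>i<n. v i * u i) + t\<^sup>2 * b"
      unfolding b_def v(2)[symmetric] by (rule sum_power2_line)
    have "q (\<lambda>i. v i + t * u i) \<le> \<kappa> * (\<Sum>i<n. (v i + t * u i)\<^sup>2)"
      unfolding \<kappa>_def by (rule max) (simp add: sum.distrib sum_distrib_left[symmetric] v u0)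
    hence "\<kappa> + 2 * t * (\<Sum>i<n. (\<Sum>j<n. S i j * v j) * u i) + t\<^sup>2 * q u \<le>
        \<kappa> * (1 + 2 * t * (\<Sum>i<n. v i * u i) + t\<^sup>2 * b)" by (simp only: 1 2)
    thus ?thesis unfolding b[symmetric] by (simp add: algebra_simps)
  qed
  have "b = 0"
  proof (rule ccontr)
    assume "b \<noteq> 0"
    hence b0: "0 < b" using sum_nonneg[of "{..<n}" "\<lambda>i. (u i)\<^sup>2"] by (simp add: b_def order_less_le)
    define A where "A = \<bar>\<kappa> * b - q u\<bar> + b"
    \<comment> \<open>At \<open>t = - s\<close> the quadratic is at most \<open>- b * b / A\<close>:
      the linear term takes away twice what the quadratic one, bounded by \<open>A\<close>, can
      return.\<close>
    define s where "s = b / A"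
    have A: "0 < A" using b0 by (simp add: A_def)
    have s: "0 < s" using A b0 by (simp add: s_def)
    have "0 \<le> (- s) * (2 * b) + (- s)\<^sup>2 * (\<kappa> * b - q u)" by (rule ineq)
    also have "\<dots> \<le> (- s) * (2 * b) + s\<^sup>2 * A"
      using b0 by (intro add_left_mono) (auto intro!: mult_left_mono simp: A_def)
    also have "s\<^sup>2 * A = s * b" using A by (simp add: s_def power2_eq_square)
    also have "(- s) * (2 * b) + s * b = - (s * b)" by (simp add: algebra_simps)
    finally show False using s b0 by (simp add: mult_le_0_iff)
  qed
  hence "\<forall>i<n. u i = 0" unfolding b_def by (subst (asm) sum_nonneg_eq_0_iff) auto
  moreover have "0 \<le> \<kappa>" by (simp add: \<kappa>_def q_def sum_nonneg)
  ultimately show ?thesis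
    using v max unfolding q_def[symmetric] \<kappa>_def[symmetric]
    by (intro exI[of _ v] exI[of _ \<kappa>]) (auto simp: u_def)
qed

text \<open>Change of basis to the all-ones vector followed by all unit vectors but the first.\<close>

lemma char_poly_stochastic_deflation:
  fixes A :: "real mat"
  assumes A: "A \<in> carrier_mat (Suc k) (Suc k)" and row: "\<And>i. i < Suc k \<Longrightarrow> (\<Sum>j<Suc k. A $$ (i, j)) = 1"
  shows "char_poly A = [:-1, 1:] * char_poly (mat k k (\<lambda>(i, j). A $$ (Suc i, Suc j) - A $$ (0, Suc j)))"
proof -
  let ?n = "Suc k"
  let ?C = "mat k k (\<lambda>(i, j). A $$ (Suc i, Suc j) - A $$ (0, Suc j))"
  define P where "P = mat ?n ?n (\<lambda>(i, j). (if j = 0 then 1 else 0) + (if j = i \<and> i \<noteq> 0 then 1 else 0) :: real)"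
  define Q where "Q = mat ?n ?n (\<lambda>(i, j). if i = j then 1 else if j = 0 then -1 else 0 :: real)"
  \<comment> \<open>\<open>A\<close> in the new basis, with \<open>Q\<close> the inverse of the base
    change \<open>P\<close>. Row sums 1 make the first column a unit vector, so \<open>B\<close> is
    block triangular with the block 1 in the corner.\<close>
  define B where "B = mat ?n ?n (\<lambda>(i, j). if j = 0 then (if i = 0 then 1 else 0)
     else if i = 0 then A $$ (0, j) else A $$ (i, j) - A $$ (0, j))"
  have carr: "P \<in> carrier_mat ?n ?n" "Q \<in> carrier_mat ?n ?n" "B \<in> carrier_mat ?n ?n"
    by (auto simp: P_def Q_def B_def)
  have P_mult: "(P * D) $$ (i, j) = D $$ (0, j) + (if i \<noteq> 0 then D $$ (i, j) else 0)"
    if D: "D \<in> carrier_mat ?n ?n" and ij: "i < ?n" "j < ?n" for D i j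
  proof -
    have "(P * D) $$ (i, j) = (\<Sum>l<?n. P $$ (i, l) * D $$ (l, j))"
      using ij D carr by (simp add: scalar_prod_def atLeast0LessThan)
    also have "\<dots> = (\<Sum>l<?n. (if l = 0 then D $$ (l, j) else 0) + (if l = i then (if i \<noteq> 0 then D $$ (i, j) else 0) else 0))"
      using ij by (intro sum.cong) (auto simp: P_def)
    also have "\<dots> = D $$ (0, j) + (if i \<noteq> 0 then D $$ (i, j) else 0)"
      using ij by (simp add: sum.distrib del: sum.lessThan_Suc)
    finally show ?thesis .
  qed
  have PQ: "P * Q = 1\<^sub>m ?n"
    by (rule eq_matI) (use carr in \<open>auto simp: P_mult simp del: index_mult_mat(1)\<close>, auto simp: Q_def)
  have QP: "Q * P = 1\<^sub>m ?n" by (rule mat_mult_left_right_inverse[OF carr(1,2) PQ])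
  have AP: "A * P = P * B"
  proof (rule eq_matI)
    fix i j assume "i < dim_row (P * B)" "j < dim_col (P * B)"
    hence ij: "i < ?n" "j < ?n" using carr by auto
    have "(A * P) $$ (i, j) = (\<Sum>l<?n. A $$ (i, l) * P $$ (l, j))"
      using ij A carr by (simp add: scalar_prod_def atLeast0LessThan)
    also have "\<dots> = (if j = 0 then 1 else A $$ (i, j))"
    proof (cases "j = 0")
      case True
      have "(\<Sum>l<?n. A $$ (i, l) * P $$ (l, j)) = (\<Sum>l<?n. A $$ (i, l))"
        using True by (intro sum.cong) (auto simp: P_def)
      thus ?thesis using True row[OF ij(1)] by simp
    next
      case False
      have "(\<Sum>l<?n. A $$ (i, l) * P $$ (l, j)) = (\<Sum>l<?n. if l = j then A $$ (i, j) else 0)"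
        using False ij by (intro sum.cong) (auto simp: P_def)
      thus ?thesis using False ij by (simp del: sum.lessThan_Suc)
    qed
    also have "\<dots> = (P * B) $$ (i, j)"
      unfolding P_mult[OF carr(3) ij] using ij by (auto simp: B_def)
    finally show "(A * P) $$ (i, j) = (P * B) $$ (i, j)" .
  qed (use A carr in auto)
  have "A = A * (P * Q)" using A PQ by simp
  also have "\<dots> = A * P * Q" using A carr by (simp add: assoc_mult_mat)
  also have "\<dots> = P * B * Q" by (simp add: AP)
  finally have "similar_mat A B"
    using PQ QP A carr by (intro similar_matI[of _ _ P Q ?n]) auto
  hence "char_poly A = char_poly B" by (rule char_poly_similar)
  also have "B = four_block_mat (1\<^sub>m 1) (mat 1 k (\<lambda>(i, j). A $$ (0, Suc j))) (0\<^sub>m k 1) ?C"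
    by (rule eq_matI) (auto simp: B_def)
  also have "char_poly \<dots> = char_poly (1\<^sub>m 1) * char_poly ?C"
    by (rule char_poly_four_block_zeros_col) auto
  also have "char_poly (1\<^sub>m 1 :: real mat) = [:-1, 1:]"
    by (simp add: char_poly_defs det_def sign_def)
  finally show ?thesis .
qed

text \<open>If the second entry were below \<open>c\<close>, so would be all later ones, leaving at
  most one member that reaches \<open>c\<close>. It is irrelevant which of the two members is larger
  or where they stand; multiplicity matters when \<open>a = b\<close>.\<close>

lemma second_of_sorted_desc_ge:
  fixes M :: "real multiset"
  assumes "{#a, b#} \<subseteq># M" "c \<le> a" "c \<le> b"
  shows "2 \<le> length (rev (sorted_list_of_multiset M)) \<and> c \<le> rev (sorted_list_of_multiset M) ! 1"
proof -
  define xs where "xs = rev (sorted_list_of_multiset M)"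
  have sorted: "sorted_wrt (\<ge>) xs" by (simp add: xs_def sorted_wrt_rev)
  have mset: "mset xs = M" by (simp add: xs_def)
  have "filter_mset (\<lambda>x. c \<le> x) {#a, b#} \<subseteq># filter_mset (\<lambda>x. c \<le> x) M"
    by (rule multiset_filter_mono[OF assms(1)])
  hence "size {#a, b#} \<le> size (filter_mset (\<lambda>x. c \<le> x) M)"
    using assms(2,3) by (auto dest: size_mset_mono)
  hence flt: "2 \<le> length (filter (\<lambda>x. c \<le> x) xs)"
    unfolding mset[symmetric] mset_filter[symmetric] size_mset by simp
  hence "2 \<le> length xs" using length_filter_le order_trans by blast
  then obtain x y zs where xs: "xs = x # y # zs"
    by (metis One_nat_def Suc_1 Suc_le_length_iff)
  have "c \<le> y"
  proof (rule ccontr)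
    assume "\<not> c \<le> y"
    hence "filter (\<lambda>x. c \<le> x) (y # zs) = []" using sorted xs by (auto simp: filter_empty_conv)
    hence "length (filter (\<lambda>x. c \<le> x) xs) \<le> 1" using xs by simp
    thus False using flt by simp
  qed
  thus ?thesis using \<open>2 \<le> length xs\<close> unfolding xs_def[symmetric] by (simp add: xs)
qed

text \<open>Deflation removes one eigenvalue 1 of the Gram matrix, that of the all-ones vector; the
  maximum \<kappa> of the quadratic form on its complement is a root of the remaining factor. So 1
  and \<kappa> occur together, even if they are equal, and the second entry is at least the smaller
  of 1 and \<open>sqrt \<kappa>\<close>. Since it is below 1, it bounds
  \<open>sqrt \<kappa>\<close>.\<close>

lemma second_singular_value_contraction:
  fixes W :: "real mat"
  assumes n: "1 \<le> n" and ds: "doubly_stochastic n W" and \<sigma>: "second_singular_value W < 1"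
  shows "0 \<le> second_singular_value W"
    and "(\<Sum>i<n. z i) = 0 \<Longrightarrow>
      (\<Sum>i<n. (\<Sum>r<n. W $$ (i, r) * z r)\<^sup>2) \<le> (second_singular_value W)\<^sup>2 * (\<Sum>i<n. (z i)\<^sup>2)"
proof -
  have W: "W \<in> carrier_mat n n" and row: "\<And>i. i < n \<Longrightarrow> (\<Sum>j<n. W $$ (i, j)) = 1"
    and col: "\<And>j. j < n \<Longrightarrow> (\<Sum>i<n. W $$ (i, j)) = 1" using ds by (auto simp: doubly_stochastic_def)
  let ?\<sigma> = "second_singular_value W"
  have "0 \<le> ?\<sigma> \<and> ((\<Sum>i<n. z i) = 0 \<longrightarrow>
      (\<Sum>i<n. (\<Sum>r<n. W $$ (i, r) * z r)\<^sup>2) \<le> ?\<sigma>\<^sup>2 * (\<Sum>i<n. (z i)\<^sup>2))"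
  proof (cases "n = 1")
    case True
    \<comment> \<open>Here the list is too short, so the value is the default 0; a single number
      with sum 0 vanishes as well.\<close>
    have G: "W\<^sup>T * W \<in> carrier_mat 1 1" using W True by auto
    have "size (proots (char_poly (W\<^sup>T * W))) \<le> 1"
      using size_proots_le[of "char_poly (W\<^sup>T * W)"] degree_monic_char_poly[OF G] by simp
    moreover have "length (singular_values W) = size (proots (char_poly (W\<^sup>T * W)))"
      by (simp add: singular_values_def flip: size_mset)
    ultimately have "?\<sigma> = 0" by (simp add: second_singular_value_def)
    thus ?thesis using True by auto
  next
    case False
    hence n2: "2 \<le> n" using n by simp
    obtain k where nk: "n = Suc k" using n by (cases n) auto
    define S where "S i j = (\<Sum>l<n. W $$ (l, i) * W $$ (l, j))" for i j
    have S: "(W\<^sup>T * W) $$ (i, j) = S i j" if "i < n" "j < n" for i j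
      using that W by (simp add: scalar_prod_def S_def atLeast0LessThan)
    have S_sum: "(\<Sum>j<n. S i j) = 1" if "i < n" for i
    proof -
      have "(\<Sum>j<n. S i j) = (\<Sum>l<n. W $$ (l, i) * (\<Sum>j<n. W $$ (l, j)))"
        unfolding S_def by (subst sum.swap) (simp add: sum_distrib_left)
      thus ?thesis using row col[OF that] by simp
    qed
    have S_sym: "S i j = S j i" for i j by (simp add: S_def mult.commute)
    obtain v \<kappa> where v: "(\<Sum>i<n. v i) = 0" "(\<Sum>i<n. (v i)\<^sup>2) = 1" "0 \<le> \<kappa>"
      and ev: "\<And>i. i < n \<Longrightarrow> (\<Sum>j<n. S i j * v j) = \<kappa> * v i"
      and bound: "\<And>z. (\<Sum>i<n. z i) = 0 \<Longrightarrow>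
        (\<Sum>i<n. (\<Sum>r<n. W $$ (i, r) * z r)\<^sup>2) \<le> \<kappa> * (\<Sum>i<n. (z i)\<^sup>2)"
      using gram_eigenvector_orth_ones[OF n2, of S "\<lambda>i j. W $$ (i, j)"] S_sum S_sym S_def by auto
    define C where "C = mat k k (\<lambda>(i, j). (W\<^sup>T * W) $$ (Suc i, Suc j) - (W\<^sup>T * W) $$ (0, Suc j))"
    have C: "C \<in> carrier_mat k k" by (simp add: C_def)
    have cp: "char_poly (W\<^sup>T * W) = [:-1, 1:] * char_poly C"
      unfolding C_def
      by (rule char_poly_stochastic_deflation) (use W S S_sum nk in \<open>auto simp del: index_mult_mat(1) sum.lessThan_Suc\<close>)
    \<comment> \<open>The coordinates of \<open>v\<close> after the first, in the basis used for the
      deflation. They vanish only if \<open>v\<close> is constant, which sum 0 and norm 1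
      exclude.\<close>
    have "eigenvector C (vec k (\<lambda>i. v (Suc i) - v 0)) \<kappa>"
      unfolding eigenvector_def
    proof (intro conjI)
      show "vec k (\<lambda>i. v (Suc i) - v 0) \<in> carrier_vec (dim_row C)" using C by simp
      show "vec k (\<lambda>i. v (Suc i) - v 0) \<noteq> 0\<^sub>v (dim_row C)"
      proof
        assume eq: "vec k (\<lambda>i. v (Suc i) - v 0) = 0\<^sub>v (dim_row C)"
        have const: "v i = v 0" if "i < n" for i
        proof (cases i)
          case (Suc l)
          hence "l < k" using that nk by simp
          thus ?thesis using arg_cong[OF eq, of "\<lambda>u. u $ l"] C Suc by simp
        qed simp
        have "(\<Sum>i<n. v i) = (\<Sum>i<n. v 0)" by (rule sum.cong) (auto intro: const)
        hence "v 0 = 0" using v(1) n by simp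
        hence "v i = 0" if "i < n" for i using const[OF that] by simp
        hence "(\<Sum>i<n. (v i)\<^sup>2) = 0" by simp
        thus False using v(2) by simp
      qed
      show "C *\<^sub>v vec k (\<lambda>i. v (Suc i) - v 0) = \<kappa> \<cdot>\<^sub>v vec k (\<lambda>i. v (Suc i) - v 0)"
      proof (rule eq_vecI)
        fix i assume "i < dim_vec (\<kappa> \<cdot>\<^sub>v vec k (\<lambda>i. v (Suc i) - v 0))"
        hence i: "i < k" by simp
        have "(C *\<^sub>v vec k (\<lambda>i. v (Suc i) - v 0)) $ i =
            (\<Sum>j<k. (S (Suc i) (Suc j) - S 0 (Suc j)) * (v (Suc j) - v 0))"
          using i C nk by (simp add: scalar_prod_def atLeast0LessThan C_def S del: index_mult_mat(1))
        \<comment> \<open>The added term \<open>j = 0\<close> carries the factor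
          \<open>v 0 - v 0\<close>.\<close>
        also have "\<dots> = (\<Sum>j<n. (S (Suc i) j - S 0 j) * (v j - v 0))"
          unfolding nk by (subst sum.lessThan_Suc_shift) simp
        also have "\<dots> = (\<Sum>j<n. S (Suc i) j * v j) - (\<Sum>j<n. S 0 j * v j) - v 0 * ((\<Sum>j<n. S (Suc i) j) - (\<Sum>j<n. S 0 j))"
          by (simp add: sum_subtractf[symmetric] sum_distrib_left algebra_simps sum.distrib)
        also have "\<dots> = \<kappa> * (v (Suc i) - v 0)"
        proof -
          have "Suc i < n" "0 < n" using i nk by auto
          thus ?thesis by (simp only: ev S_sum) (simp add: algebra_simps)
        qed
        finally show "(C *\<^sub>v vec k (\<lambda>i. v (Suc i) - v 0)) $ i = (\<kappa> \<cdot>\<^sub>v vec k (\<lambda>i. v (Suc i) - v 0)) $ i"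
          using i by simp
      qed (use C in simp)
    qed
    hence "poly (char_poly C) \<kappa> = 0" using eigenvalue_root_char_poly[OF C] by (auto simp: eigenvalue_def)
    moreover have "char_poly C \<noteq> 0" using degree_monic_char_poly[OF C] by auto
    ultimately have "{#1, \<kappa>#} \<subseteq># proots (char_poly (W\<^sup>T * W))"
      unfolding cp by (subst proots_mult) (auto simp: proots_linear_factor)
    from image_mset_subseteq_mono[OF this, of sqrt]
    have "{#1, sqrt \<kappa>#} \<subseteq># image_mset sqrt (proots (char_poly (W\<^sup>T * W)))" by simp
    from second_of_sorted_desc_ge[OF this, of "min 1 (sqrt \<kappa>)"]
    have "min 1 (sqrt \<kappa>) \<le> ?\<sigma>" by (simp add: second_singular_value_def singular_values_def)
    hence s: "sqrt \<kappa> \<le> ?\<sigma>" using \<sigma> by simp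
    hence "\<kappa> \<le> ?\<sigma>\<^sup>2" by (rule sqrt_le_D)
    hence "\<kappa> * (\<Sum>i<n. (z i)\<^sup>2) \<le> ?\<sigma>\<^sup>2 * (\<Sum>i<n. (z i)\<^sup>2)"
      by (intro mult_right_mono sum_nonneg) auto
    thus ?thesis using bound[of z] order_trans[OF real_sqrt_ge_zero[OF v(3)] s] by auto
  qed
  thus "0 \<le> ?\<sigma>" and "(\<Sum>i<n. z i) = 0 \<Longrightarrow>
      (\<Sum>i<n. (\<Sum>r<n. W $$ (i, r) * z r)\<^sup>2) \<le> ?\<sigma>\<^sup>2 * (\<Sum>i<n. (z i)\<^sup>2)" by auto
qed

section \<open>Gradient tracking with variance reduction\<close>

text \<open>The draw of node \<open>i\<close> in the step from iterate \<open>q\<close> to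
  \<open>q + 1\<close>. Inner iterations are numbered from 1 in the sample space, hence the
  \<open>Suc\<close>.\<close>

definition draw_index :: "nat \<Rightarrow> nat \<Rightarrow> nat \<Rightarrow> nat \<times> nat \<times> nat" where
  "draw_index K q i = (q div K, Suc (q mod K), i)"

definition draws_before :: "nat \<Rightarrow> nat \<Rightarrow> nat \<Rightarrow> (nat \<times> nat \<times> nat) set" where
  "draws_before n K q = (\<lambda>(q', i). draw_index K q' i) ` ({..<q} \<times> {..<n})"

text \<open>An out-of-range draw would select a function about which nothing is assumed. The draws
  are valid almost surely, and the pathwise recursions are stated under this condition.\<close>

definition valid_draws :: "nat \<Rightarrow> (nat \<Rightarrow> nat) \<Rightarrow> (nat \<times> nat \<times> nat \<Rightarrow> nat) \<Rightarrow> bool" where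
  "valid_draws n m s \<longleftrightarrow> (\<forall>t k i. 1 \<le> k \<longrightarrow> i < n \<longrightarrow> s (t, k, i) < m i)"

lemma draw_index_inj: "draw_index K q i = draw_index K q' i' \<Longrightarrow> q = q' \<and> i = i'"
  unfolding draw_index_def by (metis Pair_inject Suc_inject div_mult_mod_eq)

lemma finite_draws_before: "finite (draws_before n K q)"
  by (simp add: draws_before_def)

lemma draws_before_subset: "draws_before n K q \<subseteq> UNIV \<times> {1..} \<times> {..<n}"
  by (auto simp: draws_before_def draw_index_def)

lemma draws_before_mono: "q \<le> q' \<Longrightarrow> draws_before n K q \<subseteq> draws_before n K q'"
  by (fastforce simp: draws_before_def)

lemma draw_index_notin_before: "draw_index K q i \<notin> draws_before n K q"
  by (auto simp: draws_before_def dest: draw_index_inj)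

text \<open>The inner iterations are numbered consecutively, with \<open>q = t * K + k\<close>. The snapshot used in the
  step from \<open>q\<close> to \<open>q + 1\<close> is the iterate number \<open>q div K * K\<close>. The subspace \<open>H\<close> is the image of
  \<open>R^p\<close>, outside of which nothing is known about the gradients.\<close>

locale gt_process =
  fixes n :: nat and m :: "nat \<Rightarrow> nat" and w :: "nat \<Rightarrow> nat \<Rightarrow> real"
    and g :: "nat \<Rightarrow> nat \<Rightarrow> 'a :: real_inner \<Rightarrow> 'a" and gb :: "nat \<Rightarrow> 'a \<Rightarrow> 'a"
    and H :: "'a set" and xst :: 'a and \<alpha> \<delta> L \<mu> :: real and K :: nat
    and x0 :: "nat \<Rightarrow> 'a" and x y v :: "nat \<Rightarrow> nat \<Rightarrow> (nat \<times> nat \<times> nat \<Rightarrow> nat) \<Rightarrow> 'a"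
  assumes n1: "1 \<le> n" and m1: "i < n \<Longrightarrow> 1 \<le> m i"
    and row: "i < n \<Longrightarrow> (\<Sum>r<n. w i r) = 1" and col: "r < n \<Longrightarrow> (\<Sum>i<n. w i r) = 1"
    and \<delta>: "0 < \<delta>" "\<delta> \<le> 1"
    and contr: "(\<Sum>i<n. z i) = 0 \<Longrightarrow>
      (\<Sum>i<n. (norm (\<Sum>r<n. w i r *\<^sub>R z r))\<^sup>2) \<le> (1 - \<delta>)\<^sup>2 * (\<Sum>i<n. (norm (z i :: 'a))\<^sup>2)"
    and H: "subspace H"
    and g_H: "i < n \<Longrightarrow> j < m i \<Longrightarrow> a \<in> H \<Longrightarrow> g i j a \<in> H"
    and lip: "i < n \<Longrightarrow> j < m i \<Longrightarrow> a \<in> H \<Longrightarrow> b \<in> H \<Longrightarrow> norm (g i j a - g i j b) \<le> L * norm (a - b)"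
    and mono: "i < n \<Longrightarrow> j < m i \<Longrightarrow> a \<in> H \<Longrightarrow> b \<in> H \<Longrightarrow>
      \<mu> * (norm (a - b))\<^sup>2 \<le> inner (g i j a - g i j b) (a - b)"
    and gb: "i < n \<Longrightarrow> a \<in> H \<Longrightarrow> gb i a = (1 / real (m i)) *\<^sub>R (\<Sum>j<m i. g i j a)"
    and xst: "xst \<in> H" and opt: "(\<Sum>i<n. gb i xst) = 0"
    and \<mu>: "0 < \<mu>" "\<mu> \<le> L" and \<alpha>: "\<alpha> = 1 / 2000 * \<delta>\<^sup>2 * \<mu> / L\<^sup>2" and K1: "1 \<le> K"
    and x0_H: "i < n \<Longrightarrow> x0 i \<in> H"
    and x_0: "i < n \<Longrightarrow> x 0 i s = x0 i" and v_0: "i < n \<Longrightarrow> v 0 i s = gb i (x0 i)"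
    and y_0: "i < n \<Longrightarrow> y 0 i s = gb i (x0 i)"
    and x_Suc: "valid_draws n m s \<Longrightarrow> i < n \<Longrightarrow> x (Suc q) i s = (\<Sum>r<n. w i r *\<^sub>R x q r s) - \<alpha> *\<^sub>R y q i s"
    and v_Suc: "valid_draws n m s \<Longrightarrow> i < n \<Longrightarrow> v (Suc q) i s =
      g i (s (draw_index K q i)) (x (Suc q) i s) - g i (s (draw_index K q i)) (x (q div K * K) i s) + gb i (x (q div K * K) i s)"
    and y_Suc: "valid_draws n m s \<Longrightarrow> i < n \<Longrightarrow> y (Suc q) i s = (\<Sum>r<n. w i r *\<^sub>R y q r s) + v (Suc q) i s - v q i s"
    and dep_x: "i < n \<Longrightarrow> depends_on (draws_before n K (q - 1)) (x q i)"
    and dep_y: "i < n \<Longrightarrow> depends_on (draws_before n K q) (y q i)"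
    and dep_v: "i < n \<Longrightarrow> depends_on (draws_before n K q) (v q i)"
begin

section \<open>Pathwise one-step inequalities\<close>

lemma draw_valid: "valid_draws n m s \<Longrightarrow> i < n \<Longrightarrow> s (draw_index K q i) < m i"
  by (simp add: valid_draws_def draw_index_def)

lemma gb_H:
  assumes "i < n" "a \<in> H"
  shows "gb i a \<in> H"
proof -
  have "(\<Sum>j<m i. g i j a) \<in> H" by (rule subspace_sum[OF H]) (simp add: g_H assms)
  thus ?thesis using subspace_scale[OF H] by (simp only: gb[OF assms])
qed

lemma in_H: "valid_draws n m s \<Longrightarrow> (\<forall>i<n. x q i s \<in> H \<and> y q i s \<in> H \<and> v q i s \<in> H)"
proof (induction q rule: less_induct)
  case (less q)
  show ?case
  proof (cases q)
    case 0 thus ?thesis by (simp add: x_0 y_0 v_0 x0_H gb_H)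
  next
    case (Suc q')
    have IH: "\<forall>i<n. x q' i s \<in> H \<and> y q' i s \<in> H \<and> v q' i s \<in> H" using less Suc by simp
    have "q' div K * K < q" using Suc by (simp add: le_imp_less_Suc)
    hence z: "\<forall>i<n. x (q' div K * K) i s \<in> H" using less by blast
    have x: "x (Suc q') i s \<in> H" if "i < n" for i
      unfolding x_Suc[OF less.prems that] using IH that
      by (intro subspace_diff[OF H] subspace_sum[OF H] subspace_scale[OF H]) auto
    have v: "v (Suc q') i s \<in> H" if "i < n" for i
      unfolding v_Suc[OF less.prems that] using x z that draw_valid[OF less.prems that]
      by (intro subspace_add[OF H] subspace_diff[OF H] g_H gb_H) auto
    have "y (Suc q') i s \<in> H" if "i < n" for i
      unfolding y_Suc[OF less.prems that] using IH v that
      by (intro subspace_add[OF H] subspace_diff[OF H] subspace_sum[OF H] subspace_scale[OF H]) auto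
    thus ?thesis using x v Suc by simp
  qed
qed

lemma x_H: "valid_draws n m s \<Longrightarrow> i < n \<Longrightarrow> x q i s \<in> H"
  using in_H by blast

lemma gb_lip:
  assumes i: "i < n" and ab: "a \<in> H" "b \<in> H"
  shows "norm (gb i a - gb i b) \<le> L * norm (a - b)"
proof -
  have m: "0 < real (m i)" using m1[OF i] by simp
  have "gb i a - gb i b = (1 / real (m i)) *\<^sub>R (\<Sum>j<m i. g i j a - g i j b)"
    by (simp add: gb i ab sum_subtractf scaleR_diff_right)
  also have "norm \<dots> \<le> (1 / real (m i)) * (\<Sum>j<m i. norm (g i j a - g i j b))"
    using m by (simp add: norm_sum divide_right_mono)
  also have "\<dots> \<le> (1 / real (m i)) * (\<Sum>j<m i. L * norm (a - b))"
    using m lip[OF i _ ab] by (intro mult_left_mono sum_mono) auto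
  also have "\<dots> = L * norm (a - b)" using m by simp
  finally show ?thesis .
qed

lemma gb_mono:
  assumes i: "i < n" and ab: "a \<in> H" "b \<in> H"
  shows "\<mu> * (norm (a - b))\<^sup>2 \<le> inner (gb i a - gb i b) (a - b)"
proof -
  have m: "0 < real (m i)" using m1[OF i] by simp
  have "\<mu> * (norm (a - b))\<^sup>2 = (1 / real (m i)) * (\<Sum>j<m i. \<mu> * (norm (a - b))\<^sup>2)" using m by simp
  also have "\<dots> \<le> (1 / real (m i)) * (\<Sum>j<m i. inner (g i j a - g i j b) (a - b))"
    using m mono[OF i _ ab] by (intro mult_left_mono sum_mono) auto
  also have "\<dots> = inner ((1 / real (m i)) *\<^sub>R (\<Sum>j<m i. g i j a - g i j b)) (a - b)"
    by (simp add: inner_sum_left)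
  also have "(1 / real (m i)) *\<^sub>R (\<Sum>j<m i. g i j a - g i j b) = gb i a - gb i b"
    by (simp add: gb i ab sum_subtractf scaleR_diff_right)
  finally show ?thesis .
qed

text \<open>Mean iterate; then mean error, consensus error, tracking error, gradient noise and total
  error, each summed over the nodes. The factor \<open>n\<close> in \<open>ee\<close> makes the
  total exactly mean plus consensus error.\<close>

definition xb where "xb q s = avg n (\<lambda>i. x q i s)"
definition ee where "ee q s = real n * (norm (xb q s - xst))\<^sup>2"
definition XX where "XX q s = (\<Sum>i<n. (norm (x q i s - xb q s))\<^sup>2)"
definition YY where "YY q s = (\<Sum>i<n. (norm (y q i s - avg n (\<lambda>i. y q i s)))\<^sup>2)"
definition NN where "NN q s = (\<Sum>i<n. (norm (v q i s - gb i (x q i s)))\<^sup>2)"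
definition DD where "DD q s = (\<Sum>i<n. (norm (x q i s - xst))\<^sup>2)"

lemma L0: "0 < L" using \<mu> by simp

lemma DD_eq: "DD q s = ee q s + XX q s"
  using sum_norm_power2_about_avg[OF n1, of "\<lambda>i. x q i s" xst] by (simp add: DD_def ee_def XX_def xb_def)

lemma nonneg: "0 \<le> ee q s" "0 \<le> XX q s" "0 \<le> YY q s" "0 \<le> NN q s" "0 \<le> DD q s"
  by (simp_all add: ee_def XX_def YY_def NN_def DD_def sum_nonneg)

text \<open>The invariant of gradient tracking: mixing preserves means, and the correction added to
  \<open>y\<close> is exactly the increment of \<open>v\<close>. The mean iterate thus moves along
  the mean gradient estimate.\<close>

lemma avg_y: "valid_draws n m s \<Longrightarrow> avg n (\<lambda>i. y q i s) = avg n (\<lambda>i. v q i s)"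
proof (induction q)
  case 0 show ?case by (rule avg_cong) (simp add: y_0 v_0)
next
  case (Suc q)
  have "avg n (\<lambda>i. y (Suc q) i s) = avg n (\<lambda>i. (\<Sum>r<n. w i r *\<^sub>R y q r s) + v (Suc q) i s - v q i s)"
    by (rule avg_cong) (simp add: y_Suc[OF Suc.prems])
  thus ?case using Suc by (simp add: avg_diff avg_add avg_mix[OF col])
qed

lemma XX_Suc:
  assumes s: "valid_draws n m s"
  shows "XX (Suc q) s \<le> (1 - \<delta>) * XX q s + 2 * \<alpha>\<^sup>2 / \<delta> * YY q s"
proof -
  have "(\<Sum>i<n. (norm (- \<alpha> *\<^sub>R y q i s - avg n (\<lambda>i. - \<alpha> *\<^sub>R y q i s)))\<^sup>2) = \<alpha>\<^sup>2 * YY q s"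
    unfolding YY_def avg_scaleR scaleR_diff_right[symmetric] norm_scaleR power_mult_distrib
    by (simp add: sum_distrib_left)
  moreover have "x (Suc q) i s = (\<Sum>r<n. w i r *\<^sub>R x q r s) + - \<alpha> *\<^sub>R y q i s" if "i < n" for i
    by (simp add: x_Suc[OF s that])
  note consensus_step[OF n1 row col \<delta> contr this]
  ultimately show ?thesis unfolding XX_def xb_def by simp
qed

text \<open>The increment of \<open>v\<close> splits into the noise at both ends and the change of
  the local gradient. The latter is bounded through the distances of both iterates to
  \<open>xst\<close>, so no further quantity enters the recursion. The factor
  \<open>6 / \<delta>\<close> is \<open>2 / \<delta>\<close> from the consensus step times 3
  summands.\<close>

lemma YY_Suc:
  assumes s: "valid_draws n m s"
  shows "YY (Suc q) s \<le> (1 - \<delta>) * YY q s +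
    6 / \<delta> * (NN (Suc q) s + NN q s + 2 * L\<^sup>2 * (DD (Suc q) s + DD q s))"
proof -
  define b where "b i = v (Suc q) i s - v q i s" for i
  have "(norm (b i))\<^sup>2 \<le> 3 * ((norm (v (Suc q) i s - gb i (x (Suc q) i s)))\<^sup>2 +
      2 * L\<^sup>2 * ((norm (x (Suc q) i s - xst))\<^sup>2 + (norm (x q i s - xst))\<^sup>2) + (norm (v q i s - gb i (x q i s)))\<^sup>2)"
    if i: "i < n" for i
  proof -
    have "norm (gb i (x (Suc q) i s) - gb i (x q i s)) \<le> L * norm (x (Suc q) i s - x q i s)"
      by (intro gb_lip x_H i s)
    hence "(norm (gb i (x (Suc q) i s) - gb i (x q i s)))\<^sup>2 \<le> L\<^sup>2 * (norm (x (Suc q) i s - x q i s))\<^sup>2"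
      using power_mono[of _ _ 2] by (fastforce simp: power_mult_distrib)
    also have "\<dots> \<le> L\<^sup>2 * (2 * (norm (x (Suc q) i s - xst))\<^sup>2 + 2 * (norm (x q i s - xst))\<^sup>2)"
      using norm_diff_power2_le_double[of "x (Suc q) i s - xst" "x q i s - xst"] by (intro mult_left_mono) auto
    finally have 1: "(norm (gb i (x (Suc q) i s) - gb i (x q i s)))\<^sup>2 \<le>
      2 * L\<^sup>2 * ((norm (x (Suc q) i s - xst))\<^sup>2 + (norm (x q i s - xst))\<^sup>2)" by (simp add: algebra_simps)
    have "b i = (v (Suc q) i s - gb i (x (Suc q) i s)) + (gb i (x (Suc q) i s) - gb i (x q i s)) + - (v q i s - gb i (x q i s))"
      by (simp add: b_def)
    hence "(norm (b i))\<^sup>2 \<le> 3 * ((norm (v (Suc q) i s - gb i (x (Suc q) i s)))\<^sup>2 +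
      (norm (gb i (x (Suc q) i s) - gb i (x q i s)))\<^sup>2 + (norm (- (v q i s - gb i (x q i s))))\<^sup>2)"
      using norm_add3_power2_le by metis
    thus ?thesis using 1 unfolding norm_minus_cancel by argo
  qed
  hence "(\<Sum>i<n. (norm (b i))\<^sup>2) \<le> (\<Sum>i<n. 3 * ((norm (v (Suc q) i s - gb i (x (Suc q) i s)))\<^sup>2 +
      2 * L\<^sup>2 * ((norm (x (Suc q) i s - xst))\<^sup>2 + (norm (x q i s - xst))\<^sup>2) + (norm (v q i s - gb i (x q i s)))\<^sup>2))"
    by (intro sum_mono) auto
  also have "\<dots> = 3 * (NN (Suc q) s + NN q s + 2 * L\<^sup>2 * (DD (Suc q) s + DD q s))"
    by (simp add: NN_def DD_def sum.distrib sum_distrib_left distrib_left)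
  finally have B: "(\<Sum>i<n. (norm (b i))\<^sup>2) \<le> 3 * (NN (Suc q) s + NN q s + 2 * L\<^sup>2 * (DD (Suc q) s + DD q s))" .
  have "y (Suc q) i s = (\<Sum>r<n. w i r *\<^sub>R y q r s) + b i" if "i < n" for i
    by (simp add: y_Suc[OF s that] b_def)
  note consensus_step[OF n1 row col \<delta> contr this]
  hence "YY (Suc q) s \<le> (1 - \<delta>) * YY q s + 2 / \<delta> * (\<Sum>i<n. (norm (b i - avg n b))\<^sup>2)"
    unfolding YY_def .
  also have "\<dots> \<le> (1 - \<delta>) * YY q s + 2 / \<delta> * (3 * (NN (Suc q) s + NN q s + 2 * L\<^sup>2 * (DD (Suc q) s + DD q s)))"
    using \<delta> order_trans[OF sum_norm_power2_centered_le[OF n1] B] by (intro add_left_mono mult_left_mono) auto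
  finally show ?thesis by simp
qed

lemma NN_0: "NN 0 s = 0"
  by (simp add: NN_def v_0 x_0)

text \<open>For every realised draw the noise is a difference of two \<open>L\<close>-Lipschitz
  increments between iterate and snapshot, hence at most \<open>2 * L\<close> times their distance.
  Squaring gives 4, and splitting the distance at \<open>xst\<close> doubles it.\<close>

lemma NN_Suc:
  assumes s: "valid_draws n m s"
  shows "NN (Suc q) s \<le> 8 * L\<^sup>2 * (DD (Suc q) s + DD (q div K * K) s)"
proof -
  let ?z = "q div K * K"
  have "(norm (v (Suc q) i s - gb i (x (Suc q) i s)))\<^sup>2 \<le>
      8 * L\<^sup>2 * ((norm (x (Suc q) i s - xst))\<^sup>2 + (norm (x ?z i s - xst))\<^sup>2)" if i: "i < n" for i
  proof -
    let ?j = "s (draw_index K q i)"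
    have "v (Suc q) i s - gb i (x (Suc q) i s) =
        (g i ?j (x (Suc q) i s) - g i ?j (x ?z i s)) - (gb i (x (Suc q) i s) - gb i (x ?z i s))"
      by (simp add: v_Suc[OF s i])
    hence "norm (v (Suc q) i s - gb i (x (Suc q) i s)) \<le>
        norm (g i ?j (x (Suc q) i s) - g i ?j (x ?z i s)) + norm (gb i (x (Suc q) i s) - gb i (x ?z i s))"
      by (metis norm_triangle_ineq4)
    also have "\<dots> \<le> L * norm (x (Suc q) i s - x ?z i s) + L * norm (x (Suc q) i s - x ?z i s)"
      by (intro add_mono lip gb_lip draw_valid x_H i s)
    finally have "norm (v (Suc q) i s - gb i (x (Suc q) i s)) \<le> 2 * L * norm (x (Suc q) i s - x ?z i s)" by simp
    hence "(norm (v (Suc q) i s - gb i (x (Suc q) i s)))\<^sup>2 \<le> (2 * L * norm (x (Suc q) i s - x ?z i s))\<^sup>2"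
      by (intro power_mono) auto
    also have "\<dots> = 4 * L\<^sup>2 * (norm (x (Suc q) i s - x ?z i s))\<^sup>2" by (simp add: power_mult_distrib)
    also have "\<dots> \<le> 4 * L\<^sup>2 * (2 * (norm (x (Suc q) i s - xst))\<^sup>2 + 2 * (norm (x ?z i s - xst))\<^sup>2)"
      using norm_diff_power2_le_double[of "x (Suc q) i s - xst" "x ?z i s - xst"] by (intro mult_left_mono) auto
    finally show ?thesis by (simp add: algebra_simps)
  qed
  hence "NN (Suc q) s \<le> (\<Sum>i<n. 8 * L\<^sup>2 * ((norm (x (Suc q) i s - xst))\<^sup>2 + (norm (x ?z i s - xst))\<^sup>2))"
    unfolding NN_def by (intro sum_mono) auto
  also have "\<dots> = 8 * L\<^sup>2 * (DD (Suc q) s + DD ?z s)"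
    by (simp add: DD_def sum.distrib sum_distrib_left distrib_left)
  finally show ?thesis .
qed

text \<open>\<open>hb\<close> is the direction in which the mean would move without noise, and
  \<open>cross\<close> the part of the mean recursion that is linear in the noise.\<close>

definition hb where "hb q s = avg n (\<lambda>i. gb i (x q i s))"
definition cross where
  "cross q s = (\<Sum>i<n. inner (xb q s - xst - \<alpha> *\<^sub>R hb q s) (v q i s - gb i (x q i s)))"

lemma \<alpha>_bounds: "0 < \<alpha>" "\<alpha> * L\<^sup>2 = 1 / 2000 * \<delta>\<^sup>2 * \<mu>" "\<alpha> * L\<^sup>2 \<le> \<mu>" "\<alpha> * \<mu> \<le> 1 / 2000 * \<delta>\<^sup>2" "\<alpha> * \<mu> \<le> 1"
proof -
  have d2: "\<delta>\<^sup>2 \<le> 1" "0 < \<delta>\<^sup>2" using \<delta> by (auto simp: power_le_one)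
  show "0 < \<alpha>" using \<delta> \<mu> L0 by (simp add: \<alpha>)
  show *: "\<alpha> * L\<^sup>2 = 1 / 2000 * \<delta>\<^sup>2 * \<mu>" using L0 by (simp add: \<alpha>)
  have "\<delta>\<^sup>2 * \<mu> \<le> 1 * \<mu>" using d2 \<mu> by (intro mult_right_mono) auto
  thus "\<alpha> * L\<^sup>2 \<le> \<mu>" using * \<mu> by linarith
  have "\<mu> * \<mu> \<le> L\<^sup>2" using \<mu> by (simp add: power2_eq_square mult_mono)
  hence "\<mu> * \<mu> / L\<^sup>2 \<le> 1" using L0 by simp
  hence "1 / 2000 * \<delta>\<^sup>2 * (\<mu> * \<mu> / L\<^sup>2) \<le> 1 / 2000 * \<delta>\<^sup>2 * 1" using d2 by (intro mult_left_mono) auto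
  thus "\<alpha> * \<mu> \<le> 1 / 2000 * \<delta>\<^sup>2" by (simp add: \<alpha> mult.assoc)
  thus "\<alpha> * \<mu> \<le> 1" using d2 by simp
qed

lemma xb_H: "valid_draws n m s \<Longrightarrow> xb q s \<in> H"
  unfolding xb_def avg_def by (intro subspace_scale[OF H] subspace_sum[OF H] x_H) auto

text \<open>Comparison with an exact gradient step at the mean iterate. Strong monotonicity and
  \<open>\<alpha> * L\<^sup>2 \<le> \<mu>\<close> contract that step by
  \<open>1 - \<alpha> * \<mu>\<close>; replacing local by mean iterates costs
  \<open>L\<^sup>2 * XX q s\<close>. Young's weight \<open>\<alpha> * \<mu> / 2\<close> gives up
  half of the rate and makes the consensus factor
  \<open>3 * \<alpha> * L\<^sup>2 / \<mu>\<close>.\<close>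

lemma mean_descent:
  assumes s: "valid_draws n m s"
  shows "real n * (norm (xb q s - xst - \<alpha> *\<^sub>R hb q s))\<^sup>2 \<le>
    (1 - \<alpha> * \<mu> / 2) * ee q s + 3 * (1 / 2000) * \<delta>\<^sup>2 * XX q s"
proof -
  define G where "G = avg n (\<lambda>i. gb i (xb q s))"
  define d where "d = xb q s - xst"
  have n0: "0 < real n" using n1 by simp
  have st: "avg n (\<lambda>i. gb i xst) = 0" by (simp add: avg_def opt)
  have Gst: "G = avg n (\<lambda>i. gb i (xb q s) - gb i xst)" by (simp add: avg_diff st G_def)
  have "\<mu> * (norm d)\<^sup>2 = (1 / real n) * (\<Sum>i<n. \<mu> * (norm d)\<^sup>2)" using n0 by simp
  also have "\<dots> \<le> (1 / real n) * (\<Sum>i<n. inner (gb i (xb q s) - gb i xst) d)"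
    unfolding d_def using n0 by (intro mult_left_mono sum_mono gb_mono xb_H s xst) auto
  also have "\<dots> = inner G d" unfolding Gst by (simp add: avg_def inner_sum_left)
  finally have mon: "\<mu> * (norm d)\<^sup>2 \<le> inner G d" .
  have sq: "(norm (gb i a - gb i b))\<^sup>2 \<le> L\<^sup>2 * (norm (a - b))\<^sup>2" if "i < n" "a \<in> H" "b \<in> H" for i a b
    using power_mono[OF gb_lip[OF that], of 2] by (simp add: power_mult_distrib)
  have "real n * (norm G)\<^sup>2 \<le> (\<Sum>i<n. (norm (gb i (xb q s) - gb i xst))\<^sup>2)"
    unfolding Gst by (rule norm_avg_power2_le[OF n1])
  also have "\<dots> \<le> (\<Sum>i<n. L\<^sup>2 * (norm d)\<^sup>2)"
    unfolding d_def by (intro sum_mono sq xb_H s xst) auto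
  also have "\<dots> = real n * (L\<^sup>2 * (norm d)\<^sup>2)" by simp
  finally have G2: "(norm G)\<^sup>2 \<le> L\<^sup>2 * (norm d)\<^sup>2" using n0 by simp
  have "(norm (d - \<alpha> *\<^sub>R G))\<^sup>2 = (norm d)\<^sup>2 - 2 * \<alpha> * inner G d + \<alpha>\<^sup>2 * (norm G)\<^sup>2"
    by (simp add: norm_diff_scaleR_power2 inner_commute[of d G])
  also have "\<dots> \<le> (norm d)\<^sup>2 - 2 * \<alpha> * (\<mu> * (norm d)\<^sup>2) + \<alpha>\<^sup>2 * (L\<^sup>2 * (norm d)\<^sup>2)"
    using mon G2 \<alpha>_bounds(1) by (intro add_mono diff_mono mult_left_mono) auto
  also have "\<alpha>\<^sup>2 * (L\<^sup>2 * (norm d)\<^sup>2) = \<alpha> * ((\<alpha> * L\<^sup>2) * (norm d)\<^sup>2)" by (simp add: power2_eq_square)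
  also have "\<dots> \<le> \<alpha> * (\<mu> * (norm d)\<^sup>2)"
    using \<alpha>_bounds by (intro mult_left_mono mult_right_mono) auto
  finally have A: "(norm (d - \<alpha> *\<^sub>R G))\<^sup>2 \<le> (1 - \<alpha> * \<mu>) * (norm d)\<^sup>2" by (simp add: algebra_simps)
  have "G - hb q s = avg n (\<lambda>i. gb i (xb q s) - gb i (x q i s))" by (simp add: G_def hb_def avg_diff)
  hence "real n * (norm (G - hb q s))\<^sup>2 \<le> (\<Sum>i<n. (norm (gb i (xb q s) - gb i (x q i s)))\<^sup>2)"
    using norm_avg_power2_le[OF n1] by simp
  also have "\<dots> \<le> (\<Sum>i<n. L\<^sup>2 * (norm (xb q s - x q i s))\<^sup>2)"
    by (intro sum_mono sq xb_H x_H s) auto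
  also have "\<dots> = L\<^sup>2 * XX q s" by (simp add: XX_def sum_distrib_left norm_minus_commute)
  finally have Gh: "real n * (norm (G - hb q s))\<^sup>2 \<le> L\<^sup>2 * XX q s" .
  define \<theta> where "\<theta> = \<alpha> * \<mu> / 2"
  have \<theta>: "0 < \<theta>" "\<theta> \<le> 1 / 2" using \<alpha>_bounds \<mu> by (auto simp: \<theta>_def)
  have "xb q s - xst - \<alpha> *\<^sub>R hb q s = (d - \<alpha> *\<^sub>R G) + \<alpha> *\<^sub>R (G - hb q s)"
    by (simp add: d_def scaleR_diff_right)
  hence "(norm (xb q s - xst - \<alpha> *\<^sub>R hb q s))\<^sup>2 \<le>
      (1 + \<theta>) * (norm (d - \<alpha> *\<^sub>R G))\<^sup>2 + (1 + 1 / \<theta>) * (norm (\<alpha> *\<^sub>R (G - hb q s)))\<^sup>2"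
    using norm_add_power2_le[OF \<theta>(1), of "d - \<alpha> *\<^sub>R G" "\<alpha> *\<^sub>R (G - hb q s)"] by simp
  also have "\<dots> \<le> (1 + \<theta>) * ((1 - \<alpha> * \<mu>) * (norm d)\<^sup>2) + (3 / (\<alpha> * \<mu>)) * (\<alpha>\<^sup>2 * (norm (G - hb q s))\<^sup>2)"
  proof (intro add_mono mult_left_mono mult_mono A)
    have "1 + 1 / \<theta> = (1 + \<theta>) / \<theta>" using \<theta> by (simp add: field_simps)
    also have "\<dots> \<le> (3 / 2) / \<theta>" using \<theta> by (intro divide_right_mono) auto
    also have "\<dots> = 3 / (\<alpha> * \<mu>)" by (simp add: \<theta>_def)
    finally show "1 + 1 / \<theta> \<le> 3 / (\<alpha> * \<mu>)" .
  qed (use \<theta> \<alpha>_bounds \<mu> in \<open>auto simp: power_mult_distrib\<close>)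
  also have "(3 / (\<alpha> * \<mu>)) * (\<alpha>\<^sup>2 * (norm (G - hb q s))\<^sup>2) = 3 * \<alpha> / \<mu> * (norm (G - hb q s))\<^sup>2"
    using \<alpha>_bounds by (simp add: power2_eq_square)
  also have "(1 + \<theta>) * ((1 - \<alpha> * \<mu>) * (norm d)\<^sup>2) \<le> (1 - \<alpha> * \<mu> / 2) * (norm d)\<^sup>2"
  proof -
    have e: "\<alpha> * \<mu> = 2 * \<theta>" by (simp add: \<theta>_def)
    have "(1 + \<theta>) * (1 - \<alpha> * \<mu>) \<le> 1 - \<alpha> * \<mu> / 2" unfolding e using \<theta> by (simp add: algebra_simps)
    thus ?thesis using mult_right_mono[of _ _ "(norm d)\<^sup>2"] by (fastforce simp: mult.assoc)
  qed
  finally have "(norm (xb q s - xst - \<alpha> *\<^sub>R hb q s))\<^sup>2 \<le>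
      (1 - \<alpha> * \<mu> / 2) * (norm d)\<^sup>2 + 3 * \<alpha> / \<mu> * (norm (G - hb q s))\<^sup>2" by simp
  hence "real n * (norm (xb q s - xst - \<alpha> *\<^sub>R hb q s))\<^sup>2 \<le>
      real n * ((1 - \<alpha> * \<mu> / 2) * (norm d)\<^sup>2 + 3 * \<alpha> / \<mu> * (norm (G - hb q s))\<^sup>2)"
    by (intro mult_left_mono) auto
  also have "\<dots> = (1 - \<alpha> * \<mu> / 2) * ee q s + 3 * \<alpha> / \<mu> * (real n * (norm (G - hb q s))\<^sup>2)"
    by (simp add: ee_def d_def algebra_simps)
  also have "\<dots> \<le> (1 - \<alpha> * \<mu> / 2) * ee q s + 3 * \<alpha> / \<mu> * (L\<^sup>2 * XX q s)"
    using Gh \<alpha>_bounds \<mu> by (intro add_left_mono mult_left_mono) auto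
  also have "3 * \<alpha> / \<mu> * (L\<^sup>2 * XX q s) = 3 / \<mu> * (\<alpha> * L\<^sup>2) * XX q s" by simp
  also have "\<dots> = 3 * (1 / 2000) * \<delta>\<^sup>2 * XX q s" unfolding \<alpha>_bounds(2) using \<mu> by simp
  finally show ?thesis .
qed

text \<open>The square is expanded exactly and the term linear in the noise is kept: a pathwise
  bound on it would be of first order in \<alpha> and could outweigh the contraction.\<close>

lemma ee_Suc:
  assumes s: "valid_draws n m s"
  shows "ee (Suc q) s \<le> (1 - \<alpha> * \<mu> / 2) * ee q s + 3 * (1 / 2000) * \<delta>\<^sup>2 * XX q s + \<alpha>\<^sup>2 * NN q s - 2 * \<alpha> * cross q s"
proof -
  define A where "A = xb q s - xst - \<alpha> *\<^sub>R hb q s"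
  define \<nu> where "\<nu> = avg n (\<lambda>i. v q i s - gb i (x q i s))"
  have "xb (Suc q) s = avg n (\<lambda>i. (\<Sum>r<n. w i r *\<^sub>R x q r s) - \<alpha> *\<^sub>R y q i s)"
    unfolding xb_def by (rule avg_cong) (simp add: x_Suc[OF s])
  also have "\<dots> = xb q s - \<alpha> *\<^sub>R avg n (\<lambda>i. v q i s)"
    by (simp add: avg_diff avg_mix[OF col] avg_scaleR avg_y[OF s] xb_def)
  finally have "xb (Suc q) s - xst = A - \<alpha> *\<^sub>R \<nu>"
    by (simp add: A_def \<nu>_def hb_def avg_diff scaleR_diff_right)
  hence "ee (Suc q) s = real n * ((norm A)\<^sup>2 - 2 * \<alpha> * inner A \<nu> + \<alpha>\<^sup>2 * (norm \<nu>)\<^sup>2)"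
    by (simp add: ee_def norm_diff_scaleR_power2)
  hence "ee (Suc q) s = real n * (norm A)\<^sup>2 - 2 * \<alpha> * (real n * inner A \<nu>) + \<alpha>\<^sup>2 * (real n * (norm \<nu>)\<^sup>2)"
    by (simp add: algebra_simps)
  moreover have "2 * \<alpha> * (real n * inner A \<nu>) = 2 * \<alpha> * cross q s"
    using n1 by (simp add: \<nu>_def avg_def cross_def A_def inner_sum_right)
  moreover have "\<alpha>\<^sup>2 * (real n * (norm \<nu>)\<^sup>2) \<le> \<alpha>\<^sup>2 * NN q s"
    unfolding \<nu>_def NN_def by (intro mult_left_mono norm_avg_power2_le[OF n1]) auto
  moreover have "real n * (norm A)\<^sup>2 \<le> (1 - \<alpha> * \<mu> / 2) * ee q s + 3 * (1 / 2000) * \<delta>\<^sup>2 * XX q s"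
    unfolding A_def by (rule mean_descent[OF s])
  ultimately show ?thesis by linarith
qed

section \<open>Expectations over the draws\<close>

sublocale D: finite_draws "UNIV \<times> {1..} \<times> {..<n}" "\<lambda>(t::nat, k::nat, i). pmf_of_set {..<m i}"
proof
  fix c :: "nat \<times> nat \<times> nat" assume "c \<in> UNIV \<times> {1..} \<times> {..<n}"
  then obtain t k i where "c = (t, k, i)" "i < n" by auto
  moreover from this have "{..<m i} \<noteq> {}" using m1[of i] by (simp add: lessThan_empty_iff)
  ultimately show "finite (set_pmf (case c of (t, k, i) \<Rightarrow> pmf_of_set {..<m i}))" by simp
qed

lemma draws_eq: "draws n m = D.law"
  unfolding draws_def by (rule PiM_cong) auto

abbreviation E :: "((nat \<times> nat \<times> nat \<Rightarrow> nat) \<Rightarrow> real) \<Rightarrow> real" where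
  "E F \<equiv> integral\<^sup>L (draws n m) F"

lemma AE_valid: "AE s in draws n m. valid_draws n m s"
proof -
  have "AE s in draws n m. \<forall>c\<in>UNIV \<times> {1..} \<times> {..<n}. s c \<in> set_pmf ((\<lambda>(t::nat, k::nat, i). pmf_of_set {..<m i}) c)"
    unfolding draws_eq by (rule D.AE_support) simp
  thus ?thesis
  proof (rule AE_mp, intro AE_I2 impI)
    fix s assume *: "\<forall>c\<in>UNIV \<times> {1..} \<times> {..<n}. s c \<in> set_pmf ((\<lambda>(t::nat, k::nat, i). pmf_of_set {..<m i}) c)"
    show "valid_draws n m s" unfolding valid_draws_def
    proof (intro allI impI)
      fix t k i :: nat assume "1 \<le> k" "i < n"
      moreover from this have "{..<m i} \<noteq> {}" using m1[of i] by (simp add: lessThan_empty_iff)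
      ultimately show "s (t, k, i) < m i" using *[rule_format, of "(t, k, i)"] by simp
    qed
  qed
qed

lemma integrable_dep: "depends_on (draws_before n K q) F \<Longrightarrow> integrable (draws n m) (F :: _ \<Rightarrow> real)"
  unfolding draws_eq by (rule D.integrable_depends_on[OF _ finite_draws_before draws_before_subset])

lemma agree:
  assumes "\<forall>c\<in>draws_before n K q. s c = s' c" "i < n"
  shows "x q i s = x q i s'" "y q i s = y q i s'" "v q i s = v q i s'"
proof -
  have "draws_before n K (q - 1) \<subseteq> draws_before n K q" by (rule draws_before_mono) simp
  thus "x q i s = x q i s'" using assms by (intro depends_onD[OF dep_x]) auto
  show "y q i s = y q i s'" "v q i s = v q i s'" using assms by (auto intro: depends_onD[OF dep_y] depends_onD[OF dep_v])
qed

lemma agree_xb: "\<forall>c\<in>draws_before n K q. s c = s' c \<Longrightarrow> xb q s = xb q s'"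
  unfolding xb_def by (intro avg_cong agree)

lemma agree_hb: "\<forall>c\<in>draws_before n K q. s c = s' c \<Longrightarrow> hb q s = hb q s'"
  unfolding hb_def by (intro avg_cong arg_cong[where f = "gb _"] agree)

lemma dep_quantities:
  "depends_on (draws_before n K q) (ee q)" "depends_on (draws_before n K q) (XX q)"
  "depends_on (draws_before n K q) (YY q)" "depends_on (draws_before n K q) (NN q)"
  "depends_on (draws_before n K q) (DD q)" "depends_on (draws_before n K q) (cross q)"
proof -
  have *: "ee q s = ee q s' \<and> XX q s = XX q s' \<and> YY q s = YY q s' \<and> NN q s = NN q s' \<and> DD q s = DD q s' \<and> cross q s = cross q s'"
    if a: "\<forall>c\<in>draws_before n K q. s c = s' c" for s s'
  proof -
    have "avg n (\<lambda>i. y q i s) = avg n (\<lambda>i. y q i s')" by (intro avg_cong agree a)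
    thus ?thesis
      unfolding ee_def XX_def YY_def NN_def DD_def cross_def
      by (simp add: agree_xb[OF a] agree_hb[OF a] agree[OF a])
  qed
  show "depends_on (draws_before n K q) (ee q)" "depends_on (draws_before n K q) (XX q)"
    "depends_on (draws_before n K q) (YY q)" "depends_on (draws_before n K q) (NN q)"
    "depends_on (draws_before n K q) (DD q)" "depends_on (draws_before n K q) (cross q)"
    unfolding depends_on_def using * by blast+
qed

lemma integrable_quantities [simp]:
  "integrable (draws n m) (ee q)" "integrable (draws n m) (XX q)" "integrable (draws n m) (YY q)"
  "integrable (draws n m) (NN q)" "integrable (draws n m) (DD q)" "integrable (draws n m) (cross q)"
  by (rule integrable_dep, rule dep_quantities)+

lemma valid_upd: "valid_draws n m s \<Longrightarrow> i < n \<Longrightarrow> j < m i \<Longrightarrow> valid_draws n m (s(draw_index K q i := j))"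
  by (auto simp: valid_draws_def draw_index_def)

text \<open>Averaging over the single draw of node \<open>i\<close> turns the variance-reduced gradient into the local
  gradient, while the iterate at which it is evaluated does not depend on that draw.\<close>

lemma E_cross: "E (cross q) = 0"
proof (cases q)
  case 0
  have "cross 0 = (\<lambda>s. 0)" by (simp add: fun_eq_iff cross_def v_0 x_0)
  thus ?thesis using 0 by simp
next
  case (Suc q')
  define F where "F i s = inner (xb q s - xst - \<alpha> *\<^sub>R hb q s) (v q i s - gb i (x q i s))" for i s
  have depF: "depends_on (draws_before n K q) (F i)" if "i < n" for i
    unfolding depends_on_def F_def
  proof (intro allI impI)
    fix s s' :: "nat \<times> nat \<times> nat \<Rightarrow> nat" assume a: "\<forall>c\<in>draws_before n K q. s c = s' c"
    show "inner (xb q s - xst - \<alpha> *\<^sub>R hb q s) (v q i s - gb i (x q i s)) =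
        inner (xb q s' - xst - \<alpha> *\<^sub>R hb q s') (v q i s' - gb i (x q i s'))"
      by (simp add: agree_xb[OF a] agree_hb[OF a] agree[OF a] that)
  qed
  have "E (F i) = 0" if i: "i < n" for i
  proof -
    \<comment> \<open>The draw of node \<open>i\<close> that produced \<open>v q i\<close>; nothing
      else in \<open>F i\<close> reads it.\<close>
    define c where "c = draw_index K q' i"
    have c: "c \<in> UNIV \<times> {1..} \<times> {..<n}" using i by (simp add: c_def draw_index_def)
    have mi: "0 < m i" "{..<m i} \<noteq> {}" using m1[OF i] by (auto simp: lessThan_empty_iff)
    have "E (F i) = E (\<lambda>s. measure_pmf.expectation ((\<lambda>(t, k, i). pmf_of_set {..<m i}) c) (\<lambda>j. F i (s(c := j))))"
      unfolding draws_eq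
      by (rule D.integral_resample[OF depF[OF i] finite_draws_before draws_before_subset c])
    also have "(\<lambda>(t, k, i). pmf_of_set {..<m i}) c = pmf_of_set {..<m i}" by (simp add: c_def draw_index_def)
    also have "E (\<lambda>s. measure_pmf.expectation (pmf_of_set {..<m i}) (\<lambda>j. F i (s(c := j)))) = 0"
    proof (rule integral_eq_zero_AE)
      show "AE s in draws n m. measure_pmf.expectation (pmf_of_set {..<m i}) (\<lambda>j. F i (s(c := j))) = 0"
        using AE_valid
      proof (rule AE_mp, intro AE_I2 impI)
        fix s assume s: "valid_draws n m s"
        let ?z = "q' div K * K"
        let ?A = "xb q s - xst - \<alpha> *\<^sub>R hb q s"
        have upd: "x q i' (s(c := j)) = x q i' s" "x ?z i' (s(c := j)) = x ?z i' s" if "i' < n" for i' j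
        proof -
          \<comment> \<open>Iterates lag one draw behind: the snapshot depends on the draws before
            \<open>?z - 1\<close>, which do not include \<open>c\<close>.\<close>
          have "?z - 1 \<le> q'" using div_times_less_eq_dividend[of q' K] by linarith
          hence "c \<notin> draws_before n K (?z - 1)"
            using draws_before_mono draw_index_notin_before[of K q' i n] unfolding c_def by blast
          thus "x ?z i' (s(c := j)) = x ?z i' s" by (rule depends_on_upd[OF dep_x[OF that]])
          show "x q i' (s(c := j)) = x q i' s"
            by (rule depends_on_upd[OF dep_x[OF that]]) (simp add: Suc c_def draw_index_notin_before)
        qed
        have "xb q (s(c := j)) = xb q s" "hb q (s(c := j)) = hb q s" for j
          unfolding xb_def hb_def by (auto intro!: avg_cong simp: upd)
        hence "F i (s(c := j)) = inner ?A (g i j (x q i s) - g i j (x ?z i s)) + inner ?A (gb i (x ?z i s) - gb i (x q i s))"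
          if "j < m i" for j
          using v_Suc[OF valid_upd[OF s i that, of q'] i, of q'] i
          by (simp add: F_def Suc upd[unfolded Suc c_def] c_def inner_diff_right inner_add_right)
        hence "measure_pmf.expectation (pmf_of_set {..<m i}) (\<lambda>j. F i (s(c := j))) =
          (\<Sum>j<m i. inner ?A (g i j (x q i s) - g i j (x ?z i s)) + inner ?A (gb i (x ?z i s) - gb i (x q i s))) / real (m i)"
          using mi by (simp add: integral_pmf_of_set)
        also have "\<dots> = inner ?A ((1 / real (m i)) *\<^sub>R (\<Sum>j<m i. g i j (x q i s) - g i j (x ?z i s)))
            + inner ?A (gb i (x ?z i s) - gb i (x q i s))"
          using mi by (simp add: sum.distrib inner_sum_right add_divide_distrib)
        also have "(1 / real (m i)) *\<^sub>R (\<Sum>j<m i. g i j (x q i s) - g i j (x ?z i s)) = gb i (x q i s) - gb i (x ?z i s)"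
          by (simp add: gb i x_H s sum_subtractf scaleR_diff_right)
        also have "inner ?A (gb i (x q i s) - gb i (x ?z i s)) + inner ?A (gb i (x ?z i s) - gb i (x q i s)) = 0"
          by (simp add: inner_diff_right)
        finally show "measure_pmf.expectation (pmf_of_set {..<m i}) (\<lambda>j. F i (s(c := j))) = 0" .
      qed
    qed
    finally show ?thesis .
  qed
  moreover have "cross q = (\<lambda>s. \<Sum>i<n. F i s)" by (simp add: fun_eq_iff cross_def F_def)
  ultimately show ?thesis using integrable_dep[OF depF] by simp
qed

lemma E_mono:
  assumes "integrable (draws n m) F" "integrable (draws n m) G" "\<And>s. valid_draws n m s \<Longrightarrow> F s \<le> G s"
  shows "E F \<le> E G"
  using assms AE_valid by (intro integral_mono_AE) auto

lemma E_nonneg: "0 \<le> E (ee q)" "0 \<le> E (XX q)" "0 \<le> E (YY q)" "0 \<le> E (NN q)" "0 \<le> E (DD q)"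
  by (auto intro!: Bochner_Integration.integral_nonneg nonneg)

lemma E_DD: "E (DD q) = E (ee q) + E (XX q)"
proof -
  have "DD q = (\<lambda>s. ee q s + XX q s)" by (simp add: fun_eq_iff DD_eq)
  thus ?thesis by simp
qed

lemma E_ee_Suc:
  "E (ee (Suc q)) \<le> (1 - \<alpha> * \<mu> / 2) * E (ee q) + 3 * (1 / 2000) * \<delta>\<^sup>2 * E (XX q) + \<alpha>\<^sup>2 * E (NN q)"
proof -
  have "E (ee (Suc q)) \<le> E (\<lambda>s. (1 - \<alpha> * \<mu> / 2) * ee q s + 3 * (1 / 2000) * \<delta>\<^sup>2 * XX q s + \<alpha>\<^sup>2 * NN q s - 2 * \<alpha> * cross q s)"
    by (intro E_mono ee_Suc) auto
  thus ?thesis by (simp add: E_cross)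
qed

lemma E_XX_Suc: "E (XX (Suc q)) \<le> (1 - \<delta>) * E (XX q) + 2 * \<alpha>\<^sup>2 / \<delta> * E (YY q)"
proof -
  have "E (XX (Suc q)) \<le> E (\<lambda>s. (1 - \<delta>) * XX q s + 2 * \<alpha>\<^sup>2 / \<delta> * YY q s)"
    by (intro E_mono XX_Suc) auto
  thus ?thesis by simp
qed

lemma E_YY_Suc: "E (YY (Suc q)) \<le> (1 - \<delta>) * E (YY q) +
    6 / \<delta> * (E (NN (Suc q)) + E (NN q) + 2 * L\<^sup>2 * (E (DD (Suc q)) + E (DD q)))"
proof -
  have "E (YY (Suc q)) \<le> E (\<lambda>s. (1 - \<delta>) * YY q s +
    6 / \<delta> * (NN (Suc q) s + NN q s + 2 * L\<^sup>2 * (DD (Suc q) s + DD q s)))"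
    by (intro E_mono YY_Suc) auto
  thus ?thesis by simp
qed

lemma E_NN_Suc: "E (NN (Suc q)) \<le> 8 * L\<^sup>2 * (E (DD (Suc q)) + E (DD (q div K * K)))"
proof -
  have "E (NN (Suc q)) \<le> E (\<lambda>s. 8 * L\<^sup>2 * (DD (Suc q) s + DD (q div K * K) s))"
    by (intro E_mono NN_Suc) auto
  thus ?thesis by simp
qed

lemma E_NN_0: "E (NN 0) = 0"
proof -
  have "NN 0 = (\<lambda>s. 0)" by (simp add: fun_eq_iff NN_0)
  thus ?thesis by simp
qed

section \<open>Contraction over one outer iteration\<close>

definition U where "U t = E (ee (t * K)) + E (XX (t * K)) + 8 * (\<alpha>\<^sup>2 / \<delta>\<^sup>2 * E (YY (t * K)))"

lemma outer_step:
  assumes K: "32 / (\<alpha> * \<mu>) \<le> real K"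
  shows "U (Suc t) \<le> U t / 7 + (E (DD (t * K)) + E (DD ((t - 1) * K))) / 12"
proof -
  \<comment> \<open>The estimate at \<open>k = 0\<close> stems from the previous loop, so both
    snapshots are added to have one \<open>Z\<close> for the whole loop. For \<open>t = 0\<close>
    truncated subtraction makes them equal, and the initial noise is 0.\<close>
  define Z where "Z = E (DD (t * K)) + E (DD ((t - 1) * K))"
  have aL: "\<alpha>\<^sup>2 * L\<^sup>2 = \<alpha> * \<mu> * (1 / 2000) * \<delta>\<^sup>2"
  proof -
    have "\<alpha>\<^sup>2 * L\<^sup>2 = \<alpha> * (\<alpha> * L\<^sup>2)" by (simp add: power2_eq_square)
    thus ?thesis unfolding \<alpha>_bounds(2) by simp
  qed
  have N: "\<alpha>\<^sup>2 * E (NN (t * K + k)) \<le> 8 * (\<alpha> * \<mu> * (1 / 2000) * \<delta>\<^sup>2) * (E (ee (t * K + k)) + E (XX (t * K + k)) + Z)"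
    if k: "k \<le> K" for k
  proof -
    have "E (NN (t * K + k)) \<le> 8 * L\<^sup>2 * (E (DD (t * K + k)) + Z)"
    proof (cases "t * K + k")
      case 0
      hence "E (NN (t * K + k)) = 0" by (simp only: E_NN_0)
      moreover have "0 \<le> 8 * L\<^sup>2 * (E (DD (t * K + k)) + Z)"
        unfolding Z_def by (intro mult_nonneg_nonneg add_nonneg_nonneg E_nonneg) auto
      ultimately show ?thesis by simp
    next
      case (Suc q)
      have "q div K = t \<or> q div K = t - 1"
      proof (cases k)
        case 0
        then obtain t' where t: "t = Suc t'" using Suc by (cases t) auto
        have "q = K - 1 + t' * K" using Suc 0 t K1 by simp
        also have "\<dots> div K = t' + (K - 1) div K" using K1 by (intro div_mult_self1) simp
        also have "\<dots> = t'" using K1 by simp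
        finally have "q div K = t'" .
        thus ?thesis using t by simp
      next
        case (Suc k')
        have "q = k' + t * K" using \<open>t * K + k = Suc q\<close> Suc by simp
        hence "q div K = t" using k Suc by simp
        thus ?thesis by simp
      qed
      hence "E (DD (q div K * K)) \<le> Z" using E_nonneg(5) by (auto simp: Z_def)
      hence "8 * L\<^sup>2 * (E (DD (Suc q)) + E (DD (q div K * K))) \<le> 8 * L\<^sup>2 * (E (DD (Suc q)) + Z)"
        by (intro mult_left_mono) auto
      thus ?thesis using E_NN_Suc[of q] Suc by simp
    qed
    hence "\<alpha>\<^sup>2 * E (NN (t * K + k)) \<le> \<alpha>\<^sup>2 * (8 * L\<^sup>2 * (E (DD (t * K + k)) + Z))"
      by (intro mult_left_mono) auto
    also have "\<dots> = 8 * (\<alpha>\<^sup>2 * L\<^sup>2) * (E (ee (t * K + k)) + E (XX (t * K + k)) + Z)"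
      by (simp add: E_DD)
    finally show ?thesis unfolding aL .
  qed
  have "E (ee (t * K + K)) + E (XX (t * K + K)) + 8 * (\<alpha>\<^sup>2 / \<delta>\<^sup>2 * E (YY (t * K + K)))
    \<le> (E (ee (t * K + 0)) + E (XX (t * K + 0)) + 8 * (\<alpha>\<^sup>2 / \<delta>\<^sup>2 * E (YY (t * K + 0)))) / 7 + Z / 12"
  proof (rule gt_inner_loop_contraction[where a = "\<alpha> * \<mu>" and n = "\<lambda>k. \<alpha>\<^sup>2 * E (NN (t * K + k))" and c = "1 / 2000" and \<delta> = \<delta>])
    fix k
    show "E (XX (t * K + Suc k)) \<le> (1 - \<delta>) * E (XX (t * K + k)) + 2 * \<delta> * (\<alpha>\<^sup>2 / \<delta>\<^sup>2 * E (YY (t * K + k)))"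
      using E_XX_Suc[of "t * K + k"] \<delta> by (simp add: power2_eq_square)
    have "\<alpha>\<^sup>2 / \<delta>\<^sup>2 * E (YY (t * K + Suc k)) \<le> \<alpha>\<^sup>2 / \<delta>\<^sup>2 * ((1 - \<delta>) * E (YY (t * K + k)) +
      6 / \<delta> * (E (NN (t * K + Suc k)) + E (NN (t * K + k)) + 2 * L\<^sup>2 * (E (DD (t * K + Suc k)) + E (DD (t * K + k)))))"
      using E_YY_Suc[of "t * K + k"] by (intro mult_left_mono) auto
    also have "\<dots> = (1 - \<delta>) * (\<alpha>\<^sup>2 / \<delta>\<^sup>2 * E (YY (t * K + k))) + 6 / \<delta>^3 * (\<alpha>\<^sup>2 * E (NN (t * K + Suc k)) +
       \<alpha>\<^sup>2 * E (NN (t * K + k)) + 2 * (\<alpha>\<^sup>2 * L\<^sup>2) * (E (DD (t * K + Suc k)) + E (DD (t * K + k))))"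
      using \<delta> by (simp add: field_simps power2_eq_square power3_eq_cube)
    finally show "\<alpha>\<^sup>2 / \<delta>\<^sup>2 * E (YY (t * K + Suc k)) \<le> (1 - \<delta>) * (\<alpha>\<^sup>2 / \<delta>\<^sup>2 * E (YY (t * K + k))) +
      6 / \<delta>^3 * (\<alpha>\<^sup>2 * E (NN (t * K + Suc k)) + \<alpha>\<^sup>2 * E (NN (t * K + k)) + 2 * (\<alpha> * \<mu> * (1 / 2000) * \<delta>\<^sup>2) *
        (E (ee (t * K + Suc k)) + E (XX (t * K + Suc k)) + (E (ee (t * K + k)) + E (XX (t * K + k)))))"
      unfolding aL E_DD .
    show "E (ee (t * K + Suc k)) \<le> (1 - \<alpha> * \<mu> / 2) * E (ee (t * K + k)) + 3 * (1 / 2000) * \<delta>\<^sup>2 * E (XX (t * K + k)) + \<alpha>\<^sup>2 * E (NN (t * K + k))"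
      using E_ee_Suc[of "t * K + k"] by simp
  qed (use \<alpha>_bounds \<mu> \<delta> K E_nonneg N in \<open>auto simp: Z_def\<close>)
  thus ?thesis by (simp add: U_def Z_def add.commute)
qed

lemma geometric_rate:
  assumes K: "32 / (\<alpha> * \<mu>) \<le> real K"
  shows "\<exists>P\<ge>0. \<forall>t. E (DD (t * K)) \<le> P * (3 / 4) ^ t"
proof -
  have U0: "0 \<le> U t" for t using E_nonneg by (simp add: U_def)
  have DU: "E (DD (t * K)) \<le> U t" for t using E_nonneg by (simp add: U_def E_DD)
  have "U t \<le> U 0 * (3 / 4) ^ t" for t
  proof (rule two_step_contraction)
    \<comment> \<open>\<open>1/7 + 2/12 \<le> 1/2\<close>: at \<open>t = 0\<close> the same snapshot
      is counted twice. Later loops need \<open>1/7 + 1/12 \<le> 1/4\<close> and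
      \<open>1/12 \<le> 1/4\<close>.\<close>
    show "U (Suc 0) \<le> U 0 / 2" using outer_step[OF K, of 0] DU[of 0] U0[of 0] by simp
    show "U (Suc (Suc t)) \<le> (U (Suc t) + U t) / 4" for t
      using outer_step[OF K, of "Suc t"] DU[of t] DU[of "Suc t"] U0[of t] U0[of "Suc t"]
      by (simp add: add_divide_distrib)
  qed (rule U0)
  thus ?thesis using DU U0 order_trans by (intro exI[of _ "U 0"]) blast
qed

end

section \<open>From the algorithm to the abstract process\<close>

lemma norm_fsvec_power2:
  assumes "finite A" "{d. coord x d \<noteq> 0} \<subseteq> A"
  shows "(norm x)\<^sup>2 = (\<Sum>d\<in>A. (coord x d)\<^sup>2)"
  unfolding power2_norm_eq_inner inner_fsvec_eq[OF assms] by (simp add: power2_eq_square)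

text \<open>Mixing acts on each coordinate separately, so the scalar bound is summed over the
  finitely many coordinates that occur in \<open>z\<close>.\<close>

lemma fsvec_mix_contraction:
  fixes z :: "nat \<Rightarrow> fsvec" and w :: "nat \<Rightarrow> nat \<Rightarrow> real"
  assumes contr: "\<And>u. (\<Sum>i<n. u i) = 0 \<Longrightarrow> (\<Sum>i<n. (\<Sum>r<n. w i r * u r)\<^sup>2) \<le> c * (\<Sum>i<n. (u i)\<^sup>2)"
    and z: "(\<Sum>i<n. z i) = 0"
  shows "(\<Sum>i<n. (norm (\<Sum>r<n. w i r *\<^sub>R z r))\<^sup>2) \<le> c * (\<Sum>i<n. (norm (z i))\<^sup>2)"
proof -
  define A where "A = (\<Union>i<n. {d. coord (z i) d \<noteq> 0})"
  have A: "finite A" using finite_coord by (simp add: A_def)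
  have nz: "(norm (z i))\<^sup>2 = (\<Sum>d\<in>A. (coord (z i) d)\<^sup>2)" if "i < n" for i
    using that by (intro norm_fsvec_power2 A) (auto simp: A_def)
  have nw: "(norm (\<Sum>r<n. w i r *\<^sub>R z r))\<^sup>2 = (\<Sum>d\<in>A. (\<Sum>r<n. w i r * coord (z r) d)\<^sup>2)" for i
  proof -
    have "{d. coord (\<Sum>r<n. w i r *\<^sub>R z r) d \<noteq> 0} \<subseteq> A"
    proof
      fix d assume "d \<in> {d. coord (\<Sum>r<n. w i r *\<^sub>R z r) d \<noteq> 0}"
      hence "(\<Sum>r<n. w i r * coord (z r) d) \<noteq> 0" by simp
      then obtain r where "r < n" "w i r * coord (z r) d \<noteq> 0" by (meson lessThan_iff sum.not_neutral_contains_not_neutral)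
      thus "d \<in> A" by (auto simp: A_def)
    qed
    thus ?thesis by (simp add: norm_fsvec_power2[OF A])
  qed
  have "(\<Sum>i<n. (norm (\<Sum>r<n. w i r *\<^sub>R z r))\<^sup>2) = (\<Sum>d\<in>A. \<Sum>i<n. (\<Sum>r<n. w i r * coord (z r) d)\<^sup>2)"
    unfolding nw by (rule sum.swap)
  also have "\<dots> \<le> (\<Sum>d\<in>A. c * (\<Sum>i<n. (coord (z i) d)\<^sup>2))"
  proof (intro sum_mono contr)
    fix d
    show "(\<Sum>i<n. coord (z i) d) = 0" using arg_cong[OF z, of "\<lambda>x. coord x d"] by simp
  qed
  also have "\<dots> = c * (\<Sum>i<n. \<Sum>d\<in>A. (coord (z i) d)\<^sup>2)"
    by (subst sum.swap) (simp add: sum_distrib_left)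
  also have "\<dots> = c * (\<Sum>i<n. (norm (z i))\<^sup>2)" using nz by simp
  finally show ?thesis .
qed

locale gt_problem =
  fixes p n :: nat and m :: "nat \<Rightarrow> nat" and f :: "nat \<Rightarrow> nat \<Rightarrow> real vec \<Rightarrow> real" and W :: "real mat"
    and \<mu> L :: real and xstar :: "real vec" and \<alpha> :: real and K :: nat and x0 :: "nat \<Rightarrow> real vec"
  assumes p: "1 \<le> p" and n: "1 \<le> n" and m: "i < n \<Longrightarrow> 1 \<le> m i" and \<mu>: "0 < \<mu>"
    and diff: "i < n \<Longrightarrow> j < m i \<Longrightarrow> differentiable_fun p (f i j)"
    and sc: "i < n \<Longrightarrow> j < m i \<Longrightarrow> strongly_convex p \<mu> (f i j)"
    and sm: "i < n \<Longrightarrow> j < m i \<Longrightarrow> smooth p L (f i j)"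
    and ds: "doubly_stochastic n W" and \<sigma>: "second_singular_value W < 1"
    and min: "is_arg_min (global_obj n m f) (\<lambda>x. x \<in> carrier_vec p) xstar"
    and \<alpha>: "\<alpha> = 1 / 2000 * (1 - second_singular_value W)\<^sup>2 * \<mu> / L\<^sup>2" and K: "1 \<le> K"
    and x0: "i < n \<Longrightarrow> x0 i \<in> carrier_vec p"
begin

definition flat :: "(nat \<times> nat \<times> nat \<Rightarrow> nat) \<Rightarrow> nat \<Rightarrow> gt_state" where
  "flat s q = gt_inner p n m f W \<alpha> s (q div K) (gt_svrg p n m f W \<alpha> K x0 s (q div K)) (q mod K)"

lemma flat_mult: "flat s (t * K) = gt_svrg p n m f W \<alpha> K x0 s t"
  using K by (simp add: flat_def)

text \<open>The consecutive numbering has no exception at a loop boundary: the state that starts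
  outer iteration \<open>t + 1\<close> is by definition the result of the \<open>K\<close>-th inner
  step of iteration \<open>t\<close>, taken with the snapshot of \<open>t\<close>.\<close>

lemma flat_Suc:
  "flat s (Suc q) = gt_step p n m f W \<alpha> (st_x (flat s (q div K * K))) (\<lambda>i. s (draw_index K q i)) (flat s q)"
proof (cases "Suc (q mod K) = K")
  case True
  have "Suc q = q div K * K + K" using True div_mult_mod_eq[of q K] by linarith
  hence "Suc q = Suc (q div K) * K" by simp
  hence "flat s (Suc q) = gt_svrg p n m f W \<alpha> K x0 s (Suc (q div K))" by (simp only: flat_mult)
  also have "\<dots> = gt_inner p n m f W \<alpha> s (q div K) (gt_svrg p n m f W \<alpha> K x0 s (q div K)) (Suc (q mod K))"
    by (simp add: True)
  finally show ?thesis unfolding flat_mult by (simp add: flat_def draw_index_def)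
next
  case False
  hence "Suc q mod K = Suc (q mod K)" "Suc q div K = q div K" using K by (auto simp: mod_Suc div_Suc)
  thus ?thesis unfolding flat_mult by (simp add: flat_def draw_index_def)
qed

lemma flat_0: "flat s 0 = \<lparr>st_x = x0, st_y = (\<lambda>i. grad p (local_obj m f i) (x0 i)),
      st_v = (\<lambda>i. grad p (local_obj m f i) (x0 i))\<rparr>"
  by (simp add: flat_def)

lemma flat_x_Suc: "st_x (flat s (Suc q)) i = mix p n W (st_x (flat s q)) i - \<alpha> \<cdot>\<^sub>v st_y (flat s q) i"
  and flat_v_Suc: "st_v (flat s (Suc q)) i =
    grad p (f i (s (draw_index K q i))) (st_x (flat s (Suc q)) i)
    - grad p (f i (s (draw_index K q i))) (st_x (flat s (q div K * K)) i)
    + grad p (local_obj m f i) (st_x (flat s (q div K * K)) i)"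
  and flat_y_Suc: "st_y (flat s (Suc q)) i = mix p n W (st_y (flat s q)) i + st_v (flat s (Suc q)) i - st_v (flat s q) i"
  unfolding flat_Suc by (simp_all add: gt_step_def Let_def)

lemma mix_cong: "(\<And>r. r < n \<Longrightarrow> z r = z' r) \<Longrightarrow> mix p n W z i = mix p n W z' i"
  by (simp add: mix_def)

text \<open>The update of \<open>x\<close> reads only the old state, so a fresh draw enters
  \<open>v\<close> and \<open>y\<close> first and \<open>x\<close> one step later. This lag is what
  makes the gradient estimate unbiased at the new iterate.\<close>

lemma flat_dep:
  "(\<forall>i<n. depends_on (draws_before n K (q - 1)) (\<lambda>s. st_x (flat s q) i)) \<and>
   (\<forall>i<n. depends_on (draws_before n K q) (\<lambda>s. st_y (flat s q) i)) \<and>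
   (\<forall>i<n. depends_on (draws_before n K q) (\<lambda>s. st_v (flat s q) i))"
proof (induction q rule: less_induct)
  case (less q)
  show ?case
  proof (cases q)
    case 0 thus ?thesis by (simp add: flat_0 depends_on_def)
  next
    case (Suc q')
    let ?z = "q' div K * K"
    have zq: "?z \<le> q'" by simp
    have xx: "st_x (flat s q'') i = st_x (flat s' q'') i"
      if "\<forall>c\<in>draws_before n K q'. s c = s' c" "i < n" "q'' \<le> q'" for s s' i q''
    proof -
      have "depends_on (draws_before n K (q'' - 1)) (\<lambda>s. st_x (flat s q'') i)" using less[of q''] that Suc by auto
      moreover have "draws_before n K (q'' - 1) \<subseteq> draws_before n K q'" using that by (intro draws_before_mono) simp
      ultimately show ?thesis using that by (auto simp: depends_on_def)
    qed
    have yy: "st_y (flat s q') i = st_y (flat s' q') i" "st_v (flat s q') i = st_v (flat s' q') i"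
      if "\<forall>c\<in>draws_before n K q'. s c = s' c" "i < n" for s s' i
      using less[of q'] Suc that by (auto simp: depends_on_def)
    have x: "st_x (flat s (Suc q')) i = st_x (flat s' (Suc q')) i"
      if "\<forall>c\<in>draws_before n K q'. s c = s' c" "i < n" for s s' i
      unfolding flat_x_Suc
      by (intro arg_cong2[where f = "(-)"] arg_cong[where f = "\<lambda>v. \<alpha> \<cdot>\<^sub>v v"] mix_cong xx yy that order_refl)
    have v: "st_v (flat s (Suc q')) i = st_v (flat s' (Suc q')) i"
      if a: "\<forall>c\<in>draws_before n K (Suc q'). s c = s' c" and i: "i < n" for s s' i
    proof -
      have a': "\<forall>c\<in>draws_before n K q'. s c = s' c" using a draws_before_mono[of q' "Suc q'"] by auto
      have "draw_index K q' i \<in> draws_before n K (Suc q')" using i by (auto simp: draws_before_def)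
      thus ?thesis using a by (simp add: flat_v_Suc x[OF a' i] xx[OF a' i zq])
    qed
    have y: "st_y (flat s (Suc q')) i = st_y (flat s' (Suc q')) i"
      if a: "\<forall>c\<in>draws_before n K (Suc q'). s c = s' c" and i: "i < n" for s s' i
    proof -
      have a': "\<forall>c\<in>draws_before n K q'. s c = s' c" using a draws_before_mono[of q' "Suc q'"] by auto
      show ?thesis unfolding flat_y_Suc
        by (intro arg_cong2[where f = "(-)"] arg_cong2[where f = "(+)"] mix_cong yy a' i v a)
    qed
    show ?thesis unfolding Suc depends_on_def using x v y by auto
  qed
qed

lemma local_obj_eq: "local_obj m f i = (\<lambda>y. 1 / real (m i) * (\<Sum>j<m i. f i j y))"
  by (simp add: local_obj_def fun_eq_iff)

lemma diff_local: "i < n \<Longrightarrow> differentiable_fun p (local_obj m f i)"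
  unfolding local_obj_eq by (rule grad_weighted_sum) (auto intro: diff)

lemma flat_carrier:
  assumes s: "valid_draws n m s"
  shows "\<forall>i<n. st_x (flat s q) i \<in> carrier_vec p \<and> st_y (flat s q) i \<in> carrier_vec p \<and> st_v (flat s q) i \<in> carrier_vec p"
proof (induction q rule: less_induct)
  case (less q)
  show ?case
  proof (cases q)
    case 0 thus ?thesis by (simp add: flat_0 x0 grad_carrier diff_local)
  next
    case (Suc q')
    have "q' div K * K < q" using Suc by (simp add: le_imp_less_Suc)
    hence z: "st_x (flat s (q' div K * K)) i \<in> carrier_vec p" if "i < n" for i using less that by blast
    have IH: "st_y (flat s q') i \<in> carrier_vec p" "st_v (flat s q') i \<in> carrier_vec p" if "i < n" for i
      using less[of q'] Suc that by auto
    have mx: "mix p n W u i \<in> carrier_vec p" for u i by (simp add: mix_def)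
    have x: "st_x (flat s (Suc q')) i \<in> carrier_vec p" if "i < n" for i
      unfolding flat_x_Suc using IH[OF that] mx by auto
    have v: "st_v (flat s (Suc q')) i \<in> carrier_vec p" if i: "i < n" for i
    proof -
      have "s (draw_index K q' i) < m i" using s i by (simp add: valid_draws_def draw_index_def)
      thus ?thesis unfolding flat_v_Suc
        using grad_carrier[OF diff[OF i] x[OF i]] grad_carrier[OF diff[OF i] z[OF i]] grad_carrier[OF diff_local[OF i] z[OF i]]
        by auto
    qed
    have y: "st_y (flat s (Suc q')) i \<in> carrier_vec p" if "i < n" for i
      unfolding flat_y_Suc using IH[OF that] v[OF that] mx by auto
    show ?thesis using x y v Suc by auto
  qed
qed

lemma xstar: "xstar \<in> carrier_vec p"
  using min by (simp add: is_arg_min_def)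

lemma sum_gradV_xstar: "(\<Sum>i<n. gradV p (local_obj m f i) (emb xstar)) = 0"
proof -
  have g: "global_obj n m f = (\<lambda>y. 1 / real n * (\<Sum>i<n. local_obj m f i y))"
    by (simp add: global_obj_def fun_eq_iff)
  have "differentiable_fun p (global_obj n m f)"
    unfolding g by (rule grad_weighted_sum) (auto intro: diff_local)
  from has_gradient_minimizer[OF has_gradient_grad[OF this xstar] xstar]
  have "emb (grad p (global_obj n m f) xstar) = 0"
    using min by (auto simp: is_arg_min_linorder)
  hence "(1 / real n) *\<^sub>R (\<Sum>i<n. emb (grad p (local_obj m f i) xstar)) = 0"
    unfolding g by (subst (asm) grad_weighted_sum(2)) (auto intro: diff_local xstar)
  thus ?thesis using n by (simp add: gradV_def unemb_emb[OF xstar])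
qed

text \<open>Monotonicity and the Lipschitz bound are compared at two points at distance 1;
  \<open>1 \<le> p\<close> provides them.\<close>

lemma \<mu>_le_L: "\<mu> \<le> L"
proof -
  have m0: "0 < n" "0 < m 0" using n m[of 0] by auto
  let ?u = "emb (unit_vec p 0)" and ?z = "emb (0\<^sub>v p)" and ?g = "gradV p (f 0 0)"
  have H: "?u \<in> emb ` carrier_vec p" "?z \<in> emb ` carrier_vec p" by auto
  have uz: "?u - ?z = ?u" by (simp add: emb_zero)
  have "(norm ?u)\<^sup>2 = 1" using p by (simp add: power2_norm_eq_inner inner_emb[of _ p])
  hence nu: "norm ?u = 1" using power2_eq_imp_eq[of "norm ?u" 1] by simp
  have "\<mu> * (norm (?u - ?z))\<^sup>2 \<le> inner (?g ?u - ?g ?z) (?u - ?z)"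
    by (rule gradV_strongly_monotone[OF diff sc H]) (use m0 in auto)
  also have "\<dots> \<le> norm (?g ?u - ?g ?z) * norm (?u - ?z)" by (rule norm_cauchy_schwarz)
  also have "\<dots> \<le> (L * norm (?u - ?z)) * norm (?u - ?z)"
    by (intro mult_right_mono gradV_lipschitz[OF diff sm H]) (use m0 in auto)
  finally show ?thesis by (simp add: uz nu)
qed

lemma dep_emb: "depends_on J F \<Longrightarrow> depends_on J (\<lambda>s. emb (F s))"
  unfolding depends_on_def by metis

sublocale gt_process n m "\<lambda>i r. W $$ (i, r)" "\<lambda>i j. gradV p (f i j)" "\<lambda>i. gradV p (local_obj m f i)"
  "emb ` carrier_vec p" "emb xstar" \<alpha> "1 - second_singular_value W" L \<mu> K "\<lambda>i. emb (x0 i)"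
  "\<lambda>q i s. emb (st_x (flat s q) i)" "\<lambda>q i s. emb (st_y (flat s q) i)" "\<lambda>q i s. emb (st_v (flat s q) i)"
proof
  note sv = second_singular_value_contraction[OF n ds \<sigma>]
  show "0 < 1 - second_singular_value W" "1 - second_singular_value W \<le> 1" using sv(1) \<sigma> by auto
  show "(\<Sum>i<n. (norm (\<Sum>r<n. W $$ (i, r) *\<^sub>R z r))\<^sup>2) \<le> (1 - (1 - second_singular_value W))\<^sup>2 * (\<Sum>i<n. (norm (z i))\<^sup>2)"
    if "(\<Sum>i<n. z i) = 0" for z :: "nat \<Rightarrow> fsvec"
    using fsvec_mix_contraction[OF sv(2) that] by simp
  show "\<And>i. i < n \<Longrightarrow> (\<Sum>r<n. W $$ (i, r)) = 1" "\<And>r. r < n \<Longrightarrow> (\<Sum>i<n. W $$ (i, r)) = 1"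
    using ds by (auto simp: doubly_stochastic_def)
  show "gradV p (f i j) a \<in> emb ` carrier_vec p" if "i < n" "j < m i" "a \<in> emb ` carrier_vec p" for i j a
    unfolding gradV_def by (intro imageI grad_carrier diff that) auto
  show "gradV p (local_obj m f i) a = (1 / real (m i)) *\<^sub>R (\<Sum>j<m i. gradV p (f i j) a)"
    if "i < n" "a \<in> emb ` carrier_vec p" for i a
    unfolding gradV_def local_obj_eq by (rule grad_weighted_sum(2)) (auto intro: diff that)
  show "(\<Sum>i<n. gradV p (local_obj m f i) (emb xstar)) = 0" by (rule sum_gradV_xstar)
  show "\<alpha> = 1 / 2000 * (1 - second_singular_value W)\<^sup>2 * \<mu> / L\<^sup>2" by (rule \<alpha>)
  show "norm (gradV p (f i j) a - gradV p (f i j) b) \<le> L * norm (a - b)"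
    "\<mu> * (norm (a - b))\<^sup>2 \<le> inner (gradV p (f i j) a - gradV p (f i j) b) (a - b)"
    if "i < n" "j < m i" "a \<in> emb ` carrier_vec p" "b \<in> emb ` carrier_vec p" for i j a b
    by (intro gradV_lipschitz gradV_strongly_monotone diff sc sm that)+
  fix s :: "nat \<times> nat \<times> nat \<Rightarrow> nat" and i q assume s: "valid_draws n m s" and i: "i < n"
  have c: "st_x (flat s q) r \<in> carrier_vec p" "st_y (flat s q) r \<in> carrier_vec p" "st_v (flat s q) r \<in> carrier_vec p"
    if "r < n" for r q
    using flat_carrier[OF s] that by auto
  have mx: "mix p n W u i \<in> carrier_vec p" for u i by (simp add: mix_def)
  show "emb (st_x (flat s (Suc q)) i) = (\<Sum>r<n. W $$ (i, r) *\<^sub>R emb (st_x (flat s q) r)) - \<alpha> *\<^sub>R emb (st_y (flat s q) i)"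
    unfolding flat_x_Suc
    by (subst emb_diff[of _ p]) (use c i mx in \<open>auto simp: emb_smult emb_mix\<close>)
  have j: "s (draw_index K q i) < m i" using s i by (simp add: valid_draws_def draw_index_def)
  have gc: "grad p (f i (s (draw_index K q i))) (st_x (flat s q') i) \<in> carrier_vec p"
    "grad p (local_obj m f i) (st_x (flat s q') i) \<in> carrier_vec p" for q'
    using grad_carrier[OF diff[OF i j] c(1)[OF i]] grad_carrier[OF diff_local[OF i] c(1)[OF i]] by auto
  show "emb (st_v (flat s (Suc q)) i) =
      gradV p (f i (s (draw_index K q i))) (emb (st_x (flat s (Suc q)) i)) -
      gradV p (f i (s (draw_index K q i))) (emb (st_x (flat s (q div K * K)) i)) +
      gradV p (local_obj m f i) (emb (st_x (flat s (q div K * K)) i))"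
    unfolding flat_v_Suc gradV_def unemb_emb[OF c(1)[OF i]]
    using gc by (simp add: emb_add[of _ p] emb_diff[of _ p])
  show "emb (st_y (flat s (Suc q)) i) =
      (\<Sum>r<n. W $$ (i, r) *\<^sub>R emb (st_y (flat s q) r)) + emb (st_v (flat s (Suc q)) i) - emb (st_v (flat s q) i)"
    unfolding flat_y_Suc
    using c i mx by (simp add: emb_add[of _ p] emb_diff[of _ p] emb_mix)
qed (use n m \<mu> \<mu>_le_L K x0 xstar flat_dep in
  \<open>auto simp: subspace_emb flat_0 gradV_def unemb_emb intro!: dep_emb\<close>)

lemma error_rate:
  assumes "32 / (\<alpha> * \<mu>) \<le> real K"
  shows "\<exists>P\<ge>0. \<forall>t. \<forall>i<n.
    integrable (draws n m) (\<lambda>s. (eucl_norm (st_x (gt_svrg p n m f W \<alpha> K x0 s t) i - xstar))\<^sup>2) \<and>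
    integral\<^sup>L (draws n m) (\<lambda>s. (eucl_norm (st_x (gt_svrg p n m f W \<alpha> K x0 s t) i - xstar))\<^sup>2) \<le> P * (3 / 4) ^ t"
proof -
  obtain P where P: "0 \<le> P" "\<And>t. E (DD (t * K)) \<le> P * (3 / 4) ^ t"
    using geometric_rate[OF assms] by auto
  show ?thesis
  proof (intro exI[of _ P] conjI allI impI P(1))
    fix t i assume i: "i < n"
    let ?F = "\<lambda>s. (eucl_norm (st_x (gt_svrg p n m f W \<alpha> K x0 s t) i - xstar))\<^sup>2"
    have "depends_on (draws_before n K (t * K - 1)) ?F"
      using flat_dep[of "t * K"] i unfolding flat_mult depends_on_def by metis
    thus int: "integrable (draws n m) ?F" by (rule integrable_dep)
    have "E ?F \<le> E (DD (t * K))"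
    proof (rule E_mono[OF int])
      fix s assume s: "valid_draws n m s"
      have "?F s = (norm (emb (st_x (flat s (t * K)) i) - emb xstar))\<^sup>2"
        using flat_carrier[OF s, of "t * K"] i xstar by (simp add: flat_mult norm_emb flip: emb_diff[of _ p])
      also have "\<dots> \<le> DD (t * K) s"
        unfolding DD_def using i by (intro member_le_sum) auto
      finally show "?F s \<le> DD (t * K) s" .
    qed simp
    thus "E ?F \<le> P * (3 / 4) ^ t" using P(2) order_trans by blast
  qed
qed

end

text \<open>\<open>32 / (\<alpha> * \<mu>)\<close> is \<open>32 * 2000\<close> times
  \<open>Q\<^sup>2 / \<delta>\<^sup>2\<close>. As \<open>Q\<^sup>2 / \<delta>\<^sup>2\<close> is at
  least 1, the extra 1000 in the upper bound pays for rounding up.\<close>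

lemma inner_loop_length_bound:
  fixes \<mu> L \<delta> :: real
  assumes "0 < \<mu>" "\<mu> \<le> L" "0 < \<delta>" "\<delta> \<le> 1"
  defines "\<alpha> \<equiv> 1 / 2000 * \<delta>\<^sup>2 * \<mu> / L\<^sup>2" and "Q \<equiv> L / \<mu>"
  defines "K \<equiv> nat \<lceil>32 / (\<alpha> * \<mu>)\<rceil>"
  shows "32 / (\<alpha> * \<mu>) \<le> real K" and "real K \<le> 65000 * (Q\<^sup>2 / \<delta>\<^sup>2)" and "1 \<le> K"
proof -
  have L: "0 < L" using assms by simp
  have "1 \<le> Q" using assms by simp
  hence "1 \<le> Q\<^sup>2" by (simp add: one_le_power)
  moreover have "\<delta>\<^sup>2 \<le> 1" "0 < \<delta>\<^sup>2" using assms by (auto simp: power_le_one)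
  ultimately have Q: "1 \<le> Q\<^sup>2 / \<delta>\<^sup>2" by (simp add: field_simps)
  have e: "32 / (\<alpha> * \<mu>) = 64000 * (Q\<^sup>2 / \<delta>\<^sup>2)"
    using assms(1,3) L by (simp add: \<alpha>_def Q_def field_simps power2_eq_square)
  show "32 / (\<alpha> * \<mu>) \<le> real K" unfolding K_def by (rule real_nat_ceiling_ge)
  show "real K \<le> 65000 * (Q\<^sup>2 / \<delta>\<^sup>2)" "1 \<le> K" unfolding K_def e using Q by linarith+
qed

theorem theorem1:
  shows "\<exists>C::real. C > 0 \<and>
    (\<forall>(p::nat) (n::nat) (m :: nat \<Rightarrow> nat) (f :: nat \<Rightarrow> nat \<Rightarrow> real vec \<Rightarrow> real)
       (W :: real mat) (\<mu>::real) (L::real) (xstar :: real vec) (\<sigma>::real) (M::nat) (Q::real).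
      n \<ge> 1 \<longrightarrow>
      (\<forall>i<n. m i \<ge> 1) \<longrightarrow>
      \<mu> > 0 \<longrightarrow> L > 0 \<longrightarrow>
      (\<forall>i<n. \<forall>j<m i. differentiable_fun p (f i j) \<and> strongly_convex p \<mu> (f i j) \<and> smooth p L (f i j)) \<longrightarrow>
      primitive_matrix n W \<longrightarrow> doubly_stochastic n W \<longrightarrow>
      \<sigma> = second_singular_value W \<longrightarrow> \<sigma> < 1 \<longrightarrow>
      M = Max (m ` {..<n}) \<longrightarrow> Q = L / \<mu> \<longrightarrow>
      is_arg_min (global_obj n m f) (\<lambda>x. x \<in> carrier_vec p) xstar \<longrightarrow>
      (\<exists>\<alpha>>0. \<exists>K\<ge>1. \<forall>x0 :: nat \<Rightarrow> real vec. (\<forall>i<n. x0 i \<in> carrier_vec p) \<longrightarrow>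
        (\<exists>\<epsilon>0>0. \<forall>\<epsilon>. 0 < \<epsilon> \<and> \<epsilon> < \<epsilon>0 \<longrightarrow>
          (\<exists>t. \<forall>i<n.
             integrable (draws n m)
               (\<lambda>s. (eucl_norm (st_x (gt_svrg p n m f W \<alpha> K x0 s t) i - xstar))\<^sup>2) \<and>
             integral\<^sup>L (draws n m)
               (\<lambda>s. (eucl_norm (st_x (gt_svrg p n m f W \<alpha> K x0 s t) i - xstar))\<^sup>2) \<le> \<epsilon> \<and>
             real (component_grads m K i t)
               \<le> C * (real M + Q\<^sup>2 / (1 - \<sigma>)\<^sup>2) * ln (1 / \<epsilon>)))))"
\<comment> \<open>There are at most \<open>9 * ln (1 / \<epsilon>)\<close> outer iterations, each of
  cost at most \<open>130000 * (M + Q\<^sup>2 / (1 - \<sigma>)\<^sup>2)\<close>; the product 1170000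
  is rounded up.\<close>
proof (rule exI[of _ "1200000::real"], intro conjI allI impI)
  fix p n :: nat and m :: "nat \<Rightarrow> nat" and f :: "nat \<Rightarrow> nat \<Rightarrow> real vec \<Rightarrow> real"
    and W :: "real mat" and \<mu> L :: real and xstar :: "real vec" and \<sigma> :: real and M :: nat and Q :: real
  assume n: "1 \<le> n" and m: "\<forall>i<n. 1 \<le> m i" and \<mu>: "0 < \<mu>" and L: "0 < L"
    and f: "\<forall>i<n. \<forall>j<m i. differentiable_fun p (f i j) \<and> strongly_convex p \<mu> (f i j) \<and> smooth p L (f i j)"
    and ds: "doubly_stochastic n W" and \<sigma>: "\<sigma> = second_singular_value W" "\<sigma> < 1"
    and M: "M = Max (m ` {..<n})" and Q: "Q = L / \<mu>"
    and min: "is_arg_min (global_obj n m f) (\<lambda>x. x \<in> carrier_vec p) xstar"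
  have rate0: "0 \<le> real M + Q\<^sup>2 / (1 - \<sigma>)\<^sup>2" by simp
  show "\<exists>\<alpha>>0. \<exists>K\<ge>1. \<forall>x0 :: nat \<Rightarrow> real vec. (\<forall>i<n. x0 i \<in> carrier_vec p) \<longrightarrow>
        (\<exists>\<epsilon>0>0. \<forall>\<epsilon>. 0 < \<epsilon> \<and> \<epsilon> < \<epsilon>0 \<longrightarrow>
          (\<exists>t. \<forall>i<n.
             integrable (draws n m)
               (\<lambda>s. (eucl_norm (st_x (gt_svrg p n m f W \<alpha> K x0 s t) i - xstar))\<^sup>2) \<and>
             integral\<^sup>L (draws n m)
               (\<lambda>s. (eucl_norm (st_x (gt_svrg p n m f W \<alpha> K x0 s t) i - xstar))\<^sup>2) \<le> \<epsilon> \<and>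
             real (component_grads m K i t)
               \<le> 1200000 * (real M + Q\<^sup>2 / (1 - \<sigma>)\<^sup>2) * ln (1 / \<epsilon>)))"
    \<comment> \<open>For \<open>p = 0\<close> the hypotheses do not force \<open>\<mu> \<le> L\<close>, but every distance is 0.\<close>
  proof (cases "p = 0")
    case True
    have "xstar \<in> carrier_vec 0" using min True by (simp add: is_arg_min_def)
    hence norm0: "eucl_norm (u - xstar) = 0" for u by (simp add: eucl_norm_def scalar_prod_def)
    have "\<exists>\<epsilon>0>0. \<forall>\<epsilon>. 0 < \<epsilon> \<and> \<epsilon> < \<epsilon>0 \<longrightarrow> (\<exists>t. \<forall>i<n.
             integrable (draws n m)
               (\<lambda>s. (eucl_norm (st_x (gt_svrg p n m f W 1 1 x0 s t) i - xstar))\<^sup>2) \<and>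
             integral\<^sup>L (draws n m)
               (\<lambda>s. (eucl_norm (st_x (gt_svrg p n m f W 1 1 x0 s t) i - xstar))\<^sup>2) \<le> \<epsilon> \<and>
             real (component_grads m 1 i t)
               \<le> 1200000 * (real M + Q\<^sup>2 / (1 - \<sigma>)\<^sup>2) * ln (1 / \<epsilon>))" for x0
    proof (rule exI[of _ "1::real"], intro conjI allI impI)
      fix \<epsilon> :: real assume \<epsilon>: "0 < \<epsilon> \<and> \<epsilon> < 1"
      hence "0 \<le> ln (1 / \<epsilon>)" by simp
      thus "\<exists>t. \<forall>i<n.
             integrable (draws n m)
               (\<lambda>s. (eucl_norm (st_x (gt_svrg p n m f W 1 1 x0 s t) i - xstar))\<^sup>2) \<and>
             integral\<^sup>L (draws n m)
               (\<lambda>s. (eucl_norm (st_x (gt_svrg p n m f W 1 1 x0 s t) i - xstar))\<^sup>2) \<le> \<epsilon> \<and>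
             real (component_grads m 1 i t)
               \<le> 1200000 * (real M + Q\<^sup>2 / (1 - \<sigma>)\<^sup>2) * ln (1 / \<epsilon>)"
        using \<epsilon> rate0 by (intro exI[of _ 0]) (simp add: norm0 component_grads_def)
    qed simp
    thus ?thesis
      by (intro exI[of _ "1::real"] conjI, simp, intro exI[of _ "1::nat"] conjI allI impI, simp)
  next
    case False
    define \<delta> where "\<delta> = 1 - \<sigma>"
    define \<alpha> where "\<alpha> = 1 / 2000 * \<delta>\<^sup>2 * \<mu> / L\<^sup>2"
    define K where "K = nat \<lceil>32 / (\<alpha> * \<mu>)\<rceil>"
    have \<delta>: "0 < \<delta>" "\<delta> \<le> 1"
      using second_singular_value_contraction(1)[OF n ds] \<sigma> by (auto simp: \<delta>_def)
    \<comment> \<open>Stated for every loop length, since \<open>1 \<le> K\<close> itself rests on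
      \<open>\<mu> \<le> L\<close>, which is extracted with loop length 1 and zero starting
      points.\<close>
    have problem: "gt_problem p n m f W \<mu> L xstar \<alpha> K' x0"
      if "\<forall>i<n. x0 i \<in> carrier_vec p" "1 \<le> K'" for x0 K'
      using False n m \<mu> f ds \<sigma> min that by unfold_locales (auto simp: \<alpha>_def \<delta>_def)
    have "\<mu> \<le> L" using gt_problem.\<mu>_le_L[OF problem[of "\<lambda>_. 0\<^sub>v p" 1]] by simp
    note Kb = inner_loop_length_bound[OF \<mu> this \<delta>, folded \<alpha>_def Q, folded K_def]
    have \<alpha>0: "0 < \<alpha>" using \<delta> \<mu> L by (simp add: \<alpha>_def)
    have "\<exists>\<epsilon>0>0. \<forall>\<epsilon>. 0 < \<epsilon> \<and> \<epsilon> < \<epsilon>0 \<longrightarrow>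
          (\<exists>t. \<forall>i<n.
             integrable (draws n m)
               (\<lambda>s. (eucl_norm (st_x (gt_svrg p n m f W \<alpha> K x0 s t) i - xstar))\<^sup>2) \<and>
             integral\<^sup>L (draws n m)
               (\<lambda>s. (eucl_norm (st_x (gt_svrg p n m f W \<alpha> K x0 s t) i - xstar))\<^sup>2) \<le> \<epsilon> \<and>
             real (component_grads m K i t)
               \<le> 1200000 * (real M + Q\<^sup>2 / (1 - \<sigma>)\<^sup>2) * ln (1 / \<epsilon>))"
      if x0: "\<forall>i<n. x0 i \<in> carrier_vec p" for x0
    proof -
      let ?F = "\<lambda>t i s. (eucl_norm (st_x (gt_svrg p n m f W \<alpha> K x0 s t) i - xstar))\<^sup>2"
      obtain P where P: "0 \<le> P" "\<And>t i. i < n \<Longrightarrow> integrable (draws n m) (?F t i) \<and>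
          integral\<^sup>L (draws n m) (?F t i) \<le> P * (3 / 4) ^ t"
        using gt_problem.error_rate[OF problem[OF x0 Kb(3)] Kb(1)] by blast
      obtain \<epsilon>0 where \<epsilon>0: "0 < \<epsilon>0" "\<epsilon>0 \<le> 1"
        "\<And>\<epsilon>. 0 < \<epsilon> \<Longrightarrow> \<epsilon> < \<epsilon>0 \<Longrightarrow> \<exists>t::nat. P * (3 / 4) ^ t \<le> \<epsilon> \<and> real t \<le> 9 * ln (1 / \<epsilon>)"
        using geometric_decay_iterations[OF P(1)] by blast
      show ?thesis
      proof (intro exI[of _ \<epsilon>0] conjI allI impI \<epsilon>0(1))
        fix \<epsilon> assume "0 < \<epsilon> \<and> \<epsilon> < \<epsilon>0"
        hence \<epsilon>: "0 < \<epsilon>" "\<epsilon> < \<epsilon>0" by auto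
        obtain t where t: "P * (3 / 4) ^ t \<le> \<epsilon>" "real t \<le> 9 * ln (1 / \<epsilon>)" using \<epsilon>0(3)[OF \<epsilon>] by blast
        have l0: "0 \<le> ln (1 / \<epsilon>)" using \<epsilon> \<epsilon>0(2) by simp
        have "real (component_grads m K i t) \<le> 1200000 * (real M + Q\<^sup>2 / (1 - \<sigma>)\<^sup>2) * ln (1 / \<epsilon>)" if i: "i < n" for i
        proof -
          have "m i \<le> M" unfolding M using i by (intro Max_ge) auto
          hence "real (m i) + 2 * real K \<le> real M + 130000 * (Q\<^sup>2 / \<delta>\<^sup>2)" using Kb(2) by linarith
          also have "\<dots> \<le> 130000 * (real M + Q\<^sup>2 / (1 - \<sigma>)\<^sup>2)" by (simp add: \<delta>_def)
          finally have "real t * (real (m i) + 2 * real K) \<le> (9 * ln (1 / \<epsilon>)) * (130000 * (real M + Q\<^sup>2 / (1 - \<sigma>)\<^sup>2))"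
            using t(2) l0 by (intro mult_mono) auto
          also have "\<dots> = 1170000 * ((real M + Q\<^sup>2 / (1 - \<sigma>)\<^sup>2) * ln (1 / \<epsilon>))" by simp
          also have "\<dots> \<le> 1200000 * ((real M + Q\<^sup>2 / (1 - \<sigma>)\<^sup>2) * ln (1 / \<epsilon>))"
            using rate0 l0 by (intro mult_right_mono mult_nonneg_nonneg) auto
          finally show ?thesis
            by (simp only: component_grads_def mult.assoc of_nat_mult of_nat_add of_nat_numeral)
        qed
        thus "\<exists>t. \<forall>i<n. integrable (draws n m) (?F t i) \<and> integral\<^sup>L (draws n m) (?F t i) \<le> \<epsilon> \<and>
             real (component_grads m K i t) \<le> 1200000 * (real M + Q\<^sup>2 / (1 - \<sigma>)\<^sup>2) * ln (1 / \<epsilon>)"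
          using P(2) t(1) order_trans by blast
      qed
    qed
    thus ?thesis
      by (intro exI[of _ \<alpha>] conjI \<alpha>0, intro exI[of _ K] conjI Kb(3) allI impI)
  qed
qed simp

end
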